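(* The Merkle Mountain Belt (MMB), with the membership and increment proofs described in the context, is a succinct, incremental and optimally additive commitment scheme for an append-only list $X$. More precisely, for $n=|X|$: the commitment consists of $O(1)$ hashes; the manager needs $O(\log n)$ memory and $O(1)$ time per append; and a participant needs $O(\log n)$ memory and $O(\log k)$ communication and computational complexity to perform any of the four resync operations (updating the commitment from $\langle X_m\rangle$ to $\langle X_n\rangle$; retrieving and verifying the increment proof $\pi_{X_m\prec X_n}$; retrieving and verifying a new membership proof $\pi_{x_i\in X_n}$ with $m<i\le n$; updating and verifying an old membership proof from $\pi_{x_i\in X_m}$ to $\pi_{x_i\in X_n}$) after a $k$-increment from $X_m$ to $X_n$, $k=n-m\ge 1$.
   Context: Setting. $X=(x_1,x_2,\dots)$ is an append-only list of bit strings; $X_n=(x_1,\dots,x_n)$ is its state after $n$ appends; a $k$-increment is the change from state $X_m$ to $X_n$ with $k=n-m$. $H$ is a fixed public collision-resistant hash function; the leaf of $x_i$ is $h_i=H(x_i)$, and every non-leaf node is labelled with $H(\text{left}\,\|\,\text{right})$ of its children (a node with a single child uses a fixed default value for the missing child). Costs of computing leaf hashes are ignored. A manager performs appends and keeps the structure updated, publishing the commitment and all new node hashes on a public board; participants retrieve data and verify it. "Communication and computational complexity" (CCC) counts hashes transmitted and hash computations/elementary operations. U-MMB. A mountain of height $s\ge 0$ is a perfect binary tree with $2^s$ leaves; its root is its peak. The U-MMB for $X_n$ is an ordered (left-to-right) list of mountains whose leaves, read left to right, are $h_1,\dots,h_n$. It is built inductively from the empty list: to append $x_n$, (1) add $h_n$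 as a height-0 mountain at the right end; (2) if some two consecutive mountains have equal height (a mergeable pair), take the rightmost such pair, of height $s$, and replace it in place by one mountain of height $s+1$ whose new peak has the two old peaks as children. MMB. The U-MMB mountain list is partitioned into ranges: two consecutive mountains $M,M'$ ($M$ immediately left of $M'$) lie in different ranges iff their heights differ by 2, or the mountain immediately left of $M$ exists and has the same height as $M$. For a range with peaks $P_1,\dots,P_r$ (left to right), range nodes are $R_1$ (single child $P_1$) and $R_j$ with children $R_{j-1},P_j$; $R_r$ is the range root. For ranges with roots $Q_1,\dots,Q_q$ (left to right), belt nodes are $B_1$ (single child $Q_1$) and $B_j$ with children $B_{j-1},Q_j$; $B_q$ is the root, whose hash is the commitment $\langle X_n\rangle$. The membership proof $\pi_{x_i\in X_n}$ is the list of hashes (with handedness) of the siblings of the nodes on the path from $h_i$ to the root (a missing sibling contributes nothing); it is verified by recomputing the root. An increment proof $\pi_{X_m\prec X_n}$ is a set $C_n$ of pairwise non-ancestral nodes of the MMB for $X_n$ whose descendant leaves are exactly $h_1,\dots,h_n$, containing a subset $C_m$ whose descendant leaves are exactly $h_1,\dots,h_m$, together with instructions, such that the root of the MMB for $X_m$ is derivable from $C_m$ and the root for $X_n$ from $C_n$ by repeatedly replacing two siblings by their parent; it is verified against $\langle X_m\rangle$ and $\langle X_n\rangle$. Properties. Succinct: retrieving the current commitment, retrieving and verifying any membership proof, and retrieving and verifying any increment proof each have CCC polylogarithmic in $n$. Incremental: after a $k$-increment, each of the four resync operations listed in the claim has CCC depending only on $k$, not on $n$. Optimally additive: an append together with the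 corresponding update of the scheme and commitment takes the manager $O(1)$ time. *)

theory Defs
  imports Complex_Main "HOL-Library.Landau_Symbols" "HOL-Library.Sublist"
begin

section \<open>The Merkle mountain belt\<close>

text \<open>
  A node is identified with the tree below it. This makes sense of a node being shared by the
  belts of \<open>X\<^sub>m\<close> and \<open>X\<^sub>n\<close>, since leaves carry their index. \<open>Missing\<close> is the absent left child
  of the first range node of a range and of the first belt node; it is not itself a node.
\<close>

datatype tree = Missing | Leaf nat | Node tree tree

type_synonym hash = "bool list"
type_synonym hash_fun = "bool list \<Rightarrow> hash"

fun leaves :: "tree \<Rightarrow> nat set" where
  "leaves Missing = {}"
| "leaves (Leaf i) = {i}"
| "leaves (Node l r) = leaves l \<union> leaves r"

fun nodes :: "tree \<Rightarrow> tree set" where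
  "nodes Missing = {}"
| "nodes (Leaf i) = {Leaf i}"
| "nodes (Node l r) = insert (Node l r) (nodes l \<union> nodes r)"

text \<open>\<open>d\<close> is the default value for a missing child; \<open>x i\<close> is the \<open>i\<close>-th list element, \<open>i \<ge> 1\<close>.\<close>

fun label :: "hash_fun \<Rightarrow> hash \<Rightarrow> (nat \<Rightarrow> bool list) \<Rightarrow> tree \<Rightarrow> hash" where
  "label H d x Missing = d"
| "label H d x (Leaf i) = H (x i)"
| "label H d x (Node l r) = H (label H d x l @ label H d x r)"

fun height :: "tree \<Rightarrow> nat" where
  "height (Node l r) = Suc (max (height l) (height r))"
| "height _ = 0"

fun has_mergeable :: "tree list \<Rightarrow> bool" where
  "has_mergeable (a # b # ts) \<longleftrightarrow> height a = height b \<or> has_mergeable (b # ts)"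
| "has_mergeable _ \<longleftrightarrow> False"

fun merge_rightmost :: "tree list \<Rightarrow> tree list" where
  "merge_rightmost (a # b # ts) =
    (if has_mergeable (b # ts) then a # merge_rightmost (b # ts)
     else if height a = height b then Node a b # ts
     else a # b # ts)"
| "merge_rightmost ts = ts"

fun ummb :: "nat \<Rightarrow> tree list" where
  "ummb 0 = []"
| "ummb (Suc n) = merge_rightmost (ummb n @ [Leaf (Suc n)])"

definition range_boundary :: "tree option \<Rightarrow> tree \<Rightarrow> tree \<Rightarrow> bool" where
  "range_boundary p a b \<longleftrightarrow>
     height a = height b + 2 \<or> height b = height a + 2 \<or>
     (\<exists>c. p = Some c \<and> height c = height a)"

text \<open>The first argument is the mountain immediately to the left of the given list, if any.\<close>

fun ranges :: "tree option \<Rightarrow> tree list \<Rightarrow> tree list list" where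
  "ranges p [] = []"
| "ranges p [a] = [[a]]"
| "ranges p (a # b # ts) =
    (let rs = ranges (Some a) (b # ts)
     in if range_boundary p a b then [a] # rs else (a # hd rs) # tl rs)"

text \<open>Used both for the range nodes over peaks and for the belt nodes over range roots.\<close>

fun chain :: "tree list \<Rightarrow> tree" where
  "chain [] = Missing"
| "chain (t # ts) = foldl Node (Node Missing t) ts"

definition mmb :: "nat \<Rightarrow> tree" where
  "mmb n = chain (map chain (ranges None (ummb n)))"

definition root_hash :: "hash_fun \<Rightarrow> hash \<Rightarrow> (nat \<Rightarrow> bool list) \<Rightarrow> nat \<Rightarrow> hash" where
  "root_hash H d x n = label H d x (mmb n)"

definition commitment :: "hash_fun \<Rightarrow> hash \<Rightarrow> (nat \<Rightarrow> bool list) \<Rightarrow> nat \<Rightarrow> hash list" where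
  "commitment H d x n = [root_hash H d x n]"

section \<open>Membership proofs\<close>

text \<open>
  A missing sibling contributes no hash, but the verifier has to know where the default value
  enters; this is the marker \<open>NoSib\<close>, which is charged for like any other entry.
\<close>

datatype step = LeftSib hash | RightSib hash | NoSib

fun path :: "nat \<Rightarrow> tree \<Rightarrow> tree list" where
  "path i Missing = []"
| "path i (Leaf j) = [Leaf j]"
| "path i (Node l r) = (if i \<in> leaves l then path i l else path i r) @ [Node l r]"

fun siblings :: "hash_fun \<Rightarrow> hash \<Rightarrow> (nat \<Rightarrow> bool list) \<Rightarrow> nat \<Rightarrow> tree \<Rightarrow> step list" where
  "siblings H d x i (Node l r) =
    (if i \<in> leaves l then siblings H d x i l @ [RightSib (label H d x r)]
     else siblings H d x i r @ [if l = Missing then NoSib else LeftSib (label H d x l)])"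
| "siblings H d x i _ = []"

definition membership_proof ::
    "hash_fun \<Rightarrow> hash \<Rightarrow> (nat \<Rightarrow> bool list) \<Rightarrow> nat \<Rightarrow> nat \<Rightarrow> step list" where
  "membership_proof H d x n i = siblings H d x i (mmb n)"

fun climb :: "hash_fun \<Rightarrow> hash \<Rightarrow> hash \<Rightarrow> step \<Rightarrow> hash" where
  "climb H d h (LeftSib g) = H (g @ h)"
| "climb H d h (RightSib g) = H (h @ g)"
| "climb H d h NoSib = H (d @ h)"

definition recompute :: "hash_fun \<Rightarrow> hash \<Rightarrow> hash \<Rightarrow> step list \<Rightarrow> hash" where
  "recompute H d h \<pi> = foldl (climb H d) h \<pi>"

text \<open>
  The number of lowest proof entries that are the same for \<open>X\<^sub>m\<close> and \<open>X\<^sub>n\<close> because the paths from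
  leaf \<open>i\<close> still coincide one node higher up.
\<close>

definition kept :: "nat \<Rightarrow> nat \<Rightarrow> nat \<Rightarrow> nat" where
  "kept m n i = length (longest_common_prefix (path i (mmb m)) (path i (mmb n))) - 1"

section \<open>Increment proofs\<close>

text \<open>
  The instructions rewrite a left-to-right list of nodes into a single one, with the help of a
  stack: \<open>Shift\<close> moves the next node to the stack, \<open>Join\<close> replaces the two topmost nodes by their
  parent, \<open>JoinDefault\<close> replaces the topmost node by its parent with a missing left child.
\<close>

datatype instr = Shift | Join | JoinDefault

fun reduce_nodes :: "('a \<Rightarrow> 'a \<Rightarrow> 'a) \<Rightarrow> 'a \<Rightarrow> instr list \<Rightarrow> 'a list \<Rightarrow> 'a list \<Rightarrow> 'a option" where
  "reduce_nodes f d [] [] [r] = Some r"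
| "reduce_nodes f d (Shift # is) (a # as) st = reduce_nodes f d is as (a # st)"
| "reduce_nodes f d (Join # is) as (b # a # st) = reduce_nodes f d is as (f a b # st)"
| "reduce_nodes f d (JoinDefault # is) as (a # st) = reduce_nodes f d is as (f d a # st)"
| "reduce_nodes f d _ _ _ = None"

text \<open>
  An increment proof \<open>(C, D, is, js)\<close> has \<open>C\<^sub>m = set C\<close> and \<open>C\<^sub>n = set (C @ D)\<close>; \<open>is\<close> and \<open>js\<close> are
  the instructions for the roots of \<open>X\<^sub>m\<close> and \<open>X\<^sub>n\<close>. With node hashes in place of nodes this is
  what is transmitted and verified.
\<close>

type_synonym 'a increment_proof = "'a list \<times> 'a list \<times> instr list \<times> instr list"

definition is_increment_proof :: "nat \<Rightarrow> nat \<Rightarrow> tree increment_proof \<Rightarrow> bool" where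
  "is_increment_proof m n = (\<lambda>(C, D, is, js).
     distinct (C @ D) \<and>
     set (C @ D) \<subseteq> nodes (mmb n) \<and>
     (\<forall>u \<in> set (C @ D). \<forall>v \<in> set (C @ D). u \<in> nodes v \<longrightarrow> u = v) \<and>
     (\<Union>v \<in> set C. leaves v) = {1..m} \<and>
     (\<Union>v \<in> set (C @ D). leaves v) = {1..n} \<and>
     reduce_nodes Node Missing is C [] = Some (mmb m) \<and>
     reduce_nodes Node Missing js (C @ D) [] = Some (mmb n))"

definition hash_increment_proof ::
    "hash_fun \<Rightarrow> hash \<Rightarrow> (nat \<Rightarrow> bool list) \<Rightarrow> tree increment_proof \<Rightarrow> hash increment_proof" where
  "hash_increment_proof H d x =
     (\<lambda>(C, D, is, js). (map (label H d x) C, map (label H d x) D, is, js))"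

definition increment_accepts ::
    "hash_fun \<Rightarrow> hash \<Rightarrow> hash \<Rightarrow> hash \<Rightarrow> hash increment_proof \<Rightarrow> bool" where
  "increment_accepts H d cm cn = (\<lambda>(C, D, is, js).
     reduce_nodes (\<lambda>a b. H (a @ b)) d is C [] = Some cm \<and>
     reduce_nodes (\<lambda>a b. H (a @ b)) d js (C @ D) [] = Some cn)"

section \<open>The cost model\<close>

text \<open>
  A random access machine with unit costs. A memory cell holds a number and a hash. Hashes can only
  be copied, compared, hashed in pairs, received and published; numbers only added, subtracted and
  compared. Every operator of an expression, every command, every received token and every
  published hash costs 1. A program mentions neither the hash function nor the default value,
  so it can obtain hashes only by paying for them.
\<close>

type_synonym memory = "nat \<Rightarrow> nat \<times> hash"
type_synonym token = "nat \<times> hash"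

datatype aexp = Num nat | Val aexp | Plus aexp aexp | Minus aexp aexp
datatype hexp = Default | Cell aexp | Hash hexp hexp
datatype bexp = Less aexp aexp | Same hexp hexp | More | Not bexp
datatype cmd =
    Skip
  | Store aexp aexp
  | StoreHash aexp hexp
  | Fetch aexp
  | Publish hexp
  | Seq cmd cmd
  | If bexp cmd cmd
  | While bexp cmd

fun aval :: "memory \<Rightarrow> aexp \<Rightarrow> nat" where
  "aval M (Num k) = k"
| "aval M (Val a) = fst (M (aval M a))"
| "aval M (Plus a b) = aval M a + aval M b"
| "aval M (Minus a b) = aval M a - aval M b"

fun hval :: "hash_fun \<Rightarrow> hash \<Rightarrow> memory \<Rightarrow> hexp \<Rightarrow> hash" where
  "hval H d M Default = d"
| "hval H d M (Cell a) = snd (M (aval M a))"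
| "hval H d M (Hash a b) = H (hval H d M a @ hval H d M b)"

fun bval :: "hash_fun \<Rightarrow> hash \<Rightarrow> memory \<Rightarrow> token list \<Rightarrow> bexp \<Rightarrow> bool" where
  "bval H d M inp (Less a b) \<longleftrightarrow> aval M a < aval M b"
| "bval H d M inp (Same a b) \<longleftrightarrow> hval H d M a = hval H d M b"
| "bval H d M inp More \<longleftrightarrow> inp \<noteq> []"
| "bval H d M inp (Not b) \<longleftrightarrow> \<not> bval H d M inp b"

fun acost :: "aexp \<Rightarrow> nat" where
  "acost (Num k) = 1"
| "acost (Val a) = 1 + acost a"
| "acost (Plus a b) = 1 + acost a + acost b"
| "acost (Minus a b) = 1 + acost a + acost b"

fun hcost :: "hexp \<Rightarrow> nat" where
  "hcost Default = 1"
| "hcost (Cell a) = 1 + acost a"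
| "hcost (Hash a b) = 1 + hcost a + hcost b"

fun bcost :: "bexp \<Rightarrow> nat" where
  "bcost (Less a b) = 1 + acost a + acost b"
| "bcost (Same a b) = 1 + hcost a + hcost b"
| "bcost More = 1"
| "bcost (Not b) = 1 + bcost b"

text \<open>
  A configuration consists of the memory, the tokens not yet received and the hashes published
  so far. \<open>exec H d B c s t s'\<close>: with \<open>B\<close> memory cells, \<open>c\<close> leads from \<open>s\<close> to \<open>s'\<close> at cost \<open>t\<close>.
  A program that writes outside the first \<open>B\<close> cells, or receives more than there is, has no
  execution.
\<close>

type_synonym config = "memory \<times> token list \<times> hash list"

inductive exec :: "hash_fun \<Rightarrow> hash \<Rightarrow> nat \<Rightarrow> cmd \<Rightarrow> config \<Rightarrow> nat \<Rightarrow> config \<Rightarrow> bool"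
  for H :: hash_fun and d :: hash and B :: nat where
  Skip: "exec H d B Skip s 1 s"
| Store: "\<lbrakk>k = aval M a; k < B\<rbrakk> \<Longrightarrow>
    exec H d B (Store a e) (M, inp, out) (1 + acost a + acost e)
      (M(k := (aval M e, snd (M k))), inp, out)"
| StoreHash: "\<lbrakk>k = aval M a; k < B\<rbrakk> \<Longrightarrow>
    exec H d B (StoreHash a e) (M, inp, out) (1 + acost a + hcost e)
      (M(k := (fst (M k), hval H d M e)), inp, out)"
| Fetch: "aval M a < B \<Longrightarrow>
    exec H d B (Fetch a) (M, tok # inp, out) (1 + acost a) (M(aval M a := tok), inp, out)"
| Publish:
    "exec H d B (Publish e) (M, inp, out) (1 + hcost e) (M, inp, out @ [hval H d M e])"
| Seq: "\<lbrakk>exec H d B c1 s1 t1 s2; exec H d B c2 s2 t2 s3\<rbrakk> \<Longrightarrow>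
    exec H d B (Seq c1 c2) s1 (1 + t1 + t2) s3"
| IfTrue: "\<lbrakk>bval H d M inp b; exec H d B c1 (M, inp, out) t s\<rbrakk> \<Longrightarrow>
    exec H d B (If b c1 c2) (M, inp, out) (1 + bcost b + t) s"
| IfFalse: "\<lbrakk>\<not> bval H d M inp b; exec H d B c2 (M, inp, out) t s\<rbrakk> \<Longrightarrow>
    exec H d B (If b c1 c2) (M, inp, out) (1 + bcost b + t) s"
| WhileFalse: "\<not> bval H d M inp b \<Longrightarrow>
    exec H d B (While b c) (M, inp, out) (1 + bcost b) (M, inp, out)"
| WhileTrue: "\<lbrakk>bval H d M inp b; exec H d B c (M, inp, out) t1 s; exec H d B (While b c) s t2 s'\<rbrakk> \<Longrightarrow>
    exec H d B (While b c) (M, inp, out) (1 + bcost b + t1 + t2) s'"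

text \<open>The whole message \<open>msg\<close> is received, and exactly \<open>pub\<close> is published.\<close>

definition runs ::
    "hash_fun \<Rightarrow> hash \<Rightarrow> nat \<Rightarrow> cmd \<Rightarrow> memory \<Rightarrow> token list \<Rightarrow> nat \<Rightarrow> memory \<Rightarrow> hash list \<Rightarrow> bool" where
  "runs H d B c M msg t M' pub \<longleftrightarrow> exec H d B c (M, msg, []) t (M', [], pub)"

definition fits :: "nat \<Rightarrow> memory \<Rightarrow> bool" where
  "fits B M \<longleftrightarrow> (\<forall>a \<ge> B. M a = (0, []))"

section \<open>The commitment scheme\<close>

record scheme =
  append_prog :: cmd
  commitment_prog :: cmd
  increment_prog :: cmd
  membership_prog :: cmd
  update_prog :: cmd
  increment_choice :: "nat \<Rightarrow> nat \<Rightarrow> tree increment_proof"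

subsection \<open>The manager\<close>

inductive manager_memory ::
    "hash_fun \<Rightarrow> hash \<Rightarrow> (nat \<Rightarrow> bool list) \<Rightarrow> scheme \<Rightarrow> nat \<Rightarrow> memory \<Rightarrow> bool"
  for H :: hash_fun and d :: hash and x :: "nat \<Rightarrow> bool list" and P :: scheme where
  "manager_memory H d x P 0 (\<lambda>_. (0, []))"
| "\<lbrakk>manager_memory H d x P n M;
    runs H d B (append_prog P) M [(0, H (x (Suc n)))] t M' pub\<rbrakk> \<Longrightarrow>
   manager_memory H d x P (Suc n) M'"

definition appends_within ::
    "hash_fun \<Rightarrow> hash \<Rightarrow> (nat \<Rightarrow> bool list) \<Rightarrow> scheme \<Rightarrow> nat \<Rightarrow> nat \<Rightarrow> nat \<Rightarrow> memory \<Rightarrow> bool" where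
  "appends_within H d x P B c n M \<longleftrightarrow>
     (\<exists>t M' pub.
        runs H d B (append_prog P) M [(0, H (x (Suc n)))] t M'
          (pub @ commitment H d x (Suc n)) \<and>
        t \<le> c \<and> fits B M' \<and>
        label H d x ` (nodes (mmb (Suc n)) - nodes (mmb n))
          \<subseteq> set (pub @ commitment H d x (Suc n)))"

subsection \<open>The participants\<close>

text \<open>
  Layout of a participant's memory: cell 0 holds the current commitment and cell 2 the previous
  one; the number in cell 4 is the verdict of the last verification (1 for acceptance). A verified
  membership proof is stored with its length in cell 6, its \<open>j\<close>-th entry in cell \<open>8 + 4 * j\<close> and
  the intermediate hashes met in recomputing the root in the cells \<open>10 + 4 * j\<close>. Cells with an
  odd address are at the disposal of the programs.
\<close>

fun step_token :: "step \<Rightarrow> token" where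
  "step_token (LeftSib g) = (0, g)"
| "step_token (RightSib g) = (1, g)"
| "step_token NoSib = (2, [])"

fun instr_token :: "instr \<Rightarrow> token" where
  "instr_token Shift = (0, [])"
| "instr_token Join = (1, [])"
| "instr_token JoinDefault = (2, [])"

definition increment_message :: "hash increment_proof \<Rightarrow> token list" where
  "increment_message = (\<lambda>(C, D, is, js).
     [(length C, []), (length D, []), (length is, [])] @
     map (Pair 0) (C @ D) @ map instr_token (is @ js))"

definition stores_proof :: "hash_fun \<Rightarrow> hash \<Rightarrow> memory \<Rightarrow> hash \<Rightarrow> step list \<Rightarrow> bool" where
  "stores_proof H d M h \<pi> \<longleftrightarrow>
     fst (M 6) = length \<pi> \<and>
     (\<forall>j < length \<pi>. M (8 + 4 * j) = step_token (\<pi> ! j)) \<and>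
     (\<forall>j \<le> length \<pi>. snd (M (10 + 4 * j)) = recompute H d h (take j \<pi>))"

text \<open>
  The verification programs must give the right verdict on every message, honest or not. The
  first token for \<open>membership_prog\<close> is the participant's own input, the leaf hash; that of
  \<open>update_prog\<close> tells how many entries of the stored proof are retained.
\<close>

definition verifies_correctly :: "scheme \<Rightarrow> bool" where
  "verifies_correctly P \<longleftrightarrow> (\<forall>H d M.
     (\<forall>ip. \<exists>B t M'. runs H d B (increment_prog P) M (increment_message ip) t M' [] \<and>
        fst (M' 4) = of_bool (increment_accepts H d (snd (M 2)) (snd (M 0)) ip)) \<and>
     (\<forall>h \<pi>. \<exists>B t M'. runs H d B (membership_prog P) M ((0, h) # map step_token \<pi>) t M' [] \<and>
        fst (M' 4) = of_bool (recompute H d h \<pi> = snd (M 0)) \<and>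
        stores_proof H d M' h \<pi>) \<and>
     (\<forall>h \<pi> j \<pi>'. stores_proof H d M h \<pi> \<and> j \<le> length \<pi> \<longrightarrow>
        (\<exists>B t M'. runs H d B (update_prog P) M ((j, []) # map step_token \<pi>') t M' [] \<and>
           fst (M' 4) = of_bool (recompute H d h (take j \<pi> @ \<pi>') = snd (M 0)) \<and>
           stores_proof H d M' h (take j \<pi> @ \<pi>'))))"

definition is_mmb_scheme :: "scheme \<Rightarrow> bool" where
  "is_mmb_scheme P \<longleftrightarrow>
     verifies_correctly P \<and>
     (\<forall>m n. 1 \<le> m \<and> m < n \<longrightarrow> is_increment_proof m n (increment_choice P m n))"

text \<open>Below, \<open>B\<close> is the memory available to the participant and \<open>c\<close> a bound on the cost.\<close>

definition updates_commitment_within ::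
    "hash_fun \<Rightarrow> hash \<Rightarrow> (nat \<Rightarrow> bool list) \<Rightarrow> scheme \<Rightarrow> nat \<Rightarrow> nat \<Rightarrow> nat \<Rightarrow> bool" where
  "updates_commitment_within H d x P B c n \<longleftrightarrow> (\<forall>M. fits B M \<longrightarrow>
     (\<exists>t M'. runs H d B (commitment_prog P) M (map (Pair 0) (commitment H d x n)) t M' [] \<and>
        t \<le> c \<and> fits B M' \<and>
        snd (M' 0) = root_hash H d x n \<and> snd (M' 2) = snd (M 0) \<and>
        (\<forall>a. even a \<and> a \<notin> {0, 2} \<longrightarrow> M' a = M a)))"

definition verifies_increment_within ::
    "hash_fun \<Rightarrow> hash \<Rightarrow> (nat \<Rightarrow> bool list) \<Rightarrow> scheme \<Rightarrow> nat \<Rightarrow> nat \<Rightarrow> nat \<Rightarrow> nat \<Rightarrow> bool" where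
  "verifies_increment_within H d x P B c m n \<longleftrightarrow>
     (\<forall>M. fits B M \<and> snd (M 0) = root_hash H d x n \<and> snd (M 2) = root_hash H d x m \<longrightarrow>
     (\<exists>t M'. runs H d B (increment_prog P) M
          (increment_message (hash_increment_proof H d x (increment_choice P m n))) t M' [] \<and>
        t \<le> c \<and> fits B M' \<and> fst (M' 4) = 1 \<and>
        (\<forall>a. even a \<and> a \<noteq> 4 \<longrightarrow> M' a = M a)))"

definition retrieves_membership_within ::
    "hash_fun \<Rightarrow> hash \<Rightarrow> (nat \<Rightarrow> bool list) \<Rightarrow> scheme \<Rightarrow> nat \<Rightarrow> nat \<Rightarrow> nat \<Rightarrow> nat \<Rightarrow> bool" where
  "retrieves_membership_within H d x P B c n i \<longleftrightarrow>
     (\<forall>M. fits B M \<and> snd (M 0) = root_hash H d x n \<longrightarrow>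
     (\<exists>t M'. runs H d B (membership_prog P) M
          ((0, H (x i)) # map step_token (membership_proof H d x n i)) t M' [] \<and>
        t \<le> c \<and> fits B M' \<and> fst (M' 4) = 1 \<and>
        stores_proof H d M' (H (x i)) (membership_proof H d x n i) \<and>
        M' 0 = M 0 \<and> M' 2 = M 2))"

definition updates_membership_within ::
    "hash_fun \<Rightarrow> hash \<Rightarrow> (nat \<Rightarrow> bool list) \<Rightarrow> scheme \<Rightarrow> nat \<Rightarrow> nat \<Rightarrow> nat \<Rightarrow> nat \<Rightarrow> nat \<Rightarrow> bool" where
  "updates_membership_within H d x P B c m n i \<longleftrightarrow>
     (\<forall>M. fits B M \<and> snd (M 0) = root_hash H d x n \<and>
        stores_proof H d M (H (x i)) (membership_proof H d x m i) \<longrightarrow>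
     (\<exists>t M'. runs H d B (update_prog P) M
          ((kept m n i, []) #
             map step_token (drop (kept m n i) (membership_proof H d x n i))) t M' [] \<and>
        t \<le> c \<and> fits B M' \<and> fst (M' 4) = 1 \<and>
        stores_proof H d M' (H (x i)) (membership_proof H d x n i) \<and>
        M' 0 = M 0 \<and> M' 2 = M 2))"

text \<open>
  The empty list has no root, hence no increment proof starts from it; the operations that do
  not refer to the old commitment are also required for \<open>m = 0\<close>.
\<close>

definition resyncs_within ::
    "hash_fun \<Rightarrow> hash \<Rightarrow> (nat \<Rightarrow> bool list) \<Rightarrow> scheme \<Rightarrow> nat \<Rightarrow> nat \<Rightarrow> nat \<Rightarrow> nat \<Rightarrow> bool" where
  "resyncs_within H d x P B c m n \<longleftrightarrow>
     updates_commitment_within H d x P B c n \<and>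
     (1 \<le> m \<longrightarrow> verifies_increment_within H d x P B c m n) \<and>
     (\<forall>i. m < i \<and> i \<le> n \<longrightarrow> retrieves_membership_within H d x P B c n i) \<and>
     (\<forall>i. 1 \<le> i \<and> i \<le> m \<longrightarrow> updates_membership_within H d x P B c m n i)"

subsection \<open>Properties\<close>

definition polylogarithmic :: "(nat \<Rightarrow> nat) \<Rightarrow> bool" where
  "polylogarithmic T \<longleftrightarrow> (\<exists>e::nat. (\<lambda>n. real (T n)) \<in> O(\<lambda>n. ln (real n) ^ e))"

definition succinct :: "scheme \<Rightarrow> bool" where
  "succinct P \<longleftrightarrow> (\<exists>mem T. mono mem \<and> polylogarithmic T \<and> (\<forall>H d x n. 1 \<le> n \<longrightarrow>
     updates_commitment_within H d x P (mem n) (T n) n \<and>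
     (\<forall>i. 1 \<le> i \<and> i \<le> n \<longrightarrow> retrieves_membership_within H d x P (mem n) (T n) n i) \<and>
     (\<forall>m. 1 \<le> m \<and> m < n \<longrightarrow> verifies_increment_within H d x P (mem n) (T n) m n)))"

definition incremental :: "scheme \<Rightarrow> bool" where
  "incremental P \<longleftrightarrow> (\<exists>mem T. mono mem \<and>
     (\<forall>H d x m n. m < n \<longrightarrow> resyncs_within H d x P (mem n) (T (n - m)) m n))"

definition optimally_additive :: "scheme \<Rightarrow> bool" where
  "optimally_additive P \<longleftrightarrow> (\<exists>mem c. mono mem \<and>
     (\<forall>H d x n M. manager_memory H d x P n M \<longrightarrow> appends_within H d x P (mem (Suc n)) c n M))"

end

theory Submission
  imports Defs "HOL-Library.Discrete_Functions"
begin

text \<open>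
  Write \<open>N = n + 1\<close> in binary. The mountains of \<open>X\<^sub>n\<close> correspond to the digits of \<open>N\<close> below the leading
  one, and an append increments \<open>N\<close>: a carry stopping at digit \<open>j\<close> merges the two mountains of
  height \<open>j\<close>, and the mountains to their right form the last range. Hence an append creates at most six
  nodes, and those that do not contain the new leaf end at leaf \<open>N + 1 - 2 ^ j\<close>.

  After a \<open>k\<close>-increment from \<open>m\<close> to \<open>n\<close>, a node of the new belt with an old leaf that is not a node of the
  old belt either lies on the path from leaf \<open>m + 1\<close>, which has length \<open>O(log k)\<close>, or was created by an
  append \<open>p\<close> whose carry clears enough digits of \<open>p + 1\<close> to get down to at most \<open>m\<close>. There are only
  \<open>O(log k)\<close> such appends. This bounds both the part of a membership proof that changes and the
  increment proof built from the maximal common nodes of the two belts.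
\<close>

section \<open>Mountains, ranges and belt\<close>

text \<open>Digits enter because the mountain of index \<open>i\<close>, counted from the right, has
  height \<open>i\<close> or \<open>i + 1\<close>, and the excess is digit \<open>i\<close> of
  \<open>N\<close>. The obstacle is that a carry rewrites all digits below its stop, although hardly
  any tree changes: right of the merge a mountain of index \<open>h\<close> and digit 1 becomes one
  of index \<open>h + 1\<close> and digit 0, with the same height and the same leaves. The belt is
  therefore described by index, whereas the manager stores it by height, so that a carry of any
  length touches only a constant number of cells.

  Nodes are compared as trees, hence a node common to two belts has the same path below it in both,
  and counting the changed nodes settles both kinds of proofs.

  On the machine, two shortcuts are essential. The stop of the carry must not be searched digit by
  digit, so the heights with two mountains form a linked list. A participant must not hash the
  retained part of a proof again, so recomputation resumes from a stored intermediate hash.\<close>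

fun perfect :: "nat \<Rightarrow> nat \<Rightarrow> tree" where
  "perfect 0 k = Leaf (Suc k)"
| "perfect (Suc h) k = Node (perfect h k) (perfect h (k + 2 ^ h))"

lemma height_perfect [simp]: "height (perfect h k) = h"
  by (induction h k rule: perfect.induct) auto

lemma perfect_not_Missing [simp]: "perfect h k \<noteq> Missing"
  by (cases h) auto

declare perfect.simps(2) [simp del]

text \<open>
  With \<open>N = n + 1\<close>, the \<open>i\<close>-th mountain from the right in the list for \<open>n\<close> has height \<open>i\<close> plus the
  \<open>i\<close>-th binary digit of \<open>N\<close>, and its last leaf is \<open>2 ^ i * (N div 2 ^ i - 1)\<close>. The mountains of index
  at least \<open>i\<close> only depend on \<open>N div 2 ^ i\<close>, which is the second argument of the functions below.
\<close>

definition mountain :: "nat \<Rightarrow> nat \<Rightarrow> tree" where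
  "mountain i N = perfect (i + N mod 2) (2 ^ Suc i * (N div 2 - 1))"

fun mountains :: "nat \<Rightarrow> nat \<Rightarrow> tree list" where
  "mountains i N = (if N < 2 then [] else mountains (Suc i) (N div 2) @ [mountain i N])"

declare mountains.simps [simp del]

lemma has_mergeable_snoc:
  "has_mergeable (ts @ [a, b]) \<longleftrightarrow> height a = height b \<or> has_mergeable (ts @ [a])"
proof (induction ts)
  case (Cons c ts)
  then show ?case by (cases ts) auto
qed simp

text \<open>The recursion of \<open>merge_rightmost\<close> starts at the left, while the induction
  on the digits works at the right end; this rule and \<open>merge_rightmost_different\<close> are
  the two outcomes there.\<close>

lemma merge_rightmost_same:
  "height a = height b \<Longrightarrow> merge_rightmost (ts @ [a, b]) = ts @ [Node a b]"
proof (induction ts)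
  case (Cons c ts)
  moreover have "has_mergeable (ts @ [a, b])"
    using Cons.prems by (simp add: has_mergeable_snoc)
  ultimately show ?case
    by (cases "ts @ [a, b]") auto
qed simp

lemma merge_rightmost_different:
  "height a \<noteq> height b \<Longrightarrow> merge_rightmost (ts @ [a, b]) = merge_rightmost (ts @ [a]) @ [b]"
proof (induction ts)
  case (Cons c ts)
  show ?case
  proof (cases ts)
    case Nil
    then show ?thesis using Cons by auto
  next
    case (Cons e us)
    then show ?thesis
      using Cons.IH Cons.prems has_mergeable_snoc [of ts a b] by auto
  qed
qed simp

text \<open>A carry into digit \<open>i\<close> arrives as a mountain of height \<open>i\<close>. At
  digit 0 it meets its equal and merges. At digit 1 it stays, and the mountain of height
  \<open>i + 1\<close> before it plays the arriving one for the remaining digits; hence the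
  generality in \<open>i\<close>.\<close>

lemma merge_mtns:
  assumes "1 \<le> N"
  shows "merge_rightmost (mountains i N @ [perfect i (2 ^ i * (N - 1))]) = mountains i (Suc N)"
  using assms
proof (induction N arbitrary: i rule: less_induct)
  case (less N)
  consider "N = 1" | "2 \<le> N" "even N" | "3 \<le> N" "odd N"
    using less.prems by (metis One_nat_def Suc_1 Suc_leI antisym_conv2 even_Suc numeral_3_eq_3 odd_one)
  then show ?case
  proof cases
    case 1
    then show ?thesis by (simp add: mountains.simps mountain_def)
  next
    case 2
    then obtain q where N: "N = 2 * q" "1 \<le> q" by (auto elim!: evenE)
    have eq: "(2::nat) ^ i * (2 * q - 1) = 2 ^ Suc i * (q - 1) + 2 ^ i"
      using N by (cases q) (auto simp: algebra_simps)
    have 1: "mountains i N = mountains (Suc i) q @ [perfect i (2 ^ Suc i * (q - 1))]"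
      using N by (subst mountains.simps) (simp add: mountain_def)
    have 2: "mountains i (Suc N) = mountains (Suc i) q @ [perfect (Suc i) (2 ^ Suc i * (q - 1))]"
      using N by (subst mountains.simps) (simp add: mountain_def)
    show ?thesis
      unfolding 1 2 unfolding N(1) eq by (simp add: merge_rightmost_same perfect.simps(2))
  next
    case 3
    then obtain q where N: "N = 2 * q + 1" "1 \<le> q" by (auto elim!: oddE)
    have 1: "mountains i N = mountains (Suc i) q @ [perfect (Suc i) (2 ^ Suc i * (q - 1))]"
      using N by (subst mountains.simps) (simp add: mountain_def)
    have 2: "mountains i (Suc N) = mountains (Suc i) (Suc q) @ [perfect i (2 ^ i * (N - 1))]"
      using N by (subst mountains.simps) (simp add: mountain_def mult.assoc mult.left_commute)
    have "merge_rightmost (mountains (Suc i) q @ [perfect (Suc i) (2 ^ Suc i * (q - 1))])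
        = mountains (Suc i) (Suc q)"
      using N less.IH [of q "Suc i"] by simp
    then show ?thesis
      unfolding 1 2 by (simp add: merge_rightmost_different)
  qed
qed

lemma ummb_eq: "ummb n = mountains 0 (Suc n)"
proof (induction n)
  case (Suc n)
  then show ?case using merge_mtns [of "Suc n" 0] by simp
qed (simp add: mountains.simps)

section \<open>Ranges and belt nodes read off from the digits\<close>

lemma ranges_snoc:
  "ranges p (ts @ [a, b]) =
    (let rs = ranges p (ts @ [a]) in
     if range_boundary (if ts = [] then p else Some (last ts)) a b then rs @ [[b]]
     else butlast rs @ [last rs @ [b]])"
proof (induction ts arbitrary: p)
  case Nil
  then show ?case by (simp add: Let_def)
next
  case (Cons c ts)
  show ?case
  proof (cases ts)
    case Nil
    then show ?thesis by (simp add: Let_def)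
  next
    case (Cons e us)
    have ne: "ranges q (e # zs) \<noteq> []" for q zs
      by (cases zs) (auto simp: Let_def)
    obtain r rs where rs: "ranges (Some c) (ts @ [a]) = r # rs"
      using ne [of "Some c" "us @ [a]"] Cons by (cases "ranges (Some c) (ts @ [a])") auto
    have "ranges (Some c) (ts @ [a, b]) =
      (if range_boundary (Some (last ts)) a b then (r # rs) @ [[b]]
       else butlast (r # rs) @ [last (r # rs) @ [b]])"
      using Cons.IH [of "Some c"] Cons rs by (simp add: Let_def)
    then show ?thesis
      using Cons rs by (auto simp: Let_def)
  qed
qed

lemma chain_snoc: "chain (ts @ [t]) = Node (chain ts) t"
  by (cases ts) auto

text \<open>
  The last three digits of \<open>N\<close> decide whether a range starts at the rightmost mountain; \<open>belt_state\<close> yields the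
  belt node over all ranges but the last one, and the topmost range node of the last one.
\<close>

definition range_starts :: "nat \<Rightarrow> bool" where
  "range_starts N \<longleftrightarrow> 4 \<le> N \<and> N mod 8 \<in> {2, 3, 6}"

fun belt_state :: "nat \<Rightarrow> nat \<Rightarrow> tree \<times> tree" where
  "belt_state i N = (if N < 2 then (Missing, Missing) else
     let (B, R) = belt_state (Suc i) (N div 2) in
     if range_starts N then (Node B R, Node Missing (mountain i N)) else (B, Node R (mountain i N)))"

declare belt_state.simps [simp del]

abbreviation "bnode i N \<equiv> fst (belt_state i N)"
abbreviation "rnode i N \<equiv> snd (belt_state i N)"

lemma belt_1 [simp]: "bnode i (Suc 0) = Missing" and range_1 [simp]: "rnode i (Suc 0) = Missing"
  by (simp_all add: belt_state.simps)

lemma belt_bd: "range_starts N \<Longrightarrow> bnode i N = Node (bnode (Suc i) (N div 2)) (rnode (Suc i) (N div 2))"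
  and belt_not_bd: "2 \<le> N \<Longrightarrow> \<not> range_starts N \<Longrightarrow> bnode i N = bnode (Suc i) (N div 2)"
  and range_bd: "range_starts N \<Longrightarrow> rnode i N = Node Missing (mountain i N)"
  and range_not_bd: "2 \<le> N \<Longrightarrow> \<not> range_starts N \<Longrightarrow> rnode i N = Node (rnode (Suc i) (N div 2)) (mountain i N)"
  by (subst belt_state.simps; auto simp: range_starts_def Let_def case_prod_beta)+

text \<open>Let \<open>b2\<close>, \<open>b1\<close>, \<open>b0\<close> be the last three digits of
  \<open>N\<close>. The rightmost heights are \<open>i + 2 + b2\<close>, \<open>i + 1 + b1\<close>
  and \<open>i + b0\<close>. The last two differ by 2 iff \<open>b1 = 1\<close> and
  \<open>b0 = 0\<close>; the first two agree iff \<open>b2 = 0\<close> and \<open>b1 = 1\<close>.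
  This leaves 010, 110 and 011, that is, 2, 6 and 3. For \<open>N < 8\<close> there is no third
  mountain, but then \<open>b2 = 1\<close> excludes the second case anyway.\<close>

lemma range_boundary_iff_bd:
  assumes "4 \<le> N"
  shows "range_boundary (if N < 8 then None else Some (mountain (Suc (Suc i)) (N div 4)))
           (mountain (Suc i) (N div 2)) (mountain i N) \<longleftrightarrow> range_starts N"
proof -
  have "N mod 8 = N mod 2 + 2 * (N div 2 mod 2) + 4 * (N div 4 mod 2)"
    using mod_mult2_eq [of N 2 4] mod_mult2_eq [of "N div 2" 2 2]
    by (simp add: div_mult2_eq [symmetric])
  moreover have "N mod 2 = 0 \<or> N mod 2 = 1" "N div 2 mod 2 = 0 \<or> N div 2 mod 2 = 1"
    "N div 4 mod 2 = 0 \<or> N div 4 mod 2 = 1"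
    by auto
  ultimately have *: "Suc (N div 4 mod 2) = N div 2 mod 2 \<longleftrightarrow> N mod 8 = 2 \<or> N mod 8 = 3"
    "N div 2 mod 2 = N mod 2 + 1 \<longleftrightarrow> N mod 8 = 2 \<or> N mod 8 = 6"
    "N mod 2 < 3"
    by (elim disjE; simp)+
  have h: "height (mountain i N) = i + N mod 2" "height (mountain (Suc i) (N div 2)) = i + 1 + N div 2 mod 2"
    "height (mountain (Suc (Suc i)) (N div 4)) = i + 1 + Suc (N div 4 mod 2)"
    by (simp_all add: mountain_def)
  have "N = 4 \<or> N = 5 \<or> N = 6 \<or> N = 7" if "N < 8" using that assms by linarith
  then show ?thesis
    using assms * unfolding range_boundary_def range_starts_def h by (cases "N < 8") (auto simp: h)
qed

lemma ranges_mtns: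
  assumes "2 \<le> N"
  shows "ranges None (mountains i N) \<noteq> [] \<and>
    bnode i N = chain (map chain (butlast (ranges None (mountains i N)))) \<and>
    rnode i N = chain (last (ranges None (mountains i N)))"
  using assms
proof (induction N arbitrary: i rule: less_induct)
  case (less N)
  show ?case
  proof (cases "N < 4")
    case True
    then have "\<not> range_starts N" "N div 2 = 1" using less.prems by (auto simp: range_starts_def)
    then show ?thesis
      using less.prems
      by (simp add: belt_not_bd range_not_bd mountains.simps [of _ N] mountains.simps [of _ "Suc 0"])
  next
    case False
    let ?m = "mountains (Suc (Suc i)) (N div 4)"
    have d: "N div 2 div 2 = N div 4" by (simp add: div_mult2_eq [symmetric])
    have 1: "mountains (Suc i) (N div 2) = ?m @ [mountain (Suc i) (N div 2)]"
      using False by (subst mountains.simps) (simp add: d)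
    have 2: "mountains i N = ?m @ [mountain (Suc i) (N div 2), mountain i N]"
      using False 1 by (subst mountains.simps) simp
    have 3: "(if ?m = [] then None else Some (last ?m)) =
        (if N < 8 then None else Some (mountain (Suc (Suc i)) (N div 4)))"
      using False by (subst (1 2) mountains.simps) auto
    define rs where "rs = ranges None (mountains (Suc i) (N div 2))"
    have IH: "rs \<noteq> []" "bnode (Suc i) (N div 2) = chain (map chain (butlast rs))"
       "rnode (Suc i) (N div 2) = chain (last rs)"
      using less.IH [of "N div 2" "Suc i"] less.prems False by (auto simp: rs_def)
    have rn: "ranges None (mountains i N) =
       (if range_starts N then rs @ [[mountain i N]] else butlast rs @ [last rs @ [mountain i N]])"
      unfolding 2 ranges_snoc 3 Let_def using range_boundary_iff_bd [of N i] False
      by (simp add: rs_def 1)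
    show ?thesis
    proof (cases "range_starts N")
      case True
      have "map chain rs = map chain (butlast rs) @ [chain (last rs)]"
        using IH(1) by (metis append_butlast_last_id map_append list.simps(8,9))
      then have "chain (map chain rs) = Node (chain (map chain (butlast rs))) (chain (last rs))"
        by (simp add: chain_snoc)
      then show ?thesis
        using True IH rn by (simp add: belt_bd range_bd)
    next
      case False
      then show ?thesis
        using less.prems IH rn by (simp add: belt_not_bd range_not_bd chain_snoc)
    qed
  qed
qed

lemma mmb_eq: "1 \<le> n \<Longrightarrow> mmb n = Node (bnode 0 (Suc n)) (rnode 0 (Suc n))"
proof -
  assume "1 \<le> n"
  define rs where "rs = ranges None (mountains 0 (Suc n))"
  have *: "rs \<noteq> []" "bnode 0 (Suc n) = chain (map chain (butlast rs))"
    "rnode 0 (Suc n) = chain (last rs)"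
    using ranges_mtns [of "Suc n" 0] \<open>1 \<le> n\<close> by (auto simp: rs_def)
  have "map chain rs = map chain (butlast rs) @ [chain (last rs)]"
    using *(1) by (metis append_butlast_last_id map_append list.simps(8,9))
  then have "chain (map chain rs) = Node (chain (map chain (butlast rs))) (chain (last rs))"
    by (simp add: chain_snoc)
  then show ?thesis
    using * by (simp add: mmb_def ummb_eq rs_def [symmetric])
qed

lemma mmb_0 [simp]: "mmb 0 = Missing"
  by (simp add: mmb_def)

section \<open>Subtrees and paths\<close>

text \<open>The bound \<open>c < b\<close> forbids an empty right child while
  \<open>a \<le> c\<close> admits an empty left one: below a node, \<open>Missing\<close> occurs
  only on the left, and every node has a leaf.\<close>

fun spans :: "tree \<Rightarrow> nat \<Rightarrow> nat \<Rightarrow> bool" where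
  "spans Missing a b \<longleftrightarrow> a = b"
| "spans (Leaf i) a b \<longleftrightarrow> i = Suc a \<and> b = Suc a"
| "spans (Node l r) a b \<longleftrightarrow> (\<exists>c. a \<le> c \<and> c < b \<and> spans l a c \<and> spans r c b)"

lemma leaves_spans: "spans t a b \<Longrightarrow> leaves t = {a<..b}"
  by (induction t arbitrary: a b) fastforce+

lemma spans_le: "spans t a b \<Longrightarrow> a \<le> b"
  by (induction t arbitrary: a b) fastforce+

lemma spans_less: "spans t a b \<Longrightarrow> t \<noteq> Missing \<Longrightarrow> a < b"
  by (cases t) auto

lemma spans_perfect: "spans (perfect h k) k (k + 2 ^ h)"
proof (induction h k rule: perfect.induct)
  case (2 h k)
  then show ?case
    by (auto simp: perfect.simps intro!: exI [of _ "k + 2 ^ h"] simp: add.assoc mult_2)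
qed simp

lemma spans_node: "spans t a b \<Longrightarrow> v \<in> nodes t \<Longrightarrow> \<exists>c e. a \<le> c \<and> e \<le> b \<and> c < e \<and> spans v c e"
proof (induction t arbitrary: a b)
  case (Node l r)
  from Node.prems obtain c where c: "a \<le> c" "c < b" "spans l a c" "spans r c b" by auto
  from Node.prems consider "v = Node l r" | "v \<in> nodes l" | "v \<in> nodes r" by auto
  then show ?case
  proof cases
    case 1
    then show ?thesis using Node.prems by (meson dual_order.refl order.strict_trans1 spans.simps(3))
  next
    case 2
    then show ?thesis using Node.IH(1) [OF c(3)] c(2) by (meson less_or_eq_imp_le order_trans)
  next
    case 3
    then show ?thesis using Node.IH(2) [OF c(4)] c(1) by (meson order_trans)
  qed
qed auto

lemma nodes_leaves_nonempty: "spans t a b \<Longrightarrow> v \<in> nodes t \<Longrightarrow> leaves v \<noteq> {}"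
  using spans_node [of t a b v] leaves_spans [of v] by auto

lemma leaves_node_subset: "v \<in> nodes t \<Longrightarrow> leaves v \<subseteq> leaves t"
  by (induction t) auto

lemma nodes_trans: "u \<in> nodes v \<Longrightarrow> v \<in> nodes t \<Longrightarrow> u \<in> nodes t"
  by (induction t) auto

lemma nodes_self: "t \<noteq> Missing \<Longrightarrow> t \<in> nodes t"
  by (cases t) auto

lemma Missing_notin_nodes [simp]: "Missing \<notin> nodes t"
  by (induction t) auto

lemma size_node: "v \<in> nodes t \<Longrightarrow> v = t \<or> size v < size t"
  by (induction t) auto

lemma nodes_antisym: "u \<in> nodes v \<Longrightarrow> v \<in> nodes u \<Longrightarrow> u = v"
  using size_node by (metis less_asym)

lemma finite_nodes [simp]: "finite (nodes t)"
  by (induction t) auto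

lemma nodes_disjoint:
  assumes "spans (Node l r) a b" shows "nodes l \<inter> nodes r = {}"
proof -
  from assms obtain c where c: "spans l a c" "spans r c b" by auto
  have "leaves l \<inter> leaves r = {}" using leaves_spans [OF c(1)] leaves_spans [OF c(2)] by auto
  then show ?thesis
    using leaves_node_subset [of _ l] leaves_node_subset [of _ r] nodes_leaves_nonempty [OF c(1)]
    by blast
qed

lemma set_path: "spans t a b \<Longrightarrow> i \<in> leaves t \<Longrightarrow> set (path i t) = {v \<in> nodes t. i \<in> leaves v}"
proof (induction t arbitrary: a b)
  case (Node l r)
  then obtain c where c: "spans l a c" "spans r c b" by auto
  have "leaves l \<inter> leaves r = {}" using leaves_spans [OF c(1)] leaves_spans [OF c(2)] by auto
  then have "i \<in> leaves l \<Longrightarrow> v \<in> nodes r \<Longrightarrow> i \<notin> leaves v"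
    "i \<in> leaves r \<Longrightarrow> v \<in> nodes l \<Longrightarrow> i \<notin> leaves v" for v
    using leaves_node_subset by blast+
  then show ?case
    using Node.IH(1) [OF c(1)] Node.IH(2) [OF c(2)] Node.prems(2) by (cases "i \<in> leaves l") auto
qed auto

lemma path_nodes: "set (path i t) \<subseteq> nodes t"
  by (induction t) auto

lemma distinct_path: "distinct (path i t)"
proof (induction t)
  case (Node l r)
  then show ?case
    using path_nodes [of i l] path_nodes [of i r] size_node [of "Node l r" l] size_node [of "Node l r" r] by auto
qed auto

text \<open>A node carries its whole subtree, so the path up to it is the same in every belt that
  contains it.\<close>

lemma prefix_path:
  "spans t a b \<Longrightarrow> v \<in> nodes t \<Longrightarrow> i \<in> leaves v \<Longrightarrow> prefix (path i v) (path i t)"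
proof (induction t arbitrary: a b)
  case (Node l r)
  then obtain c where c: "spans l a c" "spans r c b" by auto
  have "leaves l \<inter> leaves r = {}" using leaves_spans [OF c(1)] leaves_spans [OF c(2)] by auto
  moreover have "v = Node l r \<or> v \<in> nodes l \<and> i \<in> leaves l \<or> v \<in> nodes r \<and> i \<in> leaves r"
    using Node.prems leaves_node_subset [of v l] leaves_node_subset [of v r] by auto
  ultimately show ?case
    using Node.IH(1) [OF c(1)] Node.IH(2) [OF c(2)] Node.prems(3)
    by (elim disjE) (auto intro: prefix_prefix)
qed auto

lemma path_nonempty: "i \<in> leaves t \<Longrightarrow> path i t \<noteq> []"
  by (cases t) auto

lemma last_path: "spans t a b \<Longrightarrow> i \<in> leaves t \<Longrightarrow> t \<in> set (path i t)"
  by (cases t) auto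

lemma spans_mtn: "2 \<le> N \<Longrightarrow> spans (mountain i N) (2 ^ Suc i * (N div 2 - 1)) (2 ^ i * (N - 1))"
proof -
  assume "2 \<le> N"
  then obtain q where q: "N div 2 = Suc q" by (cases "N div 2") auto
  have N: "N = 2 * Suc q + N mod 2" using q by presburger
  \<comment> \<open>A binary digit \<open>b\<close> satisfies \<open>2 ^ b = b + 1\<close>, so a
    mountain of height \<open>i + b\<close> has \<open>2 ^ i * (b + 1)\<close> leaves.\<close>
  have "2 ^ Suc i * (N div 2 - 1) + 2 ^ (i + N mod 2) = 2 ^ i * (N - 1)"
  proof (cases "even N")
    case True
    then have "N - 1 = 2 * q + 1" using N by simp
    then show ?thesis using q True by (simp add: algebra_simps)
  next
    case False
    then have "N - 1 = 2 * q + 2" using N by (simp add: odd_iff_mod_2_eq_one)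
    then show ?thesis using q False by (simp add: algebra_simps odd_iff_mod_2_eq_one)
  qed
  then show ?thesis
    using spans_perfect [of "i + N mod 2" "2 ^ Suc i * (N div 2 - 1)"] by (simp add: mountain_def)
qed

lemma spans_st:
  "1 \<le> N \<Longrightarrow> \<exists>e. spans (bnode i N) 0 e \<and> spans (rnode i N) e (2 ^ i * (N - 1)) \<and>
     (2 \<le> N \<longrightarrow> e < 2 ^ i * (N - 1))"
proof (induction N arbitrary: i rule: less_induct)
  case (less N)
  show ?case
  proof (cases "N = 1")
    case False
    then have N: "2 \<le> N" "1 \<le> N div 2" "N div 2 < N" using less.prems by auto
    let ?c = "2 ^ Suc i * (N div 2 - 1)"
    obtain e where e: "spans (bnode (Suc i) (N div 2)) 0 e" "spans (rnode (Suc i) (N div 2)) e ?c"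
      "2 \<le> N div 2 \<longrightarrow> e < ?c"
      using less.IH [of "N div 2" "Suc i"] N by auto
    have m: "spans (mountain i N) ?c (2 ^ i * (N - 1))" by (rule spans_mtn [OF N(1)])
    have lt: "?c < 2 ^ i * (N - 1)" using m by (rule spans_less) (simp add: mountain_def)
    have le: "e \<le> ?c" using e(2) by (rule spans_le)
    show ?thesis
    proof (cases "range_starts N")
      case True
      then have "2 \<le> N div 2" by (auto simp: range_starts_def)
      then show ?thesis
        using True e m lt by (intro exI [of _ ?c]) (auto simp: belt_bd range_bd)
    next
      case False
      then have "spans (bnode i N) 0 e" "spans (rnode i N) e (2 ^ i * (N - 1))"
        using N e(1,2) m lt le by (auto simp: belt_not_bd range_not_bd simp del: power_Suc)
      then show ?thesis
        using lt le by (meson order.strict_trans1)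
    qed
  qed simp
qed

lemma spans_mmb: "spans (mmb n) 0 n"
proof (cases "n = 0")
  case False
  then show ?thesis
    using spans_st [of "Suc n" 0] by (auto simp: mmb_eq)
qed simp

lemma leaves_mmb: "leaves (mmb n) = {1..n}"
  using leaves_spans [OF spans_mmb] by auto

section \<open>Path length and distance of the leaf from the right end\<close>

lemma length_path_perfect: "length (path l (perfect h k)) = Suc h"
  by (induction h k rule: perfect.induct) (auto simp: perfect.simps)

text \<open>Each digit adds at most one belt or range node to a path. If \<open>l\<close> lies left
  of mountain \<open>i\<close>, the at least \<open>2 ^ i\<close> leaves of that mountain are to its
  right, whence \<open>i < a\<close>. So \<open>l\<close> is in a mountain of index at most
  \<open>a\<close>, which contributes at most \<open>a + 2\<close> nodes.\<close>

lemma length_path_st: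
  assumes "1 \<le> N" "i \<le> a" "2 ^ i * (N - 1) < l + 2 ^ a"
  shows "(l \<in> leaves (bnode i N) \<longrightarrow> length (path l (bnode i N)) \<le> 2 * a + 3 - i) \<and>
    (l \<in> leaves (rnode i N) \<longrightarrow> length (path l (rnode i N)) \<le> 2 * a + 3 - i)"
  using assms
proof (induction N arbitrary: i rule: less_induct)
  case (less N)
  show ?case
  proof (cases "N = 1")
    case False
    then have N: "2 \<le> N" "1 \<le> N div 2" "N div 2 < N" using less.prems by auto
    define c :: nat where "c = 2 ^ Suc i * (N div 2 - 1)"
    have m: "spans (mountain i N) c (2 ^ i * (N - 1))" unfolding c_def by (rule spans_mtn [OF N(1)])
    obtain e where e: "spans (bnode (Suc i) (N div 2)) 0 e" "spans (rnode (Suc i) (N div 2)) e c"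
      using spans_st [of "N div 2" "Suc i"] N by (auto simp: c_def)
    have le: "e \<le> c" using e(2) by (rule spans_le)
    have M: "length (path l (mountain i N)) \<le> i + 2"
      by (simp add: mountain_def length_path_perfect)
    have "c + 2 ^ i \<le> 2 ^ i * (N - 1)"
    proof -
      have "2 * (N div 2 - 1) + 1 \<le> N - 1" using N by linarith
      then have "2 ^ i * (2 * (N div 2 - 1) + 1) \<le> 2 ^ i * (N - 1)" by (rule mult_le_mono2)
      then show ?thesis by (simp add: c_def algebra_simps)
    qed
    moreover have "i < a" if "l \<le> c"
      using that calculation less.prems(3) less.prems(2) by (metis (no_types, lifting) add_le_cancel_left
        le_neq_implies_less leD le_trans add_le_mono1)
    ultimately have IH: "i < a \<and> (l \<in> leaves (bnode (Suc i) (N div 2)) \<longrightarrow>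
          length (path l (bnode (Suc i) (N div 2))) \<le> 2 * a + 2 - i) \<and>
      (l \<in> leaves (rnode (Suc i) (N div 2)) \<longrightarrow>
          length (path l (rnode (Suc i) (N div 2))) \<le> 2 * a + 2 - i)" if "l \<le> c"
      using less.IH [of "N div 2" "Suc i"] N less.prems that by (auto simp: c_def)
    show ?thesis
    proof (cases "l \<le> c")
      case True
      then show ?thesis
        using IH [OF True] M N leaves_spans [OF m]
        by (cases "range_starts N") (auto simp: belt_bd range_bd belt_not_bd range_not_bd)
    next
      case False
      then have "l \<notin> leaves (bnode (Suc i) (N div 2))" "l \<notin> leaves (rnode (Suc i) (N div 2))"
        using le leaves_spans [OF e(1)] leaves_spans [OF e(2)] by auto
      then show ?thesis
        using M N less.prems(2)
        by (cases "range_starts N") (auto simp: belt_bd range_bd belt_not_bd range_not_bd)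
    qed
  qed simp
qed

lemma length_path_mmb:
  assumes "1 \<le> i" "i \<le> n" "n < i + 2 ^ a"
  shows "length (path i (mmb n)) \<le> 2 * a + 4"
proof -
  have "i \<in> leaves (mmb n)" using assms by (simp add: leaves_mmb)
  then show ?thesis
    using length_path_st [of "Suc n" 0 a i] assms by (auto simp: mmb_eq)
qed

section \<open>The nodes created by an append\<close>

lemma bd_double: "range_starts (2 * a) \<longleftrightarrow> odd a \<and> 3 \<le> a"
proof -
  have "2 * a mod 8 = 2 * (a mod 4)" by (simp add: mult_mod_right)
  moreover have "a mod 4 \<in> {0, 1, 2, 3}" using mod_less_divisor [of 4 a] by (auto simp del: mod_less_divisor)
  moreover have "odd a \<longleftrightarrow> a mod 4 = 1 \<or> a mod 4 = 3" by presburger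
  moreover have "4 \<le> 2 * a \<longleftrightarrow> 3 \<le> a" if "odd a" using that by presburger
  ultimately show ?thesis by (auto simp: range_starts_def)
qed

lemma bd_Suc_double: "range_starts (Suc (2 * a)) \<longleftrightarrow> a mod 4 = 1 \<and> 5 \<le> a"
proof -
  have "Suc (2 * a) mod 8 = Suc (2 * (a mod 4))"
    using mod_mult2_eq [of "Suc (2 * a)" 2 4] by simp
  moreover have "a mod 4 \<in> {0, 1, 2, 3}" using mod_less_divisor [of 4 a] by (auto simp del: mod_less_divisor)
  moreover have "4 \<le> Suc (2 * a) \<longleftrightarrow> 5 \<le> a" if "a mod 4 = 1" using that by presburger
  ultimately show ?thesis by (auto simp: range_starts_def)
qed

text \<open>A carry turns the digits 11 at \<open>h + 1\<close> and \<open>h\<close> into 00. Here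
  \<open>4 * v + 3\<close> is \<open>N div 2 ^ h\<close> before the append, and
  \<open>2 * v + 2\<close> is \<open>(N + 1) div 2 ^ Suc h\<close> after it.\<close>

lemma mtn_shift: "mountain (Suc h) (2 * v + 2) = mountain h (4 * v + 3)"
proof -
  have "(4 * v + 3) div 2 = 2 * v + 1" "(4 * v + 3) mod 2 = 1" by presburger+
  then show ?thesis by (simp add: mountain_def mult.assoc)
qed

lemma mtn_merge:
  assumes "1 \<le> a"
  shows "mountain j (Suc (2 * a)) = Node (mountain j (2 * a)) (perfect j (2 ^ j * (2 * a - 1)))"
proof -
  obtain b where "a = Suc b" using assms by (cases a) auto
  moreover have "2 ^ j * (2 * Suc b - 1) = 2 ^ Suc j * b + 2 ^ j" by simp
  ultimately show ?thesis by (simp add: mountain_def perfect.simps(2)) (simp add: ac_simps)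
qed

text \<open>If the carry stops at digit \<open>j + 1\<close>, the digits at \<open>j + 1\<close> and
  \<open>j\<close> are 0 and 1, and the mountain of index \<open>j\<close> is the right partner of
  the merge.\<close>

lemma mtn_right_of_pair: "mountain j (4 * a + 1) = perfect (Suc j) (2 ^ Suc j * (2 * a - 1))"
proof -
  have "(4 * a + 1) div 2 = 2 * a" "(4 * a + 1) mod 2 = 1" by presburger+
  then show ?thesis by (simp add: mountain_def)
qed

lemma mtn_0_even: "even N \<Longrightarrow> 2 \<le> N \<Longrightarrow> mountain 0 N = Leaf (N - 1)"
  by (auto simp: mountain_def elim!: evenE)

text \<open>The range nodes right of a merge survive the carry as well. Both arguments start a range
  for the same \<open>v\<close>. If they do not and \<open>v\<close> is positive, then
  \<open>v\<close> is odd, and the halves \<open>v + 1\<close> and \<open>2 * v + 1\<close> are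
  again of this form.\<close>

lemma range_shift: "rnode (Suc h) (2 * v + 2) = rnode h (4 * v + 3)"
proof (induction v arbitrary: h rule: less_induct)
  case (less v)
  have d: "(2 * v + 2) div 2 = v + 1" "(4 * v + 3) div 2 = 2 * v + 1" by presburger+
  have b1: "range_starts (2 * v + 2) \<longleftrightarrow> even v \<and> 2 \<le> v"
    using bd_double [of "Suc v"] by auto
  have b2: "range_starts (4 * v + 3) \<longleftrightarrow> even v \<and> 2 \<le> v"
  proof -
    have "(2 * v + 1) mod 4 = 1 \<longleftrightarrow> even v" by presburger
    moreover have "4 * v + 3 = Suc (2 * (2 * v + 1))" by simp
    ultimately have "range_starts (4 * v + 3) \<longleftrightarrow> even v \<and> 5 \<le> 2 * v + 1"
      using bd_Suc_double [of "2 * v + 1"] by presburger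
    then show ?thesis by auto
  qed
  show ?case
  proof (cases "even v \<and> 2 \<le> v")
    case True
    then show ?thesis using b1 b2 by (simp add: range_bd mtn_shift del: add_2_eq_Suc')
  next
    case False
    have "rnode (Suc (Suc h)) (v + 1) = rnode (Suc h) (2 * v + 1)"
    proof (cases "v = 0")
      case False
      then obtain w where w: "v = 2 * w + 1"
        using \<open>\<not> (even v \<and> 2 \<le> v)\<close> by (cases "even v") (auto elim!: oddE)
      then show ?thesis using less.IH [of w "Suc h"] by (simp add: eval_nat_numeral add.assoc)
    qed simp
    then show ?thesis
      using False b1 b2 d by (simp add: range_not_bd mtn_shift del: add_2_eq_Suc')
  qed
qed

lemma belt_even: "even a \<Longrightarrow> 1 \<le> a \<Longrightarrow> bnode i (2 * a) = bnode (Suc i) a"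
  by (simp add: belt_not_bd bd_double)

lemma belt_power: "even b \<Longrightarrow> 1 \<le> b \<Longrightarrow> bnode i (2 ^ r * b) = bnode (i + r) b"
proof (induction r arbitrary: i)
  case (Suc r)
  then show ?case using belt_even [of "2 ^ r * b" i] by (simp add: mult.assoc)
qed simp

text \<open>Among the zeros below digit \<open>j\<close>, a range can start only at digit
  \<open>j - 1\<close>, directly right of the merged mountain; further down the residue modulo 8 is
  0 or 4. So the belt node before the last range depends only on the digits from \<open>j\<close>
  on.\<close>

lemma belt_odd_times_power:
  assumes "1 \<le> j"
  shows "bnode 0 (2 ^ j * Suc (2 * a)) =
    (if a = 0 then Missing else Node (bnode j (Suc (2 * a))) (rnode j (Suc (2 * a))))"
proof -
  obtain r where j: "j = Suc r" using assms by (cases j) auto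
  have "bnode 0 (2 ^ j * Suc (2 * a)) = bnode r (2 * Suc (2 * a))"
    using belt_power [of "2 * Suc (2 * a)" 0 r] j by (simp add: algebra_simps)
  then show ?thesis
    using bd_double [of "Suc (2 * a)"] j by (auto simp: belt_bd belt_not_bd simp del: mult_Suc_right)
qed

lemma range_even:
  assumes "even N" "2 \<le> N"
  shows "rnode 0 N = Node (if N mod 4 = 2 then Missing else rnode 0 (N - 1)) (Leaf (N - 1))"
proof -
  obtain q where q: "N = 2 * q" "1 \<le> q" using assms by (auto elim!: evenE)
  show ?thesis
  proof (cases "even q")
    case False
    then have "N mod 4 = 2" using q by presburger
    moreover have "q = 1 \<or> 3 \<le> q" using False q(2) by presburger
    then have "rnode 0 N = Node Missing (mountain 0 N)"
    proof
      assume "q = 1"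
      then show ?thesis using q by (simp add: range_not_bd range_starts_def)
    next
      assume "3 \<le> q"
      then show ?thesis using q False by (simp add: range_bd bd_double)
    qed
    ultimately show ?thesis using mtn_0_even [OF assms] by simp
  next
    case True
    then obtain w where w: "q = 2 * w" by (auto elim!: evenE)
    define v where "v = w - 1"
    have v: "q = 2 * v + 2" using w q(2) by (simp add: v_def)
    then have N: "N - 1 = 4 * v + 3" "N mod 4 \<noteq> 2" using q by auto
    have "rnode 0 N = Node (rnode 1 q) (mountain 0 N)"
      using q True by (simp add: range_not_bd bd_double)
    then show ?thesis
      using mtn_0_even [OF assms] range_shift [of 0 v] N v by simp
  qed
qed

definition st_nodes :: "nat \<Rightarrow> nat \<Rightarrow> tree set" where
  "st_nodes i N = nodes (bnode i N) \<union> nodes (rnode i N)"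

lemma st_nodes_half: "1 \<le> N \<Longrightarrow> st_nodes (Suc i) (N div 2) \<subseteq> st_nodes i N"
  by (cases "N = 1"; cases "range_starts N")
     (auto simp: st_nodes_def belt_bd range_bd belt_not_bd range_not_bd belt_state.simps [of _ 0] range_starts_def)

lemma st_nodes_div: "1 \<le> N div 2 ^ h \<Longrightarrow> st_nodes (i + h) (N div 2 ^ h) \<subseteq> st_nodes i N"
proof (induction h)
  case (Suc h)
  have d: "N div 2 ^ Suc h = N div 2 ^ h div 2" by (simp only: div_mult2_eq power_Suc2)
  then have "1 \<le> N div 2 ^ h" using Suc.prems by (cases "N div 2 ^ h") auto
  then show ?case using Suc.IH st_nodes_half [of "N div 2 ^ h" "i + h"] d by auto
qed simp

lemma nodes_mtn_st: "2 \<le> N \<Longrightarrow> nodes (mountain i N) \<subseteq> st_nodes i N"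
  by (cases "range_starts N") (auto simp: st_nodes_def range_bd range_not_bd)

lemma st_nodes_mmb: "st_nodes 0 (Suc n) \<subseteq> nodes (mmb n)"
  by (cases "n = 0") (auto simp: st_nodes_def mmb_eq)

lemma odd_times_power: "\<exists>a j. Suc N = 2 ^ j * Suc (2 * a)"
proof (induction N rule: less_induct)
  case (less N)
  show ?case
  proof (cases "odd (Suc N)")
    case True
    then show ?thesis by (intro exI [of _ "N div 2"] exI [of _ 0]) auto
  next
    case False
    then obtain q where q: "Suc N = 2 * Suc q" by (metis dvdE mult_0_right nat.distinct(1) old.nat.exhaust)
    then obtain a j where "Suc q = 2 ^ j * Suc (2 * a)" using less.IH [of q] by auto
    then show ?thesis using q by (intro exI [of _ a] exI [of _ "Suc j"]) (simp add: mult.assoc)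
  qed
qed

text \<open>Used to pass from the digits of \<open>N + 1\<close> back to those of \<open>N\<close>,
  below whose digit \<open>h\<close> there are only ones.\<close>

lemma div_pred: "Suc N = 2 ^ h * Suc X \<Longrightarrow> N div 2 ^ h = X"
proof -
  assume "Suc N = 2 ^ h * Suc X"
  moreover have "(0::nat) < 2 ^ h" by simp
  ultimately show ?thesis 
    by (intro div_nat_eqI) (unfold mult_Suc_right, linarith+)
qed

text \<open>
  If \<open>N + 1 = 2 ^ j * (2 * a + 1)\<close>, appending the \<open>N\<close>-th element merges two mountains of height \<open>j\<close>
  (none if \<open>a = 0\<close>). The mountains right of the merged pair form the last range, so only the nodes
  next to the merge and next to the new leaf are created.
\<close>

definition new_nodes :: "nat \<Rightarrow> nat \<Rightarrow> nat \<Rightarrow> tree set" where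
  "new_nodes N a j = {Leaf N, rnode 0 (Suc N), mmb N} \<union>
     (if a = 0 then {} else
      {mountain j (Suc (2 * a)), rnode j (Suc (2 * a)),
       Node (bnode j (Suc (2 * a))) (rnode j (Suc (2 * a)))})"

lemma card_new_nodes: "finite (new_nodes N a j)" "card (new_nodes N a j) \<le> 6"
  unfolding new_nodes_def by (auto simp: card_insert_if)

lemma nodes_merged:
  assumes N: "Suc N = 2 ^ j * Suc (2 * a)" "1 \<le> a" and L: "\<And>v. v \<in> nodes (perfect j (2 ^ j * (2 * a - 1))) \<Longrightarrow> v \<in> A"
    and A: "st_nodes 0 N \<subseteq> A" "mountain j (Suc (2 * a)) \<in> A" "rnode j (Suc (2 * a)) \<in> A"
  shows "nodes (bnode j (Suc (2 * a))) \<subseteq> A \<and> nodes (rnode j (Suc (2 * a))) \<subseteq> A"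
proof -
  have d: "N div 2 ^ j = 2 * a" by (rule div_pred [OF N(1)])
  have s: "st_nodes j (2 * a) \<subseteq> A" using st_nodes_div [of N j 0] d N(2) A(1) by auto
  have s': "st_nodes (Suc j) a \<subseteq> A" using st_nodes_half [of "2 * a" j] N(2) s by auto
  have m: "nodes (mountain j (2 * a)) \<subseteq> A" using nodes_mtn_st [of "2 * a" j] N(2) s by auto
  have m': "nodes (mountain j (Suc (2 * a))) \<subseteq> A"
    using A(2) m L by (auto simp: mtn_merge [OF N(2)])
  show ?thesis
  proof (cases "range_starts (Suc (2 * a))")
    case True
    \<comment> \<open>The boundary before the merged mountain already separated its left half from
      the neighbour, so the belt node there is an old one.\<close>
    moreover from this have "range_starts (2 * a)" unfolding bd_double bd_Suc_double by presburger
    ultimately show ?thesis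
      using s m' A(3) by (auto simp: belt_bd range_bd st_nodes_def)
  next
    case False
    then show ?thesis
      using s' m' A(3) N(2) by (auto simp: belt_not_bd range_not_bd st_nodes_def)
  qed
qed

lemma nodes_mmb_Suc:
  assumes N: "Suc (Suc n) = 2 ^ j * Suc (2 * a)"
  shows "nodes (mmb (Suc n)) \<subseteq> nodes (mmb n) \<union> new_nodes (Suc n) a j"
proof -
  let ?N = "Suc n" and ?A = "nodes (mmb n) \<union> new_nodes (Suc n) a j"
  have old: "st_nodes 0 ?N \<subseteq> ?A" using st_nodes_mmb by auto
  have root: "mmb ?N \<in> ?A" "rnode 0 (Suc ?N) \<in> ?A" "Leaf ?N \<in> ?A" by (auto simp: new_nodes_def)
  have mmb: "nodes (mmb ?N) = {mmb ?N} \<union> nodes (bnode 0 (Suc ?N)) \<union> nodes (rnode 0 (Suc ?N))"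
    by (auto simp: mmb_eq)
  have merged: "nodes (bnode j (Suc (2 * a))) \<subseteq> ?A \<and> nodes (rnode j (Suc (2 * a))) \<subseteq> ?A"
    if "1 \<le> a"
  proof (rule nodes_merged [OF N that _ old])
    show "mountain j (Suc (2 * a)) \<in> ?A" "rnode j (Suc (2 * a)) \<in> ?A"
      using that by (auto simp: new_nodes_def)
    show "v \<in> ?A" if v: "v \<in> nodes (perfect j (2 ^ j * (2 * a - 1)))" for v
    \<comment> \<open>For \<open>j = 0\<close> the right partner of the merge is the new leaf,
      otherwise it is an old mountain.\<close>
    proof (cases j)
      case 0
      then have "Suc (2 * a - 1) = Suc n" using N \<open>1 \<le> a\<close> by simp
      then have "v = Leaf (Suc n)" using v 0 by simp
      then show ?thesis using root by simp
    next
      case (Suc r)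
      have "Suc (Suc n) = 2 ^ r * Suc (4 * a + 1)" using N Suc by simp
      then have d: "?N div 2 ^ r = 4 * a + 1" by (rule div_pred)
      have "v \<in> st_nodes r (4 * a + 1)"
        using v Suc nodes_mtn_st [of "4 * a + 1" r] \<open>1 \<le> a\<close> unfolding mtn_right_of_pair by auto
      then show ?thesis using st_nodes_div [of ?N r 0] d old by auto
    qed
  qed
  show ?thesis
  proof (cases "j = 0")
    case True
    then have "1 \<le> a" "Suc ?N = Suc (2 * a)" using N by (cases a, auto)
    then show ?thesis using merged True root unfolding mmb by auto
  next
    case False
    then have "even (Suc ?N)" using N by (metis dvd_power even_mult_iff neq0_conv)
    then have "nodes (rnode 0 (Suc ?N)) \<subseteq> ?A"
      using range_even [of "Suc ?N"] root old by (auto simp: st_nodes_def split: if_splits)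
    moreover have "nodes (bnode 0 (Suc ?N)) \<subseteq> ?A"
      using belt_odd_times_power [of j a] False merged N
      by (cases "a = 0") (auto simp: new_nodes_def)
    ultimately show ?thesis using root unfolding mmb by auto
  qed
qed

text \<open>Leaf \<open>Suc N - 2 ^ j = 2 ^ j * (2 * a)\<close> is the last one of the merged
  mountain, hence also lies in the range and belt nodes created above it.\<close>

lemma leaves_new_nodes:
  assumes "Suc N = 2 ^ j * Suc (2 * a)" "1 \<le> N" "v \<in> new_nodes N a j"
  shows "N \<in> leaves v \<or> Suc N - 2 ^ j \<in> leaves v"
proof -
  obtain e where e: "spans (rnode 0 (Suc N)) e N" "e < N"
    using spans_st [of "Suc N" 0] assms(2) by auto
  have 0: "N \<in> leaves (rnode 0 (Suc N))" "N \<in> leaves (mmb N)"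
    using leaves_spans [OF e(1)] e(2) assms(2) by (auto simp: leaves_mmb)
  have E: "Suc N - 2 ^ j = 2 ^ j * (2 * a)" using assms(1) by simp
  have 1: "2 ^ j * (2 * a) \<in> leaves (mountain j (Suc (2 * a)))"
      "2 ^ j * (2 * a) \<in> leaves (rnode j (Suc (2 * a)))" if "a \<noteq> 0"
  proof -
    have m: "spans (mountain j (Suc (2 * a))) (2 ^ Suc j * (a - 1)) (2 ^ j * (2 * a))"
      using spans_mtn [of "Suc (2 * a)" j] that by simp
    moreover have "mountain j (Suc (2 * a)) \<noteq> Missing" by (simp add: mountain_def)
    ultimately show "2 ^ j * (2 * a) \<in> leaves (mountain j (Suc (2 * a)))"
      using leaves_spans [OF m] spans_less [OF m] by auto
    then show "2 ^ j * (2 * a) \<in> leaves (rnode j (Suc (2 * a)))"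
      using that by (cases "range_starts (Suc (2 * a))") (auto simp: range_bd range_not_bd)
  qed
  show ?thesis
    using assms(3) 0 1 unfolding E new_nodes_def by (auto split: if_splits)
qed

section \<open>Nodes changed by an increment\<close>

text \<open>The appends after time \<open>m\<close> whose merge only involves leaves up to \<open>m\<close>.\<close>

definition late_merges :: "nat \<Rightarrow> nat \<Rightarrow> nat set" where
  "late_merges m n =
     {p. m < p \<and> p \<le> n \<and> (\<exists>a j. Suc p = 2 ^ j * Suc (2 * a) \<and> Suc p - 2 ^ j \<le> m)}"

lemma multiples_apart:
  fixes d :: nat
  assumes "d dvd x" "d dvd y" "x < y"
  shows "x + d \<le> y"
proof -
  obtain u v where uv: "x = d * u" "y = d * v" using assms by (auto elim!: dvdE)
  then have "u < v" using assms(3) by auto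
  then have "d * Suc u \<le> d * v" by (intro mult_le_mono2) simp
  then show ?thesis using uv by simp
qed

lemma le_floor_log: "2 ^ j \<le> k \<Longrightarrow> j \<le> floor_log k"
  using monoD [OF floor_log_mono, of "2 ^ j" k] by simp

lemma less_power_floor_log: "k < 2 ^ Suc (floor_log k)"
  using floor_log_exp2_gt [of k] by simp

text \<open>
  The exponents of 2 in \<open>p + 1\<close> strictly increase along \<open>late_merges m n\<close>, and all but the last are at
  most \<open>log\<^sub>2 (n - m)\<close>.
\<close>

lemma card_late_merges:
  assumes "m < n"
  shows "finite (late_merges m n)" "card (late_merges m n) \<le> floor_log (n - m) + 2"
proof -
  let ?A = "late_merges m n"
  show fin: "finite ?A" by (rule finite_subset [of _ "{..n}"]) (auto simp: late_merges_def)
  have "\<forall>p\<in>?A. \<exists>j. 2 ^ j dvd Suc p \<and> Suc p - 2 ^ j \<le> m"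
  proof
    fix p assume "p \<in> ?A"
    then obtain a j where "Suc p = 2 ^ j * Suc (2 * a)" "Suc p - 2 ^ j \<le> m"
      by (auto simp only: late_merges_def mem_Collect_eq)
    then show "\<exists>j. 2 ^ j dvd Suc p \<and> Suc p - 2 ^ j \<le> m" by (metis dvd_triv_left)
  qed
  then obtain f where f: "\<And>p. p \<in> ?A \<Longrightarrow> 2 ^ f p dvd Suc p \<and> Suc p - 2 ^ f p \<le> m"
    by metis
  have less: "f p < f p'" "2 ^ f p \<le> n - m" if "p \<in> ?A" "p' \<in> ?A" "p < p'" for p p'
  proof -
    have m: "m < p" "p' \<le> n" using that by (auto simp: late_merges_def)
    \<comment> \<open>Otherwise \<open>2 ^ f p'\<close> divides both \<open>p + 1\<close> and
      \<open>p' + 1\<close>, so these differ by at least \<open>2 ^ f p'\<close>, although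
      \<open>p' + 1 - 2 ^ f p' \<le> m < p\<close>.\<close>
    show lt: "f p < f p'"
    proof (rule ccontr)
      assume "\<not> f p < f p'"
      then have "2 ^ f p' dvd Suc p" using f [OF that(1)] by (meson dvd_trans le_imp_power_dvd not_less)
      then have "Suc p + 2 ^ f p' \<le> Suc p'"
        using f [OF that(2)] that(3) by (intro multiples_apart) auto
      then show False using f [OF that(2)] m by linarith
    qed
    then have "2 ^ f p dvd Suc p'" using f [OF that(2)] by (meson dvd_trans le_imp_power_dvd less_imp_le)
    then have "Suc p + 2 ^ f p \<le> Suc p'"
      using f [OF that(1)] that(3) by (intro multiples_apart) auto
    then show "2 ^ f p \<le> n - m" using m by linarith
  qed
  show "card ?A \<le> floor_log (n - m) + 2"
  proof (cases "?A = {}")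
    case False
    \<comment> \<open>Apart from the last merge, the exponents are distinct elements of
      \<open>{..floor_log (n - m)}\<close>; this accounts for \<open>floor_log (n - m) + 1\<close>
      merges.\<close>
    let ?B = "?A - {Max ?A}"
    have "inj_on f ?B"
      using less(1) by (intro inj_onI) (metis DiffD1 less_irrefl nat_neq_iff)
    moreover have "f ` ?B \<subseteq> {..floor_log (n - m)}"
    proof (rule image_subsetI)
      fix p assume "p \<in> ?B"
      then have p: "p \<in> ?A" "p \<noteq> Max ?A" by auto
      then have "p < Max ?A" "Max ?A \<in> ?A"
        using fin False Max_in by (auto simp: order.not_eq_order_implies_strict)
      then show "f p \<in> {..floor_log (n - m)}" using less(2) [OF p(1)] le_floor_log by auto
    qed
    ultimately have "card ?B \<le> card {..floor_log (n - m)}" by (intro card_inj_on_le) auto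
    then show ?thesis using fin False by (simp add: card_Diff_singleton_if split: if_splits)
  qed simp
qed

definition reworked :: "nat \<Rightarrow> nat \<Rightarrow> tree set" where
  "reworked m n = {v \<in> nodes (mmb n) - nodes (mmb m). leaves v \<inter> {1..m} \<noteq> {}}"

lemma created_at:
  assumes "m \<le> n" "v \<in> nodes (mmb n)" "v \<notin> nodes (mmb m)"
  shows "\<exists>p. m \<le> p \<and> p < n \<and> v \<in> nodes (mmb (Suc p)) - nodes (mmb p)"
  using assms
proof (induction n rule: dec_induct)
  case (step n)
  then show ?case by (cases "v \<in> nodes (mmb n)") (auto intro: less_SucI)
qed simp

text \<open>A reworked node contains the leaf \<open>m + 1\<close>, or it was created by a late merge.\<close>

lemma reworked_subset:
  assumes "m < n"
  shows "\<exists>F. reworked m n \<subseteq> set (path (Suc m) (mmb n)) \<union> (\<Union>p\<in>late_merges m n. F p) \<and>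
    (\<forall>p. finite (F p) \<and> card (F p) \<le> 6)"
proof -
  have "\<forall>p. \<exists>a j. Suc p = 2 ^ j * Suc (2 * a)" using odd_times_power by blast
  then obtain a j where aj: "\<And>p. Suc p = 2 ^ j p * Suc (2 * a p)" by metis
  define F where "F p = new_nodes p (a p) (j p)" for p
  have "v \<in> set (path (Suc m) (mmb n)) \<union> (\<Union>p\<in>late_merges m n. F p)" if v: "v \<in> reworked m n" for v
  proof (cases "Suc m \<in> leaves v")
    case True
    then show ?thesis
      using v assms set_path [OF spans_mmb, of "Suc m" n] by (auto simp: reworked_def leaves_mmb)
  next
    case False
    have vn: "v \<in> nodes (mmb n)" "v \<notin> nodes (mmb m)" and ne: "leaves v \<inter> {1..m} \<noteq> {}"
      using v by (auto simp: reworked_def)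
    \<comment> \<open>The leaves of a node form an interval; having an old leaf but not
      \<open>m + 1\<close>, it stays on the old side.\<close>
    obtain c e where "spans v c e" using spans_node [OF spans_mmb vn(1)] by blast
    then have old: "leaves v \<subseteq> {..m}" using False ne leaves_spans [of v c e] by auto
    obtain p where p: "m \<le> p" "p < n" "v \<in> nodes (mmb (Suc p)) - nodes (mmb p)"
      using created_at [of m n v] assms vn by auto
    then have F: "v \<in> F (Suc p)" using nodes_mmb_Suc [OF aj] by (auto simp: F_def)
    have "Suc p \<notin> leaves v" using old p by auto
    then have "Suc (Suc p) - 2 ^ j (Suc p) \<in> leaves v"
      using leaves_new_nodes [OF aj, of "Suc p" v] F by (auto simp: F_def)
    then have "Suc (Suc p) - 2 ^ j (Suc p) \<le> m" using old by auto
    then have "Suc p \<in> late_merges m n"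
      unfolding late_merges_def using p(1,2) aj [of "Suc p"] by (blast intro: le_imp_less_Suc Suc_leI)
    then show ?thesis using F by blast
  qed
  moreover have "finite (F p) \<and> card (F p) \<le> 6" for p by (simp add: F_def card_new_nodes)
  ultimately show ?thesis by (intro exI [of _ F]) blast
qed

text \<open>With \<open>k = floor_log (n - m)\<close>, the path from leaf \<open>m + 1\<close> has
  at most \<open>2 * (k + 1) + 4\<close> nodes, and each of at most \<open>k + 2\<close> late merges
  accounts for six more.\<close>

lemma card_reworked:
  assumes "m < n"
  shows "finite (reworked m n)" "card (reworked m n) \<le> 8 * floor_log (n - m) + 18"
proof -
  let ?k = "floor_log (n - m)"
  show "finite (reworked m n)" by (simp add: reworked_def)
  obtain F where F: "reworked m n \<subseteq> set (path (Suc m) (mmb n)) \<union> (\<Union>p\<in>late_merges m n. F p)"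
    "\<And>p. finite (F p)" "\<And>p. card (F p) \<le> 6"
    using reworked_subset [OF assms] by blast
  have "n < Suc m + 2 ^ Suc ?k" using less_power_floor_log [of "n - m"] by linarith
  then have 1: "length (path (Suc m) (mmb n)) \<le> 2 * Suc ?k + 4"
    using assms by (intro length_path_mmb) auto
  have "card (\<Union>p\<in>late_merges m n. F p) \<le> (\<Sum>p\<in>late_merges m n. card (F p))"
    using card_late_merges [OF assms] by (intro card_UN_le)
  also have "\<dots> \<le> card (late_merges m n) * 6"
    using F(3) sum_bounded_above [of "late_merges m n" "\<lambda>p. card (F p)" 6] by simp
  also have "\<dots> \<le> (?k + 2) * 6" using card_late_merges [OF assms] by simp
  finally have 2: "card (\<Union>p\<in>late_merges m n. F p) \<le> (?k + 2) * 6" .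
  have "card (reworked m n) \<le> card (set (path (Suc m) (mmb n)) \<union> (\<Union>p\<in>late_merges m n. F p))"
    using F card_late_merges [OF assms] by (intro card_mono) auto
  also have "\<dots> \<le> card (set (path (Suc m) (mmb n))) + card (\<Union>p\<in>late_merges m n. F p)"
    by (rule card_Un_le)
  also have "\<dots> \<le> length (path (Suc m) (mmb n)) + card (\<Union>p\<in>late_merges m n. F p)"
    by (simp add: card_length)
  finally show "card (reworked m n) \<le> 8 * ?k + 18" using 1 2 by simp
qed

section \<open>The part of a membership proof changed by an increment\<close>

definition sibling_step :: "hash_fun \<Rightarrow> hash \<Rightarrow> (nat \<Rightarrow> bool list) \<Rightarrow> nat \<Rightarrow> tree \<Rightarrow> step" where
  "sibling_step H d x i v = (case v of Node l r \<Rightarrow>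
     if i \<in> leaves l then RightSib (label H d x r)
     else if l = Missing then NoSib else LeftSib (label H d x l) | _ \<Rightarrow> NoSib)"

text \<open>Each path node above the leaf determines one entry by itself, so equal path prefixes
  give equal entries. The leaf has no entry, whence the \<open>- 1\<close> in
  \<open>kept\<close>.\<close>

lemma siblings_eq: "i \<in> leaves t \<Longrightarrow> siblings H d x i t = map (sibling_step H d x i) (tl (path i t))"
proof (induction t)
  case (Node l r)
  have "i \<in> leaves l \<Longrightarrow> path i l \<noteq> []" "i \<in> leaves r \<Longrightarrow> path i r \<noteq> []"
    by (simp_all add: path_nonempty)
  with Node show ?case by (auto simp: sibling_step_def)
qed auto

lemma length_siblings: "i \<in> leaves t \<Longrightarrow> length (siblings H d x i t) = length (path i t) - 1"
  by (simp add: siblings_eq)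

lemma recompute_siblings:
  "i \<in> leaves t \<Longrightarrow> recompute H d (H (x i)) (siblings H d x i t) = label H d x t"
  by (induction t) (auto simp: recompute_def)

lemma take_kept:
  assumes "1 \<le> i" "i \<le> m" "i \<le> n"
  shows "kept m n i \<le> length (membership_proof H d x m i)"
    "take (kept m n i) (membership_proof H d x m i) = take (kept m n i) (membership_proof H d x n i)"
proof -
  let ?p = "path i (mmb m)" and ?q = "path i (mmb n)"
  let ?c = "longest_common_prefix ?p ?q"
  have i: "i \<in> leaves (mmb m)" "i \<in> leaves (mmb n)" using assms by (auto simp: leaves_mmb)
  have "prefix ?c ?p" "prefix ?c ?q"
    by (auto simp: longest_common_prefix_prefix1 longest_common_prefix_prefix2)
  then obtain u v where uv: "?p = ?c @ u" "?q = ?c @ v" by (auto elim!: prefixE)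
  have "length ?c \<le> length ?p" by (subst uv(1)) simp
  then show "kept m n i \<le> length (membership_proof H d x m i)"
    using i by (simp add: kept_def membership_proof_def length_siblings)
  have "take (kept m n i) (tl ?p) = take (kept m n i) (tl ?q)"
  proof (cases "?c = []")
    case False
    then show ?thesis by (subst uv(1), subst uv(2)) (simp add: kept_def)
  qed (simp add: kept_def)
  then show "take (kept m n i) (membership_proof H d x m i) = take (kept m n i) (membership_proof H d x n i)"
    using i by (simp add: membership_proof_def siblings_eq take_map)
qed

text \<open>A path node above the common prefix cannot belong to the old belt: its path from leaf
  \<open>i\<close> would by \<open>prefix_path\<close> be a common prefix containing it. The changed
  entries are thus counted by \<open>reworked\<close>.\<close>

lemma length_drop_kept:
  assumes "1 \<le> i" "i \<le> m" "m < n"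
  shows "length (drop (kept m n i) (membership_proof H d x n i)) \<le> 8 * floor_log (n - m) + 18"
proof -
  let ?p = "path i (mmb m)" and ?q = "path i (mmb n)"
  let ?c = "longest_common_prefix ?p ?q"
  have i: "i \<in> leaves (mmb m)" "i \<in> leaves (mmb n)" using assms by (auto simp: leaves_mmb)
  have "prefix ?c ?q" by (rule longest_common_prefix_prefix2)
  then obtain v where v: "?q = ?c @ v" by (auto elim!: prefixE)
  have sub: "set v \<subseteq> reworked m n"
  proof
    fix w assume w: "w \<in> set v"
    then have "w \<in> set ?q" by (subst v) simp
    then have wn: "w \<in> nodes (mmb n)" "i \<in> leaves w" using set_path [OF spans_mmb i(2)] by auto
    have "w \<notin> nodes (mmb m)"
    proof
      assume "w \<in> nodes (mmb m)"
      then have "prefix (path i w) ?p" "prefix (path i w) ?q"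
        using wn by (auto intro: prefix_path [OF spans_mmb])
      then have "prefix (path i w) ?c" by (rule longest_common_prefix_max_prefix)
      moreover have "w \<in> set (path i w)" using wn spans_node [OF spans_mmb wn(1)] last_path by blast
      ultimately have "w \<in> set ?c" using set_mono_prefix by blast
      moreover have "distinct (?c @ v)" using distinct_path [of i "mmb n"] v by simp
      ultimately show False using w by auto
    qed
    then show "w \<in> reworked m n" using wn assms by (auto simp: reworked_def)
  qed
  have "distinct v" using distinct_path [of i "mmb n"] v by (metis distinct_append)
  then have "length v = card (set v)" by (simp add: distinct_card)
  also have "\<dots> \<le> card (reworked m n)" using sub card_reworked(1) [OF assms(3)] by (rule card_mono [rotated])
  also have "\<dots> \<le> 8 * floor_log (n - m) + 18" by (rule card_reworked(2) [OF assms(3)])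
  finally have "length v \<le> 8 * floor_log (n - m) + 18" .
  moreover have "length ?q = length ?c + length v" by (subst v) simp
  ultimately show ?thesis
    using i by (simp add: kept_def membership_proof_def length_siblings)
qed

section \<open>Increment proofs\<close>

fun frontier :: "(tree \<Rightarrow> bool) \<Rightarrow> tree \<Rightarrow> tree list" where
  "frontier Q Missing = []"
| "frontier Q (Leaf i) = [Leaf i]"
| "frontier Q (Node l r) = (if Q (Node l r) then [Node l r] else frontier Q l @ frontier Q r)"

fun rebuild :: "(tree \<Rightarrow> bool) \<Rightarrow> tree \<Rightarrow> instr list" where
  "rebuild Q Missing = []"
| "rebuild Q (Leaf i) = [Shift]"
| "rebuild Q (Node l r) =
    (if Q (Node l r) then [Shift]
     else if l = Missing then rebuild Q r @ [JoinDefault]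
     else rebuild Q l @ rebuild Q r @ [Join])"

lemma reduce_rebuild:
  "spans t a b \<Longrightarrow> t \<noteq> Missing \<Longrightarrow>
   reduce_nodes Node Missing (rebuild Q t @ is) (frontier Q t @ vs) stk =
   reduce_nodes Node Missing is vs (t # stk)"
proof (induction t arbitrary: a b "is" vs stk)
  case (Node l r)
  then obtain c where c: "spans l a c" "spans r c b" "c < b" by auto
  then have "r \<noteq> Missing" by auto
  then show ?case using Node.IH(1) [OF c(1)] Node.IH(2) [OF c(2)] by auto
qed auto

lemma frontier_nodes: "set (frontier Q t) \<subseteq> nodes t"
  by (induction t) auto

lemma leaves_frontier: "(\<Union>v\<in>set (frontier Q t). leaves v) = leaves t"
  by (induction t) auto

text \<open>Being free of the traversal, this description makes frontiers of two different belts
  comparable.\<close>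

lemma set_frontier:
  assumes "spans t a b" "\<And>i. Leaf i \<in> nodes t \<Longrightarrow> Q (Leaf i)"
  shows "set (frontier Q t) =
    {v \<in> nodes t. Q v \<and> (\<forall>w\<in>nodes t. Q w \<longrightarrow> v \<in> nodes w \<longrightarrow> w = v)}"
  using assms
proof (induction t arbitrary: a b)
  case (Node l r)
  show ?case
  proof (cases "Q (Node l r)")
    case True
    have "w = Node l r" if "w \<in> nodes (Node l r)" "Node l r \<in> nodes w" for w
      using that nodes_antisym by blast
    moreover have "Node l r \<in> nodes (Node l r)" by simp
    ultimately show ?thesis
      using True by (auto simp del: nodes.simps(3))
  next
    case False
    obtain c where c: "spans l a c" "spans r c b" using Node.prems by auto
    have IH: "set (frontier Q l) = {v \<in> nodes l. Q v \<and> (\<forall>w\<in>nodes l. Q w \<longrightarrow> v \<in> nodes w \<longrightarrow> w = v)}"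
      "set (frontier Q r) = {v \<in> nodes r. Q v \<and> (\<forall>w\<in>nodes r. Q w \<longrightarrow> v \<in> nodes w \<longrightarrow> w = v)}"
      using Node.IH(1) [OF c(1)] Node.IH(2) [OF c(2)] Node.prems(2) by simp_all
    have "v \<notin> nodes w" if "v \<in> nodes l \<and> w \<in> nodes r \<or> v \<in> nodes r \<and> w \<in> nodes l" for v w
      using that nodes_disjoint [OF Node.prems(1)] nodes_trans by blast
    then have "set (frontier Q l) \<union> set (frontier Q r) =
      {v \<in> nodes l \<union> nodes r. Q v \<and> (\<forall>w\<in>nodes l \<union> nodes r. Q w \<longrightarrow> v \<in> nodes w \<longrightarrow> w = v)}"
      unfolding IH by blast
    then show ?thesis using False by auto
  qed
qed auto

definition left_of :: "tree \<Rightarrow> tree \<Rightarrow> bool" where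
  "left_of u v \<longleftrightarrow> leaves u \<noteq> {} \<and> (\<forall>i\<in>leaves u. \<forall>j\<in>leaves v. i < j) \<and> leaves v \<noteq> {}"

lemma left_of_asym: "left_of u v \<Longrightarrow> \<not> left_of v u"
  unfolding left_of_def by (meson all_not_in_conv less_asym)

lemma sorted_frontier: "spans t a b \<Longrightarrow> sorted_wrt left_of (frontier Q t)"
proof (induction t arbitrary: a b)
  case (Node l r)
  then obtain c where c: "spans l a c" "spans r c b" by auto
  have "left_of u v" if "u \<in> nodes l" "v \<in> nodes r" for u v
    using that leaves_node_subset [of u l] leaves_node_subset [of v r] leaves_spans [OF c(1)]
      leaves_spans [OF c(2)] nodes_leaves_nonempty [OF c(1)] nodes_leaves_nonempty [OF c(2)]
    unfolding left_of_def by fastforce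
  then show ?case
    using Node.IH(1) [OF c(1)] Node.IH(2) [OF c(2)] frontier_nodes [of Q l] frontier_nodes [of Q r]
    by (auto simp: sorted_wrt_append)
qed auto

text \<open>With \<open>sorted_frontier\<close>, this lifts equality of node sets to equality of
  node lists, on whose order the instructions rely.\<close>

lemma sorted_wrt_unique:
  assumes asym: "\<And>x y. r x y \<Longrightarrow> \<not> r y x"
  shows "sorted_wrt r xs \<Longrightarrow> sorted_wrt r ys \<Longrightarrow> set xs = set ys \<Longrightarrow> xs = ys"
proof (induction xs arbitrary: ys)
  case (Cons x xs)
  then obtain y zs where ys: "ys = y # zs" by (cases ys) auto
  have "x = y"
  proof (rule ccontr)
    assume "x \<noteq> y"
    then have "y \<in> set xs" "x \<in> set zs" using Cons.prems(3) ys by auto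
    then show False using Cons.prems(1,2) ys asym by auto
  qed
  moreover have "x \<notin> set xs" "y \<notin> set zs" using Cons.prems(1,2) ys asym by auto
  ultimately have "set xs = set zs" using Cons.prems(3) ys by auto
  then show ?case using Cons.IH [of zs] Cons.prems ys \<open>x = y\<close> by auto
qed simp

section \<open>Size of an increment proof\<close>

fun missing_depth :: "tree \<Rightarrow> nat" where
  "missing_depth (Node l r) = (if l = Missing then Suc (missing_depth r) else 0)"
| "missing_depth _ = 0"

text \<open>
  Chains of nodes without left child have length at most two, so the number of instructions is
  linear in the number of nodes they combine.
\<close>

lemma length_rebuild:
  "spans t a b \<Longrightarrow> t \<noteq> Missing \<Longrightarrow> (\<And>v. v \<in> nodes t \<Longrightarrow> missing_depth v \<le> 2) \<Longrightarrow>
   length (rebuild Q t) + 5 \<le> 6 * length (frontier Q t) + missing_depth t"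
proof (induction t arbitrary: a b)
  case (Node l r)
  then obtain c where c: "spans l a c" "spans r c b" "c < b" by auto
  then have r: "r \<noteq> Missing" by auto
  have IHr: "length (rebuild Q r) + 5 \<le> 6 * length (frontier Q r) + missing_depth r"
    using Node.IH(2) [OF c(2) r] Node.prems(3) by simp
  show ?case
  proof (cases "l = Missing")
    case True
    then show ?thesis using IHr by auto
  next
    case False
    have "length (rebuild Q l) + 5 \<le> 6 * length (frontier Q l) + missing_depth l"
      using Node.IH(1) [OF c(1) False] Node.prems(3) by simp
    \<comment> \<open>The slack 5 pays for the \<open>Join\<close> and for up to two
      \<open>JoinDefault\<close> on either side; the factor 6 is one more, for the
      \<open>Shift\<close> of a single node.\<close>
    moreover have "missing_depth l \<le> 2" "missing_depth r \<le> 2"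
      using Node.prems(3) False r by (simp_all add: nodes_self)
    ultimately show ?thesis using IHr False by auto
  qed
qed auto

lemma missing_depth_perfect: "v \<in> nodes (perfect h k) \<Longrightarrow> missing_depth v = 0"
  by (induction h k rule: perfect.induct) (auto simp: perfect.simps)

text \<open>The worst case is a first belt node above a first range node; below these is a perfect
  tree.\<close>

lemma missing_depth_st:
  "1 \<le> N \<Longrightarrow> (\<forall>v\<in>nodes (bnode i N). missing_depth v \<le> 2) \<and> (\<forall>v\<in>nodes (rnode i N). missing_depth v \<le> 1)"
proof (induction N arbitrary: i rule: less_induct)
  case (less N)
  show ?case
  proof (cases "N = 1")
    case False
    then have N: "2 \<le> N" "1 \<le> N div 2" "N div 2 < N" using less.prems by auto
    have M: "\<forall>v\<in>nodes (mountain i N). missing_depth v = 0" "missing_depth (mountain i N) = 0"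
      using missing_depth_perfect nodes_self [of "mountain i N"] by (auto simp: mountain_def)
    have IH: "\<forall>v\<in>nodes (bnode (Suc i) (N div 2)). missing_depth v \<le> 2"
      "\<forall>v\<in>nodes (rnode (Suc i) (N div 2)). missing_depth v \<le> 1"
      using less.IH [of "N div 2" "Suc i"] N by auto
    have "missing_depth (rnode (Suc i) (N div 2)) \<le> 1"
      using IH(2) nodes_self [of "rnode (Suc i) (N div 2)"] by (cases "rnode (Suc i) (N div 2) = Missing") auto
    then show ?thesis
      using IH M N by (cases "range_starts N") (auto simp: belt_bd range_bd belt_not_bd range_not_bd)
  qed simp
qed

lemma missing_depth_mmb: "v \<in> nodes (mmb n) \<Longrightarrow> missing_depth v \<le> 2"
proof (cases "n = 0")
  case False
  assume "v \<in> nodes (mmb n)"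
  moreover have "missing_depth (rnode 0 (Suc n)) \<le> 1"
    using missing_depth_st [of "Suc n" 0] nodes_self [of "rnode 0 (Suc n)"]
    by (cases "rnode 0 (Suc n) = Missing") auto
  ultimately show ?thesis
    using missing_depth_st [of "Suc n" 0] False by (fastforce simp: mmb_eq)
qed simp

text \<open>The nodes through which the traversal passes fail \<open>Q\<close>, and a cut of a
  binary tree has at most one node more than there are nodes above it.\<close>

lemma length_frontier: "spans t a b \<Longrightarrow> length (frontier Q t) \<le> Suc (card {v \<in> nodes t. \<not> Q v})"
proof (induction t arbitrary: a b)
  case (Node l r)
  obtain c where c: "spans l a c" "spans r c b" using Node.prems by auto
  show ?case
  proof (cases "Q (Node l r)")
    case False
    let ?l = "{v \<in> nodes l. \<not> Q v}" and ?r = "{v \<in> nodes r. \<not> Q v}"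
    have "{v \<in> nodes (Node l r). \<not> Q v} = insert (Node l r) (?l \<union> ?r)" using False by auto
    moreover have "Node l r \<notin> ?l \<union> ?r" using size_node [of "Node l r" l] size_node [of "Node l r" r] by auto
    moreover have "card (?l \<union> ?r) = card ?l + card ?r"
      using nodes_disjoint [OF Node.prems] by (intro card_Un_disjoint) auto
    ultimately show ?thesis
      using False Node.IH(1) [OF c(1)] Node.IH(2) [OF c(2)] by simp
  qed simp
qed auto

lemma Leaf_in_nodes: "i \<in> leaves t \<Longrightarrow> Leaf i \<in> nodes t"
  by (induction t) auto

text \<open>Since \<open>label\<close> is a homomorphism from trees to hashes, instructions that
  rebuild a belt also recompute its root hash.\<close>

lemma reduce_nodes_label:
  "reduce_nodes Node Missing is vs stk = Some t \<Longrightarrow>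
   reduce_nodes (\<lambda>a b. H (a @ b)) d is (map (label H d x) vs) (map (label H d x) stk) = Some (label H d x t)"
  by (induction Node Missing "is" vs stk rule: reduce_nodes.induct) auto

lemma distinct_if_sorted_wrt_asym: 
  assumes "sorted_wrt r xs" "\<And>x y. r x y \<Longrightarrow> \<not> r y x"
  shows "distinct xs"
  using assms by (induction xs) auto

text \<open>
  The shared part of an increment proof consists of the maximal common nodes of the two belts,
  the rest of the maximal nodes with new leaves only.
\<close>

definition shared :: "nat \<Rightarrow> nat \<Rightarrow> tree list" where
  "shared m n = frontier (\<lambda>v. v \<in> nodes (mmb n)) (mmb m)"

definition cover :: "nat \<Rightarrow> nat \<Rightarrow> tree list" where
  "cover m n = frontier (\<lambda>v. v \<in> nodes (mmb m) \<or> leaves v \<inter> {1..m} = {}) (mmb n)"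

definition belt_increment :: "nat \<Rightarrow> nat \<Rightarrow> tree increment_proof" where
  "belt_increment m n =
    (shared m n, drop (length (shared m n)) (cover m n),
     rebuild (\<lambda>v. v \<in> nodes (mmb n)) (mmb m),
     rebuild (\<lambda>v. v \<in> nodes (mmb m) \<or> leaves v \<inter> {1..m} = {}) (mmb n))"

text \<open>A node of the cover is either purely new or a maximal common node, and the latter come
  first because old leaves precede new ones. This is why a single node list serves both
  roots.\<close>

lemma shared_prefix_cover:
  assumes "m < n"
  shows "prefix (shared m n) (cover m n)"
proof -
  let ?new = "\<lambda>v. leaves v \<inter> {1..m} = {}"
  let ?F = "cover m n"
  have F: "set ?F = {v \<in> nodes (mmb n). (v \<in> nodes (mmb m) \<or> ?new v) \<and>
      (\<forall>w\<in>nodes (mmb n). w \<in> nodes (mmb m) \<or> ?new w \<longrightarrow> v \<in> nodes w \<longrightarrow> w = v)}"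
    unfolding cover_def
  proof (rule set_frontier [OF spans_mmb])
    fix i assume "Leaf i \<in> nodes (mmb n)"
    show "Leaf i \<in> nodes (mmb m) \<or> leaves (Leaf i) \<inter> {1..m} = {}"
      using Leaf_in_nodes [of i "mmb m"] leaves_mmb [of m] by auto
  qed
  have C: "set (shared m n) = {v \<in> nodes (mmb m). v \<in> nodes (mmb n) \<and>
      (\<forall>w\<in>nodes (mmb m). w \<in> nodes (mmb n) \<longrightarrow> v \<in> nodes w \<longrightarrow> w = v)}"
    unfolding shared_def
  proof (rule set_frontier [OF spans_mmb])
    fix i assume "Leaf i \<in> nodes (mmb m)"
    then have "i \<in> leaves (mmb m)" using leaves_node_subset [of "Leaf i" "mmb m"] by simp
    then show "Leaf i \<in> nodes (mmb n)"
      using Leaf_in_nodes [of i "mmb n"] leaves_mmb [of m] leaves_mmb [of n] assms by auto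
  qed
  have sF: "sorted_wrt left_of ?F" unfolding cover_def by (rule sorted_frontier [OF spans_mmb])
  have new: "?new v \<longleftrightarrow> v \<notin> nodes (mmb m)" if "v \<in> set ?F" for v
  proof
    assume "?new v"
    then show "v \<notin> nodes (mmb m)"
      using leaves_node_subset [of v "mmb m"] leaves_mmb [of m] nodes_leaves_nonempty [OF spans_mmb, of v m] by blast
  next
    assume "v \<notin> nodes (mmb m)"
    then show "?new v" using that F by auto
  qed
  \<comment> \<open>Once a purely new node occurs, everything to its right is purely new.\<close>
  have part: "vs = filter (\<lambda>v. \<not> ?new v) vs @ filter ?new vs" if "sorted_wrt left_of vs" "set vs \<subseteq> set ?F" for vs
    using that
  proof (induction vs)
    case (Cons v vs)
    show ?case
    proof (cases "?new v")
      case True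
      have "?new w" if "w \<in> set vs" for w
      proof -
        have "left_of v w" using Cons.prems that by simp
        moreover obtain i where "i \<in> leaves v" "i \<notin> {1..m}"
          using True calculation unfolding left_of_def by blast
        moreover have "i \<ge> 1"
          using \<open>i \<in> leaves v\<close> Cons.prems(2) F leaves_node_subset [of v "mmb n"] leaves_mmb [of n] by auto
        ultimately show ?thesis by (fastforce simp: left_of_def)
      qed
      then have "filter (\<lambda>v. \<not> ?new v) vs = []" "filter ?new vs = vs"
        by (auto simp: filter_empty_conv intro!: filter_True)
      then show ?thesis using True by simp
    next
      case False
      then show ?thesis using Cons by auto
    qed
  qed simp
  have "filter (\<lambda>v. \<not> ?new v) ?F = shared m n"
  proof (rule sorted_wrt_unique [OF left_of_asym])
    show "sorted_wrt left_of (filter (\<lambda>v. \<not> ?new v) ?F)" using sF by (rule sorted_wrt_filter)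
    show "sorted_wrt left_of (shared m n)" unfolding shared_def by (rule sorted_frontier [OF spans_mmb])
    \<comment> \<open>Nodes above an old node have old leaves, so admitting purely new nodes does
      not affect which old nodes are maximal.\<close>
    have up: "\<not> ?new w" if "v \<in> nodes w" "v \<in> nodes (mmb m)" for v w
      using leaves_node_subset [OF that(1)] leaves_node_subset [OF that(2)] leaves_mmb [of m]
        nodes_leaves_nonempty [OF spans_mmb that(2)] by blast
    have "set (filter (\<lambda>v. \<not> ?new v) ?F) = {v \<in> set ?F. v \<in> nodes (mmb m)}" using new by auto
    also have "\<dots> = set (shared m n)"
      unfolding F C using up by blast
    finally show "set (filter (\<lambda>v. \<not> ?new v) ?F) = set (shared m n)" .
  qed
  then show ?thesis using part [OF sF] by (metis order_refl prefixI)
qed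

lemma is_increment_proof_belt:
  assumes "1 \<le> m" "m < n"
  shows "is_increment_proof m n (belt_increment m n)"
proof -
  let ?C = "shared m n" and ?F = "cover m n"
  have CD: "?C @ drop (length ?C) ?F = ?F"
    using shared_prefix_cover [OF assms(2)] by (auto elim!: prefixE)
  have ne: "mmb m \<noteq> Missing" "mmb n \<noteq> Missing" using assms by (auto simp: mmb_eq)
  have "sorted_wrt left_of ?F" unfolding cover_def by (rule sorted_frontier [OF spans_mmb])
  then have "distinct ?F" by (rule distinct_if_sorted_wrt_asym) (rule left_of_asym)
  moreover have "set ?F \<subseteq> nodes (mmb n)" unfolding cover_def by (rule frontier_nodes)
  moreover have "\<forall>u\<in>set ?F. \<forall>v\<in>set ?F. u \<in> nodes v \<longrightarrow> u = v"
  proof (intro ballI impI)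
    fix u v assume uv: "u \<in> set ?F" "v \<in> set ?F" "u \<in> nodes v"
    have "leaves u \<subseteq> leaves v" "leaves u \<noteq> {}"
      using uv leaves_node_subset [of u v] \<open>set ?F \<subseteq> nodes (mmb n)\<close>
        nodes_leaves_nonempty [OF spans_mmb, of u n] by auto
    then have "\<not> left_of u v" "\<not> left_of v u" unfolding left_of_def by blast+
    then show "u = v" using uv \<open>sorted_wrt left_of ?F\<close>
      by (metis in_set_conv_nth linorder_neqE_nat sorted_wrt_nth_less)
  qed
  moreover have "(\<Union>v\<in>set ?C. leaves v) = {1..m}" "(\<Union>v\<in>set ?F. leaves v) = {1..n}"
    unfolding shared_def cover_def leaves_frontier leaves_mmb by auto
  moreover have "reduce_nodes Node Missing (rebuild (\<lambda>v. v \<in> nodes (mmb n)) (mmb m)) ?C [] = Some (mmb m)"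
    unfolding shared_def
    using reduce_rebuild [OF spans_mmb ne(1), of _ "[]" "[]" "[]"] by simp
  moreover have "reduce_nodes Node Missing
      (rebuild (\<lambda>v. v \<in> nodes (mmb m) \<or> leaves v \<inter> {1..m} = {}) (mmb n)) ?F [] = Some (mmb n)"
    unfolding cover_def
    using reduce_rebuild [OF spans_mmb ne(2), of _ "[]" "[]" "[]"] by simp
  ultimately show ?thesis
    unfolding is_increment_proof_def belt_increment_def by (simp only: prod.case CD)
qed

text \<open>With \<open>k = floor_log (n - m)\<close>, the cover has at most
  \<open>8 * k + 19\<close> nodes and each instruction list is at most six times as long:
  \<open>13 * (8 * k + 19)\<close> tokens besides the three lengths in front.\<close>

lemma length_increment_message:
  assumes "1 \<le> m" "m < n"
  shows "length (increment_message (hash_increment_proof H d x (belt_increment m n)))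
    \<le> 104 * floor_log (n - m) + 250"
proof -
  let ?F = "cover m n" and ?k = "floor_log (n - m)"
  have "{v \<in> nodes (mmb n). \<not> (v \<in> nodes (mmb m) \<or> leaves v \<inter> {1..m} = {})} = reworked m n"
    by (auto simp: reworked_def)
  then have F: "length ?F \<le> 8 * ?k + 19"
    using length_frontier [OF spans_mmb, of "\<lambda>v. v \<in> nodes (mmb m) \<or> leaves v \<inter> {1..m} = {}" n]
      card_reworked(2) [OF assms(2)] by (simp add: cover_def)
  have "length (rebuild Q (mmb p)) \<le> 6 * length (frontier Q (mmb p))" if "1 \<le> p" for p Q
  proof -
    have ne: "mmb p \<noteq> Missing" using that by (simp add: mmb_eq)
    have "length (rebuild Q (mmb p)) + 5 \<le> 6 * length (frontier Q (mmb p)) + missing_depth (mmb p)"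
      by (rule length_rebuild [OF spans_mmb ne missing_depth_mmb])
    then show ?thesis using missing_depth_mmb [OF nodes_self [OF ne]] by linarith
  qed
  then have "length (rebuild (\<lambda>v. v \<in> nodes (mmb n)) (mmb m)) \<le> 6 * length (shared m n)"
    "length (rebuild (\<lambda>v. v \<in> nodes (mmb m) \<or> leaves v \<inter> {1..m} = {}) (mmb n)) \<le> 6 * length ?F"
    using assms by (auto simp: shared_def cover_def)
  moreover have "length (shared m n) \<le> length ?F"
    using shared_prefix_cover [OF assms(2)] by (rule prefix_length_le)
  ultimately show ?thesis
    using F by (simp add: increment_message_def hash_increment_proof_def belt_increment_def)
qed

lemma increment_accepts_belt:
  assumes "1 \<le> m" "m < n"
  shows "increment_accepts H d (root_hash H d x m) (root_hash H d x n)
    (hash_increment_proof H d x (belt_increment m n))"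
  using is_increment_proof_belt [OF assms]
  unfolding is_increment_proof_def increment_accepts_def hash_increment_proof_def root_hash_def
  using reduce_nodes_label [of _ _ "[]" _ H d x] by (force split: prod.splits)

section \<open>Loop-free programs and membership proofs\<close>

text \<open>A functional semantics of loop-free programs, which the simplifier can evaluate. Loops
  are treated by induction on the tokens, with \<open>cost_bound\<close> as the cost of a
  round.\<close>

fun sem :: "hash_fun \<Rightarrow> hash \<Rightarrow> nat \<Rightarrow> cmd \<Rightarrow> config \<Rightarrow> config option" where
  "sem H d B Skip s = Some s"
| "sem H d B (Store a e) (M, inp, out) =
    (if aval M a < B then Some (M(aval M a := (aval M e, snd (M (aval M a)))), inp, out) else None)"
| "sem H d B (StoreHash a e) (M, inp, out) =
    (if aval M a < B then Some (M(aval M a := (fst (M (aval M a)), hval H d M e)), inp, out) else None)"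
| "sem H d B (Fetch a) (M, inp, out) =
    (if aval M a < B \<and> inp \<noteq> [] then Some (M(aval M a := hd inp), tl inp, out) else None)"
| "sem H d B (Publish e) (M, inp, out) = Some (M, inp, out @ [hval H d M e])"
| "sem H d B (Seq c1 c2) s = (case sem H d B c1 s of None \<Rightarrow> None | Some s' \<Rightarrow> sem H d B c2 s')"
| "sem H d B (If b c1 c2) (M, inp, out) =
    (if bval H d M inp b then sem H d B c1 (M, inp, out) else sem H d B c2 (M, inp, out))"
| "sem H d B (While b c) s = None"

fun cost_bound :: "cmd \<Rightarrow> nat" where
  "cost_bound Skip = 1"
| "cost_bound (Store a e) = 1 + acost a + acost e"
| "cost_bound (StoreHash a e) = 1 + acost a + hcost e"
| "cost_bound (Fetch a) = 1 + acost a"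
| "cost_bound (Publish e) = 1 + hcost e"
| "cost_bound (Seq c1 c2) = 1 + cost_bound c1 + cost_bound c2"
| "cost_bound (If b c1 c2) = 1 + bcost b + cost_bound c1 + cost_bound c2"
| "cost_bound (While b c) = 0"

lemma exec_sem: "sem H d B c s = Some s' \<Longrightarrow> \<exists>t \<le> cost_bound c. exec H d B c s t s'"
proof (induction H d B c s arbitrary: s' rule: sem.induct)
  case (4 H d B a M inp out)
  then show ?case by (cases inp) (auto intro!: exI [of _ "1 + acost a"] exec.Fetch [simplified] split: if_splits)
next
  case (6 H d B c1 c2 s)
  from 6(3) obtain s1 where s1: "sem H d B c1 s = Some s1" "sem H d B c2 s1 = Some s'"
    by (auto split: option.splits)
  obtain t1 t2 where "t1 \<le> cost_bound c1" "exec H d B c1 s t1 s1" "t2 \<le> cost_bound c2" "exec H d B c2 s1 t2 s'"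
    using 6(1) [OF s1(1)] 6(2) [OF s1] by blast
  then show ?case by (intro exI [of _ "1 + t1 + t2"]) (simp add: exec.Seq [simplified])
next
  case (7 H d B b c1 c2 M inp out)
  show ?case
  proof (cases "bval H d M inp b")
    case True
    then obtain t where "t \<le> cost_bound c1" "exec H d B c1 (M, inp, out) t s'" using 7(1,3) by auto
    then show ?thesis
      using exec.IfTrue [OF True] by (intro exI [of _ "1 + bcost b + t"]) simp
  next
    case False
    then obtain t where "t \<le> cost_bound c2" "exec H d B c2 (M, inp, out) t s'" using 7(2,3) by auto
    then show ?thesis
      using exec.IfFalse [OF False] by (intro exI [of _ "1 + bcost b + t"]) simp
  qed
next
  case (1 H d B s)
  then show ?case using exec.Skip [of H d B s] by auto
next
  case (2 H d B a e M inp out)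
  then show ?case using exec.Store [of _ M a B H d e inp out] by (auto split: if_splits)
next
  case (3 H d B a e M inp out)
  then show ?case using exec.StoreHash [of _ M a B H d e inp out] by (auto split: if_splits)
next
  case (5 H d B e M inp out)
  then show ?case using exec.Publish [of H d B e M inp out] by auto
qed simp

text \<open>The budgets differ because \<open>manager_memory\<close> admits any budget for an
  append, while the invariant is established for runs within \<open>mem_bound\<close>.\<close>

lemma exec_deterministic:
  "exec H d B c s t s' \<Longrightarrow> exec H d B' c s t' s'' \<Longrightarrow> s' = s''"
proof (induction arbitrary: B' t' s'' rule: exec.induct)
  case (Seq c1 s1 t1 s2 c2 t2 s3)
  from Seq.prems show ?case by (cases rule: exec.cases) (use Seq.IH in blast)
next
  case (IfTrue M inp b c1 out t s c2)
  from IfTrue.prems show ?case by (cases rule: exec.cases) (use IfTrue in blast)+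
next
  case (IfFalse M inp b c2 out t s c1)
  from IfFalse.prems show ?case by (cases rule: exec.cases) (use IfFalse in blast)+
next
  case (WhileTrue M inp b c out t1 s t2 s')
  from WhileTrue.prems show ?case by (cases rule: exec.cases) (use WhileTrue in blast)+
qed (auto elim: exec.cases)

lemma exec_outside:
  "exec H d B c s t s' \<Longrightarrow> B \<le> a \<Longrightarrow> fst s' a = fst s a"
  by (induction rule: exec.induct) auto

lemma exec_fits: "exec H d B c (M, inp, out) t (M', inp', out') \<Longrightarrow> fits B M \<Longrightarrow> fits B M'"
  using exec_outside [of H d B c "(M, inp, out)" t "(M', inp', out')"] by (auto simp: fits_def)

lemma exec_SeqI: "exec H d B c1 s1 t1 s2 \<Longrightarrow> exec H d B c2 s2 t2 s3 \<Longrightarrow> t = 1 + t1 + t2 \<Longrightarrow>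
    exec H d B (Seq c1 c2) s1 t s3"
  by (auto intro: exec.Seq [simplified])

definition commit_cmd :: cmd where
  "commit_cmd = Seq (StoreHash (Num 2) (Cell (Num 0))) (Fetch (Num 0))"

text \<open>Cell 6 doubles as the loop counter, so that \<open>entry 8\<close> is the cell for the next proof entry.\<close>

definition entry :: "nat \<Rightarrow> aexp" where
  "entry b = Plus (Num b) (Plus (Plus (Val (Num 6)) (Val (Num 6))) (Plus (Val (Num 6)) (Val (Num 6))))"

lemma aval_entry [simp]: "aval M (entry b) = b + 4 * fst (M 6)"
  by (simp add: entry_def)

text \<open>Raising cell 6 by one moves every \<open>entry\<close> by four cells, so the hash
  written to \<open>entry 14\<close> is found at \<open>entry 10\<close> in the next round.\<close>

definition climb_cmd :: cmd where
  "climb_cmd =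
    Seq (Fetch (entry 8))
     (Seq (If (Less (Val (entry 8)) (Num 1)) (StoreHash (entry 14) (Hash (Cell (entry 8)) (Cell (entry 10))))
       (If (Less (Val (entry 8)) (Num 2)) (StoreHash (entry 14) (Hash (Cell (entry 10)) (Cell (entry 8))))
         (StoreHash (entry 14) (Hash Default (Cell (entry 10))))))
      (Store (Num 6) (Plus (Val (Num 6)) (Num 1))))"

definition verdict_cmd :: "bexp \<Rightarrow> cmd" where
  "verdict_cmd b = If b (Store (Num 4) (Num 1)) (Store (Num 4) (Num 0))"

definition climb_all :: cmd where
  "climb_all = Seq (While More climb_cmd) (verdict_cmd (Same (Cell (entry 10)) (Cell (Num 0))))"

definition member_cmd :: cmd where
  "member_cmd = Seq (Fetch (Num 10)) (Seq (Store (Num 6) (Num 0)) climb_all)"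

definition update_cmd :: cmd where
  "update_cmd = Seq (Fetch (Num 6)) climb_all"

lemma stores_proof_verdict:
  "stores_proof H d (M(4 := v)) h \<pi> \<longleftrightarrow> stores_proof H d M h \<pi>"
  by (simp add: stores_proof_def)

lemma recompute_snoc: "recompute H d h (\<pi> @ [e]) = climb H d (recompute H d h \<pi>) e"
  by (simp add: recompute_def)

lemma sem_climb:
  assumes "stores_proof H d M h \<pi>" "14 + 4 * length \<pi> < B"
  shows "\<exists>M'. sem H d B climb_cmd (M, step_token e # inp, out) = Some (M', inp, out) \<and>
    stores_proof H d M' h (\<pi> @ [e]) \<and> M' 0 = M 0 \<and> M' 2 = M 2"
proof -
  let ?n = "length \<pi>"
  define M' where "M' = M(8 + 4 * ?n := step_token e,
     14 + 4 * ?n := (fst (M (14 + 4 * ?n)), recompute H d h (\<pi> @ [e])), 6 := (Suc ?n, snd (M 6)))"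
  have M: "fst (M 6) = ?n" "snd (M (10 + 4 * ?n)) = recompute H d h \<pi>"
    using assms(1) by (auto simp: stores_proof_def)
  have "sem H d B climb_cmd (M, step_token e # inp, out) = Some (M', inp, out)"
    using assms(2) M by (cases e) (auto simp: climb_cmd_def M'_def recompute_snoc)
  moreover have "stores_proof H d M' h (\<pi> @ [e])"
  proof -
    have "M' (8 + 4 * j) = step_token ((\<pi> @ [e]) ! j)" if "j < length (\<pi> @ [e])" for j
    proof (cases "j = ?n")
      case False
      then have "M' (8 + 4 * j) = M (8 + 4 * j)" using that by (simp add: M'_def)
      then show ?thesis using assms(1) that False by (simp add: stores_proof_def nth_append)
    qed (simp add: M'_def)
    moreover have "snd (M' (10 + 4 * j)) = recompute H d h (take j (\<pi> @ [e]))" if "j \<le> length (\<pi> @ [e])" for j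
    proof (cases "j = Suc ?n")
      case False
      then have "M' (10 + 4 * j) = M (10 + 4 * j)" using that unfolding M'_def by simp presburger
      then show ?thesis using assms(1) that False by (simp add: stores_proof_def)
    qed (simp add: M'_def)
    ultimately show ?thesis by (simp add: stores_proof_def M'_def)
  qed
  ultimately show ?thesis by (auto simp: M'_def)
qed

lemma exec_climbs:
  assumes "stores_proof H d M h \<pi>" "15 + 4 * (length \<pi> + length es) \<le> B"
  shows "\<exists>t M'. exec H d B (While More climb_cmd) (M, map step_token es, out) t (M', [], out) \<and>
    t \<le> 2 + (2 + cost_bound climb_cmd) * length es \<and>
    stores_proof H d M' h (\<pi> @ es) \<and> M' 0 = M 0 \<and> M' 2 = M 2"
  using assms
proof (induction es arbitrary: M \<pi>)
  case Nil
  then show ?case using exec.WhileFalse [of H d M "[]" More B climb_cmd out] by (auto intro!: exI)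
next
  case (Cons e es)
  obtain M1 where M1: "sem H d B climb_cmd (M, step_token e # map step_token es, out) = Some (M1, map step_token es, out)"
    "stores_proof H d M1 h (\<pi> @ [e])" "M1 0 = M 0" "M1 2 = M 2"
    using sem_climb [OF Cons.prems(1), of B e "map step_token es" out] Cons.prems(2) by auto
  obtain t1 where t1: "t1 \<le> cost_bound climb_cmd"
    "exec H d B climb_cmd (M, step_token e # map step_token es, out) t1 (M1, map step_token es, out)"
    using exec_sem [OF M1(1)] by blast
  obtain t2 M2 where t2: "exec H d B (While More climb_cmd) (M1, map step_token es, out) t2 (M2, [], out)"
    "t2 \<le> 2 + (2 + cost_bound climb_cmd) * length es"
    "stores_proof H d M2 h ((\<pi> @ [e]) @ es)" "M2 0 = M1 0" "M2 2 = M1 2"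
    using Cons.IH [OF M1(2)] Cons.prems(2) by auto
  have "exec H d B (While More climb_cmd) (M, map step_token (e # es), out) (1 + bcost More + t1 + t2) (M2, [], out)"
    using exec.WhileTrue [OF _ t1(2) t2(1)] by simp
  then show ?case using t1 t2 M1 by (intro exI [of _ "1 + bcost More + t1 + t2"] exI [of _ M2]) auto
qed

definition "climb_all_cost n = 4 + cost_bound (verdict_cmd (Same (Cell (entry 10)) (Cell (Num 0))))
   + (2 + cost_bound climb_cmd) * n"

lemma exec_climb_all:
  assumes "stores_proof H d M h \<pi>" "15 + 4 * (length \<pi> + length es) \<le> B"
  shows "\<exists>t M'. exec H d B climb_all (M, map step_token es, out) t (M', [], out) \<and>
    t \<le> climb_all_cost (length es) \<and>
    fst (M' 4) = of_bool (recompute H d h (\<pi> @ es) = snd (M 0)) \<and>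
    stores_proof H d M' h (\<pi> @ es) \<and> M' 0 = M 0 \<and> M' 2 = M 2"
proof -
  let ?b = "Same (Cell (entry 10)) (Cell (Num 0))"
  obtain t M' where M': "exec H d B (While More climb_cmd) (M, map step_token es, out) t (M', [], out)"
    "t \<le> 2 + (2 + cost_bound climb_cmd) * length es"
    "stores_proof H d M' h (\<pi> @ es)" "M' 0 = M 0" "M' 2 = M 2"
    using exec_climbs [OF assms] by blast
  let ?M = "M'(4 := (of_bool (recompute H d h (\<pi> @ es) = snd (M 0)), snd (M' 4)))"
  have "snd (M' (10 + 4 * fst (M' 6))) = recompute H d h (\<pi> @ es)"
    using M'(3) unfolding stores_proof_def by (metis order_refl take_all_iff)
  then have "sem H d B (verdict_cmd ?b) (M', [], out) = Some (?M, [], out)"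
    using assms(2) M'(4) by (simp add: verdict_cmd_def)
  then obtain t' where "t' \<le> cost_bound (verdict_cmd ?b)"
    "exec H d B (verdict_cmd ?b) (M', [], out) t' (?M, [], out)"
    using exec_sem by blast
  then show ?thesis
    using M' unfolding climb_all_def climb_all_cost_def
    by (intro exI [of _ "1 + t + t'"] exI [of _ ?M]) (auto simp: stores_proof_verdict intro: exec_SeqI)
qed

lemma exec_member:
  assumes "15 + 4 * length es \<le> B"
  shows "\<exists>t M'. exec H d B member_cmd (M, (0, h) # map step_token es, out) t (M', [], out) \<and>
    t \<le> 7 + climb_all_cost (length es) \<and>
    fst (M' 4) = of_bool (recompute H d h es = snd (M 0)) \<and>
    stores_proof H d M' h es \<and> M' 0 = M 0 \<and> M' 2 = M 2"
proof -
  let ?M = "M(10 := (0, h), 6 := (0, snd (M 6)))"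
  have "stores_proof H d ?M h []" by (simp add: stores_proof_def recompute_def)
  then obtain t M' where M': "exec H d B climb_all (?M, map step_token es, out) t (M', [], out)"
    "t \<le> climb_all_cost (length es)" "fst (M' 4) = of_bool (recompute H d h es = snd (M 0))"
    "stores_proof H d M' h es" "M' 0 = M 0" "M' 2 = M 2"
    using exec_climb_all [of H d ?M h "[]" es B out] assms by auto
  have "exec H d B (Store (Num 6) (Num 0)) (M(10 := (0, h)), map step_token es, out) 3 (?M, map step_token es, out)"
    using exec.Store [of 6 "M(10 := (0, h))" "Num 6" B H d "Num 0"] assms by (simp add: numeral_3_eq_3)
  moreover have "exec H d B (Fetch (Num 10)) (M, (0, h) # map step_token es, out) 2 (M(10 := (0, h)), map step_token es, out)"
    using exec.Fetch [of M "Num 10" B H d "(0, h)"] assms by (simp add: numeral_2_eq_2)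
  ultimately have "exec H d B member_cmd (M, (0, h) # map step_token es, out) (1 + 2 + (1 + 3 + t)) (M', [], out)"
    unfolding member_cmd_def using M'(1) by (intro exec.Seq)
  then show ?thesis using M' by (intro exI [of _ "1 + 2 + (1 + 3 + t)"] exI [of _ M']) auto
qed

text \<open>Lowering the stored length truncates a proof in one command, and the hash reached after
  \<open>j\<close> entries is already in memory. So the cost of an update does not depend on the
  number of retained entries.\<close>

lemma stores_proof_take:
  assumes "stores_proof H d M h \<pi>" "j \<le> length \<pi>"
  shows "stores_proof H d (M(6 := (j, g))) h (take j \<pi>)"
  using assms by (auto simp: stores_proof_def min_def)

lemma exec_update:
  assumes "stores_proof H d M h \<pi>" "j \<le> length \<pi>" "15 + 4 * (j + length es) \<le> B"
  shows "\<exists>t M'. exec H d B update_cmd (M, (j, []) # map step_token es, out) t (M', [], out) \<and>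
    t \<le> 3 + climb_all_cost (length es) \<and>
    fst (M' 4) = of_bool (recompute H d h (take j \<pi> @ es) = snd (M 0)) \<and>
    stores_proof H d M' h (take j \<pi> @ es) \<and> M' 0 = M 0 \<and> M' 2 = M 2"
proof -
  let ?M = "M(6 := (j, []))"
  obtain t M' where M': "exec H d B climb_all (?M, map step_token es, out) t (M', [], out)"
    "t \<le> climb_all_cost (length es)" "fst (M' 4) = of_bool (recompute H d h (take j \<pi> @ es) = snd (M 0))"
    "stores_proof H d M' h (take j \<pi> @ es)" "M' 0 = M 0" "M' 2 = M 2"
    using exec_climb_all [OF stores_proof_take [OF assms(1,2)], of es B "[]" out] assms(2,3)
    by (auto simp: min_absorb1 min_absorb2)
  have "exec H d B (Fetch (Num 6)) (M, (j, []) # map step_token es, out) 2 (?M, map step_token es, out)"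
    using exec.Fetch [of M "Num 6" B H d "(j, [])"] assms by (simp add: numeral_2_eq_2)
  then have "exec H d B update_cmd (M, (j, []) # map step_token es, out) (1 + 2 + t) (M', [], out)"
    unfolding update_cmd_def using M'(1) by (intro exec.Seq)
  then show ?thesis using M' by (intro exI [of _ "1 + 2 + t"] exI [of _ M']) auto
qed

section \<open>Verification of increment proofs\<close>

abbreviation reg :: "nat \<Rightarrow> aexp" where "reg k \<equiv> Val (Num k)"

definition times4 :: "nat \<Rightarrow> nat \<Rightarrow> aexp" where
  "times4 b k = Plus (Num b) (Plus (Plus (reg k) (reg k)) (Plus (reg k) (reg k)))"

lemma aval_times4 [simp]: "aval M (times4 b k) = b + 4 * fst (M k)"
  by (simp add: times4_def)

text \<open>
  Cells 1, 3, 5 hold the numbers of shared nodes, further nodes and remaining instructions for the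
  old root; 7 is the position in the node list, 9 the stack height, 11 the number of nodes that may
  be shifted, 13 is 1 as long as nothing failed. The node list occupies the cells \<open>17 + 4 * i\<close>,
  the stack the cells \<open>19 + 4 * i\<close>.
\<close>

definition load_cmd :: cmd where
  "load_cmd = Seq (Fetch (times4 17 7)) (Store (Num 7) (Plus (reg 7) (Num 1)))"

definition fail_cmd :: cmd where
  "fail_cmd = Store (Num 13) (Num 0)"

text \<open>At stack height \<open>s\<close> the two topmost cells are \<open>15 + 4 * s\<close> and
  \<open>11 + 4 * s\<close>. Tokens are fetched even after a failure, since a run has to receive the
  whole message.\<close>

definition instr_cmd :: cmd where
  "instr_cmd = Seq (Fetch (Num 15)) (If (Less (Num 0) (reg 13))
    (If (Less (reg 15) (Num 1))
      (If (Less (reg 7) (reg 11))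
        (Seq (StoreHash (times4 19 9) (Cell (times4 17 7)))
          (Seq (Store (Num 7) (Plus (reg 7) (Num 1))) (Store (Num 9) (Plus (reg 9) (Num 1)))))
        fail_cmd)
      (If (Less (reg 15) (Num 2))
        (If (Less (Num 1) (reg 9))
          (Seq (StoreHash (times4 11 9) (Hash (Cell (times4 11 9)) (Cell (times4 15 9))))
            (Store (Num 9) (Minus (reg 9) (Num 1))))
          fail_cmd)
        (If (Less (Num 0) (reg 9))
          (StoreHash (times4 15 9) (Hash Default (Cell (times4 15 9))))
          fail_cmd)))
    Skip)"

definition counted_instr_cmd :: cmd where
  "counted_instr_cmd = Seq (Store (Num 5) (Minus (reg 5) (Num 1))) instr_cmd"

definition begin_cmd :: "aexp \<Rightarrow> cmd" where
  "begin_cmd e = Seq (Store (Num 7) (Num 0)) (Seq (Store (Num 9) (Num 0)) (Store (Num 11) e))"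

definition check_cmd :: "nat \<Rightarrow> cmd" where
  "check_cmd k =
    Seq (If (Same (Cell (Num 19)) (Cell (Num k))) Skip fail_cmd)
     (Seq (If (Less (reg 7) (reg 11)) fail_cmd Skip)
      (Seq (If (Less (reg 9) (Num 1)) fail_cmd Skip) (If (Less (Num 1) (reg 9)) fail_cmd Skip)))"

definition incr_init :: cmd where
  "incr_init = Seq (Fetch (Num 1)) (Seq (Fetch (Num 3)) (Seq (Fetch (Num 5))
     (Seq (Store (Num 13) (Num 1)) (Store (Num 7) (Num 0)))))"

definition incr_mid :: cmd where
  "incr_mid = Seq (check_cmd 2) (begin_cmd (Plus (reg 1) (reg 3)))"

definition incr_end :: cmd where
  "incr_end = Seq (check_cmd 0) (Store (Num 4) (reg 13))"

definition incr_cmd :: cmd where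
  "incr_cmd = Seq incr_init (Seq (While (Less (reg 7) (Plus (reg 1) (reg 3))) load_cmd)
     (Seq (begin_cmd (reg 1)) (Seq (While (Less (Num 0) (reg 5)) counted_instr_cmd)
     (Seq incr_mid (Seq (While More instr_cmd) incr_end)))))"

fun istep :: "('a \<Rightarrow> 'a \<Rightarrow> 'a) \<Rightarrow> 'a \<Rightarrow> instr \<Rightarrow> 'a list \<times> 'a list \<Rightarrow> ('a list \<times> 'a list) option" where
  "istep f d Shift (a # as, stk) = Some (as, a # stk)"
| "istep f d Join (as, b # a # stk) = Some (as, f a b # stk)"
| "istep f d JoinDefault (as, a # stk) = Some (as, f d a # stk)"
| "istep f d _ _ = None"

text \<open>Unlike \<open>reduce_nodes\<close>, this goes on consuming instructions after a failure,
  just as the program does with 0 in cell 13.\<close>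

fun isteps :: "('a \<Rightarrow> 'a \<Rightarrow> 'a) \<Rightarrow> 'a \<Rightarrow> instr list \<Rightarrow> ('a list \<times> 'a list) option \<Rightarrow> ('a list \<times> 'a list) option" where
  "isteps f d [] S = S"
| "isteps f d (i # is) S = isteps f d is (Option.bind S (istep f d i))"

lemma isteps_None [simp]: "isteps f d is None = None"
  by (induction "is") auto

lemma isteps_empty: "isteps f d is (Some ([], [])) \<noteq> Some (as, [r])"
  by (cases "is"; cases "hd is") auto

lemma reduce_nodes_isteps:
  "reduce_nodes f d is as stk = Some r \<longleftrightarrow> isteps f d is (Some (as, stk)) = Some ([], [r])"
  by (induction f d "is" as stk rule: reduce_nodes.induct) (auto simp: isteps_empty)

text \<open>The stack is bounded by the number of nodes shifted so far, so that a budget depending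
  on \<open>length hs\<close> suffices for it whatever the instructions are.\<close>

definition holds :: "hash list \<Rightarrow> nat \<Rightarrow> memory \<Rightarrow> (hash list \<times> hash list) option \<Rightarrow> bool" where
  "holds hs lm M S \<longleftrightarrow> lm \<le> length hs \<and> fst (M 11) = lm \<and>
     (\<forall>i < length hs. snd (M (17 + 4 * i)) = hs ! i) \<and>
     (case S of None \<Rightarrow> fst (M 13) = 0
      | Some (as, stk) \<Rightarrow> fst (M 13) = 1 \<and> fst (M 7) \<le> lm \<and> as = drop (fst (M 7)) (take lm hs) \<and>
          fst (M 9) = length stk \<and> length stk \<le> fst (M 7) \<and>
          (\<forall>i < length stk. snd (M (19 + 4 * i)) = rev stk ! i))"

definition same_outside :: "nat set \<Rightarrow> memory \<Rightarrow> memory \<Rightarrow> bool" where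
  "same_outside A M M' \<longleftrightarrow> (\<forall>a. a \<notin> A \<longrightarrow> M' a = M a)"

definition work :: "nat set" where
  "work = {a. odd a \<and> 7 \<le> a}"

lemma sem_instr:
  fixes H :: hash_fun
  defines "f \<equiv> \<lambda>a b. H (a @ b)"
  assumes "holds hs lm M S" "19 + 4 * length hs \<le> B"
  shows "\<exists>M'. sem H d B instr_cmd (M, instr_token i # inp, out) = Some (M', inp, out) \<and>
    holds hs lm M' (Option.bind S (istep f d i)) \<and> same_outside work M M'"
proof (cases S)
  case None
  then show ?thesis
    using assms(2,3)
    by (intro exI [of _ "M(15 := instr_token i)"])
       (auto simp: instr_cmd_def holds_def same_outside_def work_def)
next
  case (Some s)
  obtain as stk where s: "s = (as, stk)" by (cases s)
  note h = assms(2) [unfolded holds_def Some s option.case prod.case]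
  let ?p = "fst (M 7)" and ?n = "length stk"
  have B: "15 < B" using assms(3) by simp
  have fail: "\<exists>M'. sem H d B fail_cmd (M(15 := t), inp, out) = Some (M', inp, out) \<and>
      holds hs lm M' None \<and> same_outside work M M'" for t
    using h B by (intro exI [of _ "M(15 := t, 13 := (0, snd (M 13)))"])
      (auto simp: fail_cmd_def holds_def same_outside_def work_def)
  show ?thesis
  proof (cases i)
    case Shift
    show ?thesis
    proof (cases "?p < lm")
      case False
      then have "as = []" using h by simp
      then show ?thesis using fail [of "(0, [])"] Some s Shift h B False
        by (auto simp: instr_cmd_def)
    next
      case True
      define a where "a = hs ! ?p"
      have as: "as = a # drop (Suc ?p) (take lm hs)"
        using True h by (auto simp: a_def Cons_nth_drop_Suc [symmetric])
      define M' where "M' = M(15 := (0, []), 19 + 4 * ?n := (fst (M (19 + 4 * ?n)), a),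
        7 := (Suc ?p, snd (M 7)), 9 := (Suc ?n, snd (M 9)))"
      have "sem H d B instr_cmd (M, instr_token i # inp, out) = Some (M', inp, out)"
        using h True assms(3) Shift by (auto simp: instr_cmd_def M'_def a_def)
      moreover have "snd (M' (17 + 4 * j)) = hs ! j" if "j < length hs" for j
      proof -
        have "4 * j \<noteq> Suc (Suc (4 * length stk))" by presburger
        then have "M' (17 + 4 * j) = M (17 + 4 * j)" by (simp add: M'_def)
        then show ?thesis using h that by simp
      qed
      moreover have "snd (M' (19 + 4 * j)) = rev (a # stk) ! j" if "j < Suc ?n" for j
      proof (cases "j = ?n")
        case False
        then show ?thesis using h that by (auto simp: M'_def nth_append)
      qed (simp add: M'_def nth_append)
      moreover have "same_outside work M M'" by (auto simp: same_outside_def work_def M'_def)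
      moreover have "Option.bind S (istep f d i) = Some (drop (Suc ?p) (take lm hs), a # stk)"
        by (simp add: Some s Shift as)
      moreover have "fst (M' 7) = Suc ?p" "fst (M' 9) = Suc ?n" "fst (M' 11) = lm" "fst (M' 13) = 1"
        using h by (auto simp: M'_def)
      ultimately show ?thesis
        using h True by (intro exI [of _ M']) (simp add: holds_def)
    qed
  next
    case Join
    show ?thesis
    proof (cases "1 < ?n")
      case False
      then have "istep f d Join (as, stk) = None" by (cases stk; cases "tl stk") auto
      then show ?thesis using fail [of "(1, [])"] Some s Join h B False
        by (auto simp: instr_cmd_def)
    next
      case True
      then obtain b a rest where stk: "stk = b # a # rest" by (cases stk; cases "tl stk") auto
      define r where "r = length rest"
      have n: "?n = Suc (Suc r)" by (simp add: stk r_def)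
      have "snd (M (19 + 4 * r)) = a" "snd (M (19 + 4 * Suc r)) = b"
        using h by (auto simp: stk r_def nth_append)
      then have top: "snd (M (19 + 4 * r)) = a" "snd (M (23 + 4 * r)) = b" by (simp_all add: algebra_simps)
      define M' where "M' = M(15 := (1, []), 19 + 4 * r := (fst (M (19 + 4 * r)), f a b), 9 := (Suc r, snd (M 9)))"
      have "sem H d B instr_cmd (M, instr_token i # inp, out) = Some (M', inp, out)"
        using h True assms(3) Join n top by (auto simp: instr_cmd_def M'_def f_def algebra_simps)
      moreover have "snd (M' (17 + 4 * j)) = hs ! j" if "j < length hs" for j
      proof -
        have "4 * j \<noteq> Suc (Suc (4 * r))" by presburger
        then have "M' (17 + 4 * j) = M (17 + 4 * j)" by (simp add: M'_def)
        then show ?thesis using h that by simp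
      qed
      moreover have "snd (M' (19 + 4 * j)) = rev (f a b # rest) ! j" if "j < Suc r" for j
      proof (cases "j = r")
        case False
        then have "snd (M (19 + 4 * j)) = rev stk ! j" using h that n by simp
        then show ?thesis using that False by (simp add: M'_def nth_append stk r_def)
      qed (simp add: M'_def nth_append r_def)
      moreover have "same_outside work M M'" by (auto simp: same_outside_def work_def M'_def)
      ultimately show ?thesis
        using h Some s Join n
        by (intro exI [of _ M']) (auto simp: holds_def M'_def stk r_def)
    qed
  next
    case JoinDefault
    show ?thesis
    proof (cases stk)
      case Nil
      then show ?thesis using fail [of "(2, [])"] Some s JoinDefault h B
        by (auto simp: instr_cmd_def)
    next
      case (Cons a rest)
      define r where "r = length rest"
      have n: "?n = Suc r" by (simp add: Cons r_def)
      have top: "snd (M (19 + 4 * r)) = a"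
        using h by (auto simp: Cons r_def nth_append)
      define M' where "M' = M(15 := (2, []), 19 + 4 * r := (fst (M (19 + 4 * r)), f d a))"
      have "sem H d B instr_cmd (M, instr_token i # inp, out) = Some (M', inp, out)"
        using h assms(3) JoinDefault n top by (auto simp: instr_cmd_def M'_def f_def algebra_simps)
      moreover have "snd (M' (17 + 4 * j)) = hs ! j" if "j < length hs" for j
      proof -
        have "4 * j \<noteq> Suc (Suc (4 * r))" by presburger
        then have "M' (17 + 4 * j) = M (17 + 4 * j)" by (simp add: M'_def)
        then show ?thesis using h that by simp
      qed
      moreover have "snd (M' (19 + 4 * j)) = rev (f d a # rest) ! j" if "j < Suc r" for j
      proof (cases "j = r")
        case False
        then have "snd (M (19 + 4 * j)) = rev stk ! j" using h that n by simp
        then show ?thesis using that False by (simp add: M'_def nth_append Cons r_def)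
      qed (simp add: M'_def nth_append r_def)
      moreover have "same_outside work M M'" by (auto simp: same_outside_def work_def M'_def)
      ultimately show ?thesis
        using h Some s JoinDefault n
        by (intro exI [of _ M']) (auto simp: holds_def M'_def Cons r_def)
    qed
  qed
qed


lemma same_outside_trans: "same_outside A M M' \<Longrightarrow> same_outside A M' M'' \<Longrightarrow> same_outside A M M''"
  by (simp add: same_outside_def)

lemma exec_instrs:
  fixes H :: hash_fun
  defines "f \<equiv> \<lambda>a b. H (a @ b)"
  assumes "holds hs lm M S" "19 + 4 * length hs \<le> B"
  shows "\<exists>t M'. exec H d B (While More instr_cmd) (M, map instr_token is, out) t (M', [], out) \<and>
    t \<le> 2 + (2 + cost_bound instr_cmd) * length is \<and>
    holds hs lm M' (isteps f d is S) \<and> same_outside work M M'"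
  using assms(2)
proof (induction "is" arbitrary: M S)
  case Nil
  then show ?case
    using exec.WhileFalse [of H d M "[]" More B instr_cmd out] by (auto intro!: exI simp: same_outside_def)
next
  case (Cons i "is")
  obtain M1 where M1: "sem H d B instr_cmd (M, instr_token i # map instr_token is, out) = Some (M1, map instr_token is, out)"
    "holds hs lm M1 (Option.bind S (istep f d i))" "same_outside work M M1"
    using sem_instr [OF Cons.prems assms(3), of H d i "map instr_token is" out] unfolding f_def by blast
  obtain t1 where t1: "t1 \<le> cost_bound instr_cmd"
    "exec H d B instr_cmd (M, instr_token i # map instr_token is, out) t1 (M1, map instr_token is, out)"
    using exec_sem [OF M1(1)] by blast
  obtain t2 M2 where t2: "exec H d B (While More instr_cmd) (M1, map instr_token is, out) t2 (M2, [], out)"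
    "t2 \<le> 2 + (2 + cost_bound instr_cmd) * length is"
    "holds hs lm M2 (isteps f d is (Option.bind S (istep f d i)))" "same_outside work M1 M2"
    using Cons.IH [OF M1(2)] by blast
  have "exec H d B (While More instr_cmd) (M, map instr_token (i # is), out) (1 + bcost More + t1 + t2) (M2, [], out)"
    using exec.WhileTrue [OF _ t1(2) t2(1)] by simp
  then show ?case
    using t1 t2 same_outside_trans [OF M1(3) t2(4)]
    by (intro exI [of _ "1 + bcost More + t1 + t2"] exI [of _ M2]) auto
qed

lemma holds_upd5: "holds hs lm (M(5 := v)) S \<longleftrightarrow> holds hs lm M S"
  by (cases S) (auto simp: holds_def)

lemma exec_counted_instrs:
  fixes H :: hash_fun
  defines "f \<equiv> \<lambda>a b. H (a @ b)"
  assumes "holds hs lm M S" "fst (M 5) = length is" "19 + 4 * length hs \<le> B"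
  shows "\<exists>t M'. exec H d B (While (Less (Num 0) (reg 5)) counted_instr_cmd) (M, map instr_token is @ inp, out) t (M', inp, out) \<and>
    t \<le> 5 + (5 + cost_bound counted_instr_cmd) * length is \<and>
    holds hs lm M' (isteps f d is S) \<and> same_outside (insert 5 work) M M'"
  using assms(2,3)
proof (induction "is" arbitrary: M S)
  case Nil
  then show ?case
    using exec.WhileFalse [of H d M inp "Less (Num 0) (reg 5)" B counted_instr_cmd out]
    by (auto intro!: exI simp: same_outside_def)
next
  case (Cons i "is")
  let ?b = "Less (Num 0) (reg 5)"
  let ?inp = "map instr_token is @ inp"
  let ?M = "M(5 := (length is, snd (M 5)))"
  obtain M1 where M1: "sem H d B instr_cmd (?M, instr_token i # ?inp, out) = Some (M1, ?inp, out)"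
    "holds hs lm M1 (Option.bind S (istep f d i))" "same_outside work ?M M1"
    using sem_instr [of hs lm ?M S B H d i ?inp out] Cons.prems assms(4) unfolding f_def holds_upd5 by blast
  have "sem H d B counted_instr_cmd (M, instr_token i # ?inp, out) = Some (M1, ?inp, out)"
    using M1(1) Cons.prems(2) assms(4) by (simp add: counted_instr_cmd_def)
  then obtain t1 where t1: "t1 \<le> cost_bound counted_instr_cmd"
    "exec H d B counted_instr_cmd (M, instr_token i # ?inp, out) t1 (M1, ?inp, out)"
    using exec_sem by blast
  have "fst (M1 5) = length is" using M1(3) by (auto simp: same_outside_def work_def)
  then obtain t2 M2 where t2: "exec H d B (While ?b counted_instr_cmd) (M1, ?inp, out) t2 (M2, inp, out)"
    "t2 \<le> 5 + (5 + cost_bound counted_instr_cmd) * length is"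
    "holds hs lm M2 (isteps f d is (Option.bind S (istep f d i)))" "same_outside (insert 5 work) M1 M2"
    using Cons.IH [OF M1(2)] by blast
  have "exec H d B (While ?b counted_instr_cmd) (M, map instr_token (i # is) @ inp, out) (1 + bcost ?b + t1 + t2) (M2, inp, out)"
    using exec.WhileTrue [OF _ _ t2(1)] t1(2) Cons.prems(2) by simp
  moreover have "same_outside (insert 5 work) M M2"
    using M1(3) t2(4) by (auto simp: same_outside_def)
  ultimately show ?case
    using t1 t2 by (intro exI [of _ "1 + bcost ?b + t1 + t2"] exI [of _ M2]) auto
qed

lemma exec_load:
  assumes "fst (M 7) = length done" "fst (M 1) + fst (M 3) = length done + length hs"
    "\<forall>i < length done. snd (M (17 + 4 * i)) = done ! i" "19 + 4 * (length done + length hs) \<le> B"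
  shows "\<exists>t M'. exec H d B (While (Less (reg 7) (Plus (reg 1) (reg 3))) load_cmd) (M, map (Pair 0) hs @ inp, out) t (M', inp, out) \<and>
    t \<le> 9 + (9 + cost_bound load_cmd) * length hs \<and>
    (\<forall>i < length (done @ hs). snd (M' (17 + 4 * i)) = (done @ hs) ! i) \<and>
    same_outside (work - {13}) M M'"
  using assms
proof (induction hs arbitrary: M "done")
  case Nil
  then show ?case
    using exec.WhileFalse [of H d M inp "Less (reg 7) (Plus (reg 1) (reg 3))" B load_cmd out]
    by (auto intro!: exI simp: same_outside_def)
next
  case (Cons h hs)
  let ?b = "Less (reg 7) (Plus (reg 1) (reg 3))"
  let ?n = "length done" and ?inp = "map (Pair 0) hs @ inp"
  define M1 where "M1 = M(17 + 4 * ?n := (0, h), 7 := (Suc ?n, snd (M 7)))"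
  have "sem H d B load_cmd (M, (0, h) # ?inp, out) = Some (M1, ?inp, out)"
    using Cons.prems by (simp add: load_cmd_def M1_def)
  then obtain t1 where t1: "t1 \<le> cost_bound load_cmd"
    "exec H d B load_cmd (M, (0, h) # ?inp, out) t1 (M1, ?inp, out)"
    using exec_sem by blast
  have out1: "same_outside (work - {13}) M M1"
    by (auto simp: same_outside_def work_def M1_def)
  have "\<forall>i < length (done @ [h]). snd (M1 (17 + 4 * i)) = (done @ [h]) ! i"
    using Cons.prems(3) by (auto simp: M1_def nth_append)
  moreover have "fst (M1 7) = length (done @ [h])" "fst (M1 1) + fst (M1 3) = length (done @ [h]) + length hs"
    "19 + 4 * (length (done @ [h]) + length hs) \<le> B"
    using Cons.prems by (auto simp: M1_def)
  ultimately obtain t2 M2 where t2: "exec H d B (While ?b load_cmd) (M1, ?inp, out) t2 (M2, inp, out)"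
    "t2 \<le> 9 + (9 + cost_bound load_cmd) * length hs"
    "\<forall>i < length ((done @ [h]) @ hs). snd (M2 (17 + 4 * i)) = ((done @ [h]) @ hs) ! i"
    "same_outside (work - {13}) M1 M2"
    using Cons.IH [of M1 "done @ [h]"] by blast
  have "exec H d B (While ?b load_cmd) (M, map (Pair 0) (h # hs) @ inp, out) (1 + bcost ?b + t1 + t2) (M2, inp, out)"
    using exec.WhileTrue [OF _ _ t2(1)] t1(2) Cons.prems(1,2) by simp
  then show ?case
    using t1 t2 same_outside_trans [OF out1 t2(4)]
    by (intro exI [of _ "1 + bcost ?b + t1 + t2"] exI [of _ M2]) auto
qed

lemma sem_check:
  assumes "holds hs lm M S" "13 < B" and that: "k \<noteq> 13"
  shows "sem H d B (check_cmd k) (M, inp, out) =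
    Some (M(13 := (of_bool (S = Some ([], [snd (M k)])), snd (M 13))), inp, out)"
proof (cases S)
  case None
  then show ?thesis
    using assms that by (auto simp: holds_def check_cmd_def fail_cmd_def fun_upd_idem_iff prod_eq_iff)
next
  case (Some s)
  obtain as stk where s: "s = (as, stk)" by (cases s)
  note h = assms(1) [unfolded holds_def Some s option.case prod.case]
  have M13: "M 13 = (Suc 0, snd (M 13))" using h by (simp add: prod_eq_iff)
  have as: "as = [] \<longleftrightarrow> \<not> fst (M 7) < fst (M 11)" using h by auto
  consider "stk = []" | r where "stk = [r]" | "1 < length stk"
    by (cases stk; cases "tl stk") auto
  then show ?thesis
  proof cases
    case 2
    then have "snd (M 19) = r" using h by auto
    then show ?thesis using 2 h as assms(2) that Some s M13
      by (auto simp: check_cmd_def fail_cmd_def fun_upd_idem_iff)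
  qed (use h as assms(2) that Some s M13 in \<open>auto simp: check_cmd_def fail_cmd_def fun_upd_idem_iff\<close>)
qed


lemma sem_begin:
  assumes "13 < B"
  shows "sem H d B (begin_cmd e) (M, inp, out) =
    Some (M(7 := (0, snd (M 7)), 9 := (0, snd (M 9)),
      11 := (aval (M(7 := (0, snd (M 7)), 9 := (0, snd (M 9)))) e, snd (M 11))), inp, out)"
  using assms by (simp add: begin_cmd_def)

definition "incr_cost n =
  cost_bound incr_init + cost_bound (begin_cmd (reg 1)) + cost_bound incr_mid + cost_bound incr_end + 30 +
  (16 + cost_bound load_cmd + cost_bound counted_instr_cmd + cost_bound instr_cmd) * n"

lemma exec_increment:
  assumes B: "19 + 4 * (length C + length D) \<le> B"
  shows "\<exists>t M'. exec H d B incr_cmd (M, increment_message (C, D, is, js), out) t (M', [], out) \<and>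
    t \<le> incr_cost (length (increment_message (C, D, is, js))) \<and>
    fst (M' 4) = of_bool (increment_accepts H d (snd (M 2)) (snd (M 0)) (C, D, is, js)) \<and>
    (\<forall>a. even a \<and> a \<noteq> 4 \<longrightarrow> M' a = M a)"
proof -
  let ?f = "\<lambda>a b. H (a @ b)" and ?hs = "C @ D"
  let ?in1 = "map instr_token is @ map instr_token js"
  let ?in0 = "map (Pair 0) ?hs @ ?in1"
  define M0 where "M0 = M(1 := (length C, []), 3 := (length D, []), 5 := (length is, []),
     13 := (1, snd (M 13)), 7 := (0, snd (M 7)))"
  have msg: "increment_message (C, D, is, js) = (length C, []) # (length D, []) # (length is, []) # ?in0"
    by (simp add: increment_message_def)
  have "sem H d B incr_init (M, increment_message (C, D, is, js), out) = Some (M0, ?in0, out)"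
    using B by (simp add: incr_init_def msg M0_def fun_upd_twist)
  then obtain t0 where t0: "t0 \<le> cost_bound incr_init"
    "exec H d B incr_init (M, increment_message (C, D, is, js), out) t0 (M0, ?in0, out)"
    using exec_sem by blast
  obtain t1 M1 where t1: "exec H d B (While (Less (reg 7) (Plus (reg 1) (reg 3))) load_cmd) (M0, ?in0, out) t1 (M1, ?in1, out)"
    "t1 \<le> 9 + (9 + cost_bound load_cmd) * length ?hs"
    "\<forall>i < length ?hs. snd (M1 (17 + 4 * i)) = ?hs ! i" "same_outside (work - {13}) M0 M1"
    using exec_load [of M0 "[]" ?hs B H d ?in1 out] B by (auto simp: M0_def)
  have M1: "fst (M1 1) = length C" "fst (M1 3) = length D" "fst (M1 5) = length is" "fst (M1 13) = 1"
    using t1(4) by (auto simp: same_outside_def work_def M0_def)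
  define M2 where "M2 = M1(7 := (0, snd (M1 7)), 9 := (0, snd (M1 9)), 11 := (length C, snd (M1 11)))"
  have "sem H d B (begin_cmd (reg 1)) (M1, ?in1, out) = Some (M2, ?in1, out)"
    using B M1 by (simp add: sem_begin M2_def)
  then obtain t2 where t2: "t2 \<le> cost_bound (begin_cmd (reg 1))"
    "exec H d B (begin_cmd (reg 1)) (M1, ?in1, out) t2 (M2, ?in1, out)"
    using exec_sem by blast
  have h2: "holds ?hs (length C) M2 (Some (C, []))" "fst (M2 5) = length is"
    using t1(3) M1 by (auto simp: holds_def M2_def)
  define S where "S = isteps ?f d is (Some (C, []))"
  obtain t3 M3 where t3: "exec H d B (While (Less (Num 0) (reg 5)) counted_instr_cmd) (M2, ?in1, out) t3 (M3, map instr_token js, out)"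
    "t3 \<le> 5 + (5 + cost_bound counted_instr_cmd) * length is"
    "holds ?hs (length C) M3 S" "same_outside (insert 5 work) M2 M3"
    using exec_counted_instrs [OF h2, of B H d "map instr_token js" out] B unfolding S_def by auto
  have M3: "fst (M3 1) = length C" "fst (M3 3) = length D" "snd (M3 2) = snd (M 2)"
    using t3(4) t1(4) M1 by (auto simp: same_outside_def work_def M2_def M0_def)
  define ok where "ok \<longleftrightarrow> S = Some ([], [snd (M 2)])"
  define M4 where "M4 = M3(13 := (of_bool ok, snd (M3 13)), 7 := (0, snd (M3 7)), 9 := (0, snd (M3 9)),
    11 := (length ?hs, snd (M3 11)))"
  have "sem H d B incr_mid (M3, map instr_token js, out) = Some (M4, map instr_token js, out)"
    using B M3 sem_check [OF t3(3), of B 2 H d] by (simp add: incr_mid_def sem_begin M4_def ok_def)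
  then obtain t4 where t4: "t4 \<le> cost_bound incr_mid"
    "exec H d B incr_mid (M3, map instr_token js, out) t4 (M4, map instr_token js, out)"
    using exec_sem by blast
  \<comment> \<open>The flag is not reset between the two runs, so a rejected old root makes the
    second one start in the failed state.\<close>
  define S' where "S' = isteps ?f d js (if ok then Some (?hs, []) else None)"
  have h4: "holds ?hs (length ?hs) M4 (if ok then Some (?hs, []) else None)"
    using t3(3) by (auto simp: holds_def M4_def)
  obtain t5 M5 where t5: "exec H d B (While More instr_cmd) (M4, map instr_token js, out) t5 (M5, [], out)"
    "t5 \<le> 2 + (2 + cost_bound instr_cmd) * length js"
    "holds ?hs (length ?hs) M5 S'" "same_outside work M4 M5"
    using exec_instrs [OF h4, of B H d js out] B unfolding S'_def by auto
  have even: "M5 a = M a" if "even a" for a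
  proof -
    have w: "a \<notin> insert 5 work" "a \<notin> {1, 3, 5, 7, 9, 11, 13}" using that by (auto simp: work_def)
    then have "M5 a = M4 a" "M3 a = M2 a" "M1 a = M0 a"
      using t5(4) t3(4) t1(4) unfolding same_outside_def by simp_all
    moreover have "M4 a = M3 a" "M2 a = M1 a" "M0 a = M a"
      using w(2) by (simp_all add: M4_def M2_def M0_def)
    ultimately show ?thesis by simp
  qed
  define res where "res \<longleftrightarrow> S' = Some ([], [snd (M 0)])"
  define M6 where "M6 = M5(13 := (of_bool res, snd (M5 13)), 4 := (of_bool res, snd (M5 4)))"
  have "sem H d B incr_end (M5, [], out) = Some (M6, [], out)"
    using B sem_check [OF t5(3), of B 0 H d] even [of 0] by (simp add: incr_end_def M6_def res_def)
  then obtain t6 where t6: "t6 \<le> cost_bound incr_end"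
    "exec H d B incr_end (M5, [], out) t6 (M6, [], out)"
    using exec_sem by blast
  let ?t = "1 + t0 + (1 + t1 + (1 + t2 + (1 + t3 + (1 + t4 + (1 + t5 + t6)))))"
  have "exec H d B incr_cmd (M, increment_message (C, D, is, js), out) ?t (M6, [], out)"
    unfolding incr_cmd_def
    by (intro exec.Seq [OF t0(2)] exec.Seq [OF t1(1)] exec.Seq [OF t2(2)] exec.Seq [OF t3(1)]
        exec.Seq [OF t4(2)] exec.Seq [OF t5(1)] t6(2))
  moreover have "?t \<le> incr_cost (length (increment_message (C, D, is, js)))"
  proof -
    let ?n = "length (increment_message (C, D, is, js))"
    have "length ?hs \<le> ?n" "length is \<le> ?n" "length js \<le> ?n" by (auto simp: msg)
    then have "(9 + cost_bound load_cmd) * length ?hs \<le> (9 + cost_bound load_cmd) * ?n"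
      "(5 + cost_bound counted_instr_cmd) * length is \<le> (5 + cost_bound counted_instr_cmd) * ?n"
      "(2 + cost_bound instr_cmd) * length js \<le> (2 + cost_bound instr_cmd) * ?n"
      by (blast intro: mult_le_mono2)+
    moreover have "(16 + cost_bound load_cmd + cost_bound counted_instr_cmd + cost_bound instr_cmd) * ?n =
      (9 + cost_bound load_cmd) * ?n + (5 + cost_bound counted_instr_cmd) * ?n + (2 + cost_bound instr_cmd) * ?n"
      by (simp add: algebra_simps)
    ultimately show ?thesis
      using t0(1) t1(2) t2(1) t3(2) t4(1) t5(2) t6(1) unfolding incr_cost_def by linarith
  qed
  moreover have "fst (M6 4) = of_bool (increment_accepts H d (snd (M 2)) (snd (M 0)) (C, D, is, js))"
    by (auto simp: M6_def res_def S'_def ok_def S_def increment_accepts_def reduce_nodes_isteps)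
  moreover have "\<forall>a. even a \<and> a \<noteq> 4 \<longrightarrow> M6 a = M a"
    using even by (auto simp: M6_def)
  ultimately show ?thesis by blast
qed

section \<open>The manager\<close>

text \<open>
  The manager stores mountains by height, since a mountain keeps its height, but not its index, while
  others are merged to its left. There are at most two mountains of height \<open>h\<close>. The cells
  \<open>addr r h\<close> hold, for \<open>r = 0\<close>, their number and the peak of the right one; for \<open>r = 1\<close> and
  if there are two, the address of the next such height and the peak of the left one; for \<open>r = 2\<close>
  the range node at the right one; for \<open>r = 3\<close>, provided the right one ends its range, the belt node
  before that range. Cell 0 holds the address of the least height with two mountains, or 0.
\<close>

definition addr :: "nat \<Rightarrow> nat \<Rightarrow> nat" where
  "addr r h = 8 + 4 * h + r"

lemma addr_eq_iff: "r < 4 \<Longrightarrow> r' < 4 \<Longrightarrow> addr r h = addr r' h' \<longleftrightarrow> r = r' \<and> h = h'"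
  unfolding addr_def by presburger

lemma addr_neq: "k < 8 \<Longrightarrow> addr r h \<noteq> k" "k < 8 \<Longrightarrow> k \<noteq> addr r h"
  by (simp_all add: addr_def)

lemma addr_pos: "0 < addr r h"
  by (simp add: addr_def)

lemma addr_not_less: "k \<le> 8 \<Longrightarrow> \<not> addr r h < k"
  by (simp add: addr_def)

lemma addr_add:
  "Suc (addr 0 h) = addr (Suc 0) h" "addr 0 h + 2 = addr 2 h" "addr 0 h + 3 = addr 3 h"
  "addr 0 h + 4 = addr 0 (Suc h)" "addr 0 h + 5 = addr (Suc 0) (Suc h)"
  "addr 0 h + 6 = addr 2 (Suc h)" "addr 0 h + 7 = addr 3 (Suc h)"
  "addr 0 h + 8 = addr 0 (Suc (Suc h))"
  "addr 0 h + 10 = addr 2 (Suc (Suc h))" "addr 0 h + 11 = addr 3 (Suc (Suc h))"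
  by (simp_all add: addr_def)

lemmas addr_simps = addr_eq_iff addr_neq addr_pos addr_not_less addr_add

abbreviation off :: "nat \<Rightarrow> aexp" where "off k \<equiv> Plus (reg 2) (Num k)"

text \<open>
  A height 0 mountain is merged with the new leaf at once; this is recorded by a 1 in cell 1, which holds
  the leaf. Otherwise the merge takes place at the address in cell 0. Cells 2 and 3 receive the peaks to
  be merged, the address of their height and that of the next pair.
\<close>

definition select_cmd :: cmd where
  "select_cmd = If (Less (Num 0) (Val (Num (addr 0 0))))
    (Seq (Store (Num 1) (Num 1)) (Seq (Store (Num 2) (Num (addr 0 0))) (Seq (Store (Num 3) (reg 0))
      (Seq (StoreHash (Num 2) (Cell (Num (addr 0 0)))) (StoreHash (Num 3) (Cell (Num 1)))))))
    (Seq (Store (Num 2) (reg 0)) (Seq (Store (Num 3) (Val (Plus (reg 0) (Num 1))))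
      (Seq (StoreHash (Num 2) (Cell (Plus (reg 0) (Num 1)))) (StoreHash (Num 3) (Cell (reg 0))))))"

text \<open>If \<open>h\<close> is the height of the pair, \<open>off 4\<close> and
  \<open>off 8\<close> belong to \<open>h + 1\<close> and \<open>h + 2\<close>, the only possible
  heights of the left neighbour. A neighbour of height \<open>h + 1\<close> forms a new pair with
  the merged mountain, within its range. One of height \<open>h + 2\<close> also shares its range,
  unless there are two of that height. Cells 5 and 6 receive the belt and range node. If the leaf is
  still to be pushed, it lies in a later range, so cell 5 finally absorbs the range just
  completed.\<close>

definition merge_cmd :: cmd where
  "merge_cmd =
    Seq (StoreHash (Num 4) (Hash (Cell (Num 2)) (Cell (Num 3))))
    (Seq (If (Less (Num 0) (Val (off 4)))
      (Seq (StoreHash (Num 5) (Cell (off 3)))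
      (Seq (StoreHash (Num 6) (Hash (Cell (off 6)) (Cell (Num 4))))
      (Seq (Store (off 5) (reg 3))
      (Seq (StoreHash (off 5) (Cell (off 4)))
      (Seq (Store (Num 0) (off 4)) (Store (off 4) (Num 2)))))))
      (Seq (If (Less (Num 0) (Val (off 8)))
          (If (Less (Num 1) (Val (off 8)))
            (Seq (StoreHash (Num 5) (Hash (Cell (off 11)) (Cell (off 10))))
              (StoreHash (Num 6) (Hash Default (Cell (Num 4)))))
            (Seq (StoreHash (Num 5) (Cell (off 11)))
              (StoreHash (Num 6) (Hash (Cell (off 10)) (Cell (Num 4))))))
          (Seq (StoreHash (Num 5) Default) (StoreHash (Num 6) (Hash Default (Cell (Num 4))))))
      (Seq (Store (Num 0) (reg 3)) (Store (off 4) (Num 1)))))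
    (Seq (StoreHash (off 4) (Cell (Num 4)))
    (Seq (StoreHash (off 6) (Cell (Num 6)))
    (Seq (StoreHash (off 7) (Cell (Num 5)))
    (Seq (Store (reg 2) (Num 0))
    (Seq (Publish (Cell (Num 4)))
    (Seq (Publish (Cell (Num 6)))
    (Seq (Publish (Hash (Cell (Num 5)) (Cell (Num 6))))
      (If (Less (Num 0) (reg 1)) Skip (StoreHash (Num 5) (Hash (Cell (Num 5)) (Cell (Num 6)))))))))))))"

text \<open>Having no mountain of height 1 at this point means that the carry stopped at digit 1;
  then the new leaf starts a range.\<close>

definition push_cmd :: cmd where
  "push_cmd = Seq (Publish (Cell (Num 1)))
    (Seq (If (Less (Num 0) (reg 1)) Skip
      (Seq (If (Less (Num 0) (Val (Num (addr 0 1))))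
            (StoreHash (Num 6) (Hash (Cell (Num (addr 2 1))) (Cell (Num 1))))
            (StoreHash (Num 6) (Hash Default (Cell (Num 1)))))
      (Seq (Store (Num (addr 0 0)) (Num 1))
      (Seq (StoreHash (Num (addr 0 0)) (Cell (Num 1)))
      (Seq (StoreHash (Num (addr 2 0)) (Cell (Num 6)))
      (Seq (StoreHash (Num (addr 3 0)) (Cell (Num 5)))
        (Publish (Cell (Num 6)))))))))
    (Publish (Hash (Cell (Num 5)) (Cell (Num 6)))))"

definition append_cmd :: cmd where
  "append_cmd = Seq (Fetch (Num 1)) (Seq select_cmd
     (Seq (If (Less (Num 0) (reg 2)) merge_cmd (StoreHash (Num 5) Default)) push_cmd))"

text \<open>Mountains of indices \<open>i + 1\<close> and \<open>i\<close> have equal height iff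
  their digits are 0 and 1, which is the test \<open>N mod 4 = 1\<close>; with
  \<open>5 \<le> N\<close> both indices lie below the leading digit.\<close>

fun top_pair :: "nat \<Rightarrow> nat \<Rightarrow> nat" where
  "top_pair i N = (if N < 5 then 0 else if N mod 4 = 1 then addr 0 (Suc i) else top_pair (Suc i) (N div 2))"

declare top_pair.simps [simp del]

lemma top_pair_double: "top_pair i (2 * y) = top_pair (Suc i) y"
proof (cases "y < 3")
  case True
  then show ?thesis by (simp add: top_pair.simps)
next
  case False
  have "2 * y mod 4 \<noteq> Suc 0" by presburger
  with False show ?thesis by (subst top_pair.simps) simp
qed

lemma top_pair_Suc_double:
  "top_pair i (Suc (2 * a)) = (if even a \<and> 2 \<le> a then addr 0 (Suc i) else top_pair (Suc i) a)"
proof -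
  have "Suc (2 * a) mod 4 = 1 \<longleftrightarrow> even a" by presburger
  then show ?thesis by (subst top_pair.simps) (auto simp: top_pair.simps [of _ a])
qed

lemma top_pair_power: "top_pair i (2 ^ r * y) = top_pair (i + r) y"
  by (induction r arbitrary: i) (auto simp: top_pair_double mult.assoc)

text \<open>In \<open>N\<close> the digits of \<open>a\<close> are followed by 0 and
  \<open>r + 1\<close> ones. The lowest pair sits where the carry will stop, so the manager finds
  the merge without inspecting digits.\<close>

lemma top_pair_ones:
  "Suc N = 2 ^ Suc r * Suc (2 * a) \<Longrightarrow> top_pair i N = (if a = 0 then 0 else addr 0 (Suc (i + r)))"
proof (induction r arbitrary: i N)
  case 0
  then have "N = Suc (2 * (2 * a))" by simp
  then show ?case using top_pair_Suc_double [of i "2 * a"] by (auto simp: top_pair.simps [of _ 0])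
next
  case (Suc r)
  define X where "X = 2 ^ Suc r * Suc (2 * a) - 1"
  have X: "Suc X = 2 ^ Suc r * Suc (2 * a)" by (simp add: X_def)
  have N: "N = Suc (2 * X)" using Suc.prems X by simp
  have "odd X" using X by (metis even_Suc even_mult_iff even_power even_numeral zero_less_Suc)
  then show ?case using Suc.IH [OF X] N by (simp add: top_pair_Suc_double)
qed

text \<open>Here \<open>u\<close> is \<open>N div 2 ^ g\<close>. A mountain of height
  \<open>g + 1\<close> has index \<open>g\<close> and digit 1, or index \<open>g + 1\<close> and
  digit 0; if both exist, the former is the right one. \<open>w\<close> tells whether the mountain
  of index \<open>g\<close> ends its range, in which case its belt cell is valid.\<close>

definition slot :: "memory \<Rightarrow> (tree \<Rightarrow> hash) \<Rightarrow> nat \<Rightarrow> nat \<Rightarrow> bool \<Rightarrow> bool" where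
  "slot M lab g u w \<longleftrightarrow>
     fst (M (addr 0 (Suc g))) = of_bool (even (u div 2) \<and> 4 \<le> u) + of_bool (odd u \<and> 3 \<le> u) \<and>
     (odd u \<and> 3 \<le> u \<longrightarrow> snd (M (addr 0 (Suc g))) = lab (mountain g u) \<and>
        snd (M (addr 2 (Suc g))) = lab (rnode g u) \<and>
        (w \<longrightarrow> snd (M (addr 3 (Suc g))) = lab (bnode g u))) \<and>
     (even u \<and> even (u div 2) \<and> 4 \<le> u \<longrightarrow> snd (M (addr 0 (Suc g))) = lab (mountain (Suc g) (u div 2)) \<and>
        snd (M (addr 2 (Suc g))) = lab (rnode (Suc g) (u div 2))) \<and>
     (odd u \<and> even (u div 2) \<and> 4 \<le> u \<longrightarrow> M (addr 1 (Suc g)) = (top_pair (Suc g) (u div 2), lab (mountain (Suc g) (u div 2))))"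

definition manager_inv :: "(tree \<Rightarrow> hash) \<Rightarrow> nat \<Rightarrow> memory \<Rightarrow> bool" where
  "manager_inv lab N M \<longleftrightarrow>
     fst (M 0) = top_pair 0 N \<and>
     fst (M (addr 0 0)) = of_bool (even N \<and> 2 \<le> N) \<and>
     (even N \<and> 2 \<le> N \<longrightarrow> snd (M (addr 0 0)) = lab (mountain 0 N) \<and> snd (M (addr 3 0)) = lab (bnode 0 N)) \<and>
     (\<forall>g. slot M lab g (N div 2 ^ g) (g = 0 \<or> range_starts (N div 2 ^ (g - 1))))"

lemma slot_cong:
  assumes "slot M lab g u w" "\<And>r. r < 4 \<Longrightarrow> M' (addr r (Suc g)) = M (addr r (Suc g))" "w' \<longrightarrow> w"
  shows "slot M' lab g u w'"
  using assms(1,3) assms(2) [of 0] assms(2) [of 1] assms(2) [of 2] assms(2) [of 3] unfolding slot_def by auto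

lemma sem_select:
  assumes inv: "manager_inv (label H d x) N M" and N: "Suc N = 2 ^ j * Suc (2 * a)" "1 \<le> a" and B: "8 \<le> B"
  shows "sem H d B select_cmd (M(1 := (0, H (x N))), inp, out) =
    Some (M(1 := (of_bool (j = 0), H (x N)), 2 := (addr 0 j, label H d x (mountain j (2 * a))),
        3 := (top_pair (Suc j) a, label H d x (perfect j (2 ^ j * (2 * a - 1))))), inp, out)"
proof (cases j)
  case 0
  then have [simp]: "N = 2 * a" using N by simp
  have "fst (M (addr 0 0)) = 1" "snd (M (addr 0 0)) = label H d x (mountain 0 N)" "fst (M 0) = top_pair 1 a"
    using inv N(2) by (auto simp: manager_inv_def top_pair_double)
  then show ?thesis
    using B 0 N(2) by (simp add: select_cmd_def addr_simps fun_upd_twist)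
next
  case (Suc r)
  have "Suc N = 2 ^ r * Suc (4 * a + 1)" using N Suc by simp
  then have d: "N div 2 ^ r = 4 * a + 1" by (rule div_pred)
  have "odd N" using N Suc by (metis even_Suc even_mult_iff even_power even_numeral zero_less_Suc)
  have "slot M (label H d x) r (4 * a + 1) (r = 0 \<or> range_starts (N div 2 ^ (r - 1)))"
    using inv d unfolding manager_inv_def by metis
  then have s: "snd (M (addr 0 j)) = label H d x (perfect j (2 ^ j * (2 * a - 1)))"
    "M (addr 1 j) = (top_pair (Suc j) a, label H d x (mountain j (2 * a)))"
    using Suc N(2) mtn_right_of_pair [of r a] by (auto simp: slot_def top_pair_double)
  have "fst (M 0) = addr 0 j" "fst (M (addr 0 0)) = 0"
    using inv top_pair_ones [of N r a 0] N Suc \<open>odd N\<close> by (auto simp: manager_inv_def)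
  then show ?thesis
    using B Suc s by (simp add: select_cmd_def addr_simps fun_upd_twist)
qed


text \<open>
  If the left neighbour of the merged pair has the next height (\<open>a\<close> even), it is in the same range, so
  the belt node is read off at the pair; otherwise the neighbour ends its own range.
\<close>

lemma merge_inputs:
  assumes inv: "manager_inv lab N M" and N: "Suc N = 2 ^ j * Suc (2 * a)" "1 \<le> a"
  shows "fst (M (addr 0 (Suc j))) = of_bool (even a)"
    "even a \<Longrightarrow> snd (M (addr 0 (Suc j))) = lab (mountain (Suc j) a)"
    "even a \<Longrightarrow> snd (M (addr 2 (Suc j))) = lab (rnode (Suc j) a)"
    "even a \<Longrightarrow> snd (M (addr 3 j)) = lab (bnode (Suc j) a)"
    "odd a \<Longrightarrow> fst (M (addr 0 (Suc (Suc j)))) = of_bool (range_starts (Suc (2 * a))) + of_bool (3 \<le> a)"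
    "odd a \<Longrightarrow> 3 \<le> a \<Longrightarrow> snd (M (addr 2 (Suc (Suc j)))) = lab (rnode (Suc j) a)"
    "odd a \<Longrightarrow> 3 \<le> a \<Longrightarrow> snd (M (addr 3 (Suc (Suc j)))) = lab (bnode (Suc j) a)"
proof -
  have d: "N div 2 ^ j = 2 * a" by (rule div_pred [OF N(1)])
  then have d': "N div 2 ^ Suc j = a" by (simp add: power_Suc2 div_mult2_eq del: power_Suc)
  have s: "slot M lab j (2 * a) (j = 0 \<or> range_starts (N div 2 ^ (j - 1)))"
    using inv d unfolding manager_inv_def by metis
  have s': "slot M lab (Suc j) a (Suc j = 0 \<or> range_starts (N div 2 ^ (Suc j - 1)))"
    using inv d' unfolding manager_inv_def by metis
  have even2: "2 \<le> a" if "even a" using that N(2) by (cases "a = 1") auto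
  show "fst (M (addr 0 (Suc j))) = of_bool (even a)"
    "even a \<Longrightarrow> snd (M (addr 0 (Suc j))) = lab (mountain (Suc j) a)"
    "even a \<Longrightarrow> snd (M (addr 2 (Suc j))) = lab (rnode (Suc j) a)"
    using s even2 by (auto simp: slot_def)
  show "snd (M (addr 3 j)) = lab (bnode (Suc j) a)" if "even a"
  proof (cases j)
    case 0
    then show ?thesis using inv N that by (auto simp: manager_inv_def belt_even)
  next
    case (Suc r)
    have "Suc N = 2 ^ r * Suc (4 * a + 1)" using N Suc by simp
    then have d: "N div 2 ^ r = 4 * a + 1" by (rule div_pred)
    \<comment> \<open>Two equal peaks force a boundary after them, so the right mountain of the pair
      ends its range.\<close>
    have "r = 0 \<or> range_starts (N div 2 ^ (r - 1))"
    proof (cases r)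
      case (Suc q)
      have "Suc N = 2 ^ q * Suc (Suc (2 * (4 * a + 1)))" using N Suc \<open>j = Suc r\<close> by simp
      then have "N div 2 ^ q = Suc (2 * (4 * a + 1))" by (rule div_pred)
      moreover have "(4 * a + 1) mod 4 = 1" by presburger
      ultimately show ?thesis using Suc N(2) bd_Suc_double [of "4 * a + 1"] by simp
    qed simp
    moreover have "slot M lab r (4 * a + 1) (r = 0 \<or> range_starts (N div 2 ^ (r - 1)))"
      using inv d unfolding manager_inv_def by metis
    ultimately have "snd (M (addr 3 j)) = lab (bnode r (4 * a + 1))"
      using Suc N(2) by (auto simp: slot_def)
    \<comment> \<open>The pair itself lies in one range, so its two mountains have the same belt
      node before them.\<close>
    moreover have "\<not> range_starts (Suc (2 * (2 * a)))" unfolding bd_Suc_double by presburger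
    then have "bnode r (4 * a + 1) = bnode j (2 * a)"
      using Suc N(2) by (simp add: belt_not_bd)
    ultimately show ?thesis using belt_even [OF that N(2)] by simp
  qed
  show "fst (M (addr 0 (Suc (Suc j)))) = of_bool (range_starts (Suc (2 * a))) + of_bool (3 \<le> a)" if "odd a"
  proof -
    have "a mod 4 = 1 \<longleftrightarrow> even (a div 2)" using that by presburger
    moreover have "4 \<le> a \<longleftrightarrow> 5 \<le> a" if "a mod 4 = 1" using that by presburger
    ultimately have "range_starts (Suc (2 * a)) \<longleftrightarrow> even (a div 2) \<and> 4 \<le> a" unfolding bd_Suc_double by blast
    then show ?thesis using s' that by (simp add: slot_def)
  qed
  show "snd (M (addr 2 (Suc (Suc j)))) = lab (rnode (Suc j) a)" if "odd a" "3 \<le> a"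
    using s' that by (simp add: slot_def)
  show "snd (M (addr 3 (Suc (Suc j)))) = lab (bnode (Suc j) a)" if "odd a" "3 \<le> a"
    using s' that d bd_double [of a] by (simp add: slot_def)
qed

definition merged_memory :: "(tree \<Rightarrow> hash) \<Rightarrow> bool \<Rightarrow> nat \<Rightarrow> nat \<Rightarrow> memory \<Rightarrow> memory \<Rightarrow> bool" where
  "merged_memory lab z j a M M' \<longleftrightarrow>
    fst (M' 0) = top_pair j (Suc (2 * a)) \<and> M' 1 = M 1 \<and>
    snd (M' 5) = lab (if z then bnode j (Suc (2 * a))
       else Node (bnode j (Suc (2 * a))) (rnode j (Suc (2 * a)))) \<and>
    snd (M' 6) = lab (rnode j (Suc (2 * a))) \<and>
    slot M' lab j (Suc (2 * a)) True \<and> fst (M' (addr 0 j)) = 0 \<and>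
    (\<forall>r h. r < 4 \<longrightarrow> h \<noteq> j \<longrightarrow> h \<noteq> Suc j \<longrightarrow> M' (addr r h) = M (addr r h))"

lemma sem_merge:
  fixes H d x
  defines "lab \<equiv> label H d x"
  assumes inv: "manager_inv lab N M0" and N: "Suc N = 2 ^ j * Suc (2 * a)" "1 \<le> a"
    and B: "8 \<le> B" "\<And>r h. r < 4 \<Longrightarrow> h \<le> Suc j \<Longrightarrow> addr r h < B"
    and M: "M = M0(1 := (of_bool z, v), 2 := (addr 0 j, lab (mountain j (2 * a))),
        3 := (top_pair (Suc j) a, lab (perfect j (2 ^ j * (2 * a - 1)))))"
  shows "\<exists>M'. sem H d B merge_cmd (M, inp, out) =
      Some (M', inp, out @ [lab (mountain j (Suc (2 * a))), lab (rnode j (Suc (2 * a))),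
        lab (Node (bnode j (Suc (2 * a))) (rnode j (Suc (2 * a))))]) \<and>
      merged_memory lab z j a M M'"
proof -
  note in0 = merge_inputs [OF inv N]
  have peak: "lab (mountain j (Suc (2 * a))) = H (lab (mountain j (2 * a)) @ lab (perfect j (2 ^ j * (2 * a - 1))))"
    by (simp add: lab_def mtn_merge [OF N(2)])
  have lab: "lab (Node l r) = H (lab l @ lab r)" "lab Missing = d" for l r by (simp_all add: lab_def)
  have regs: "fst (M (Suc 0)) = of_bool z" "fst (M 2) = addr 0 j" "snd (M 2) = lab (mountain j (2 * a))"
    "fst (M 3) = top_pair (Suc j) a" "snd (M 3) = lab (perfect j (2 ^ j * (2 * a - 1)))"
    "\<And>r h. M (addr r h) = M0 (addr r h)"
    by (simp_all add: M addr_simps)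
  have div: "Suc (2 * a) div 2 = a" by simp
  consider "even a" "2 \<le> a" | "odd a" "3 \<le> a" "range_starts (Suc (2 * a))" | "odd a" "3 \<le> a" "\<not> range_starts (Suc (2 * a))" | "odd a" "\<not> 3 \<le> a"
    using N(2) by (cases "a = 1"; cases "a = 2"; cases "even a") auto
  then show ?thesis
  proof cases
    case 1
    then have "\<not> range_starts (Suc (2 * a))" unfolding bd_Suc_double by presburger
    then have new: "bnode j (Suc (2 * a)) = bnode (Suc j) a"
      "rnode j (Suc (2 * a)) = Node (rnode (Suc j) a) (mountain j (Suc (2 * a)))"
      using N(2) by (simp_all add: belt_not_bd range_not_bd)
    show ?thesis
      unfolding merge_cmd_def
      using B 1 in0 by (simp add: addr_simps regs slot_def merged_memory_def new lab peak top_pair_Suc_double)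
  next
    case 2
    then have new: "bnode j (Suc (2 * a)) = Node (bnode (Suc j) a) (rnode (Suc j) a)"
      "rnode j (Suc (2 * a)) = Node Missing (mountain j (Suc (2 * a)))"
      by (simp_all add: belt_bd range_bd)
    show ?thesis
      unfolding merge_cmd_def
      using B 2 in0 by (simp add: addr_simps regs slot_def merged_memory_def new lab peak top_pair_Suc_double)
  next
    case 3
    then have new: "bnode j (Suc (2 * a)) = bnode (Suc j) a"
      "rnode j (Suc (2 * a)) = Node (rnode (Suc j) a) (mountain j (Suc (2 * a)))"
      using N(2) by (simp_all add: belt_not_bd range_not_bd)
    show ?thesis
      unfolding merge_cmd_def
      using B 3 in0 by (simp add: addr_simps regs slot_def merged_memory_def new lab peak top_pair_Suc_double)
  next
    case 4
    then have b: "\<not> range_starts (Suc (2 * a))" unfolding bd_Suc_double by simp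
    have "a = 1" using 4 N(2) by (cases "a = 2") auto
    then have new: "bnode j (Suc (2 * a)) = Missing"
      "rnode j (Suc (2 * a)) = Node Missing (mountain j (Suc (2 * a)))"
      using belt_not_bd [OF _ b] range_not_bd [OF _ b] by simp_all
    show ?thesis
      unfolding merge_cmd_def
      using B 4 N(2) in0 b by (simp add: addr_simps regs slot_def merged_memory_def new lab peak top_pair_Suc_double)
  qed
qed


lemma div_Suc_high:
  assumes "Suc N = 2 ^ j * Suc (2 * a)" "j < g"
  shows "Suc N div 2 ^ g = N div 2 ^ g"
proof -
  obtain e where g: "g = Suc j + e" using assms(2) by (metis less_imp_Suc_add add_Suc)
  have "N div 2 ^ j = 2 * a" by (rule div_pred [OF assms(1)])
  then have "N div 2 ^ Suc j = a" by (simp add: power_Suc2 div_mult2_eq del: power_Suc)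
  moreover have "Suc N div 2 ^ j = Suc (2 * a)" by (simp add: assms(1))
  then have "Suc N div 2 ^ Suc j = a" by (simp add: power_Suc2 div_mult2_eq del: power_Suc)
  ultimately show ?thesis by (simp only: g power_add div_mult2_eq)
qed

text \<open>The merge affects heights \<open>j\<close> and \<open>j + 1\<close> only. Below, indices
  and digits change, but by \<open>mtn_shift\<close> and \<open>range_shift\<close> the cells remain
  correct; above, at most the validity of a belt cell is lost.\<close>

lemma slot_step:
  assumes inv: "manager_inv lab N M0" and N: "Suc N = 2 ^ j * Suc (2 * a)"
    and keep: "\<And>r h. r < 4 \<Longrightarrow> 1 \<le> h \<Longrightarrow> h \<noteq> j \<Longrightarrow> h \<noteq> Suc j \<Longrightarrow> M (addr r h) = M0 (addr r h)"
    and merged: "slot M lab j (Suc (2 * a)) True" and cleared: "1 \<le> j \<Longrightarrow> fst (M (addr 0 j)) = 0"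
  shows "slot M lab g (Suc N div 2 ^ g) (g = 0 \<or> range_starts (Suc N div 2 ^ (g - 1)))"
proof -
  have old: "slot M0 lab g (N div 2 ^ g) (g = 0 \<or> range_starts (N div 2 ^ (g - 1)))"
    using inv unfolding manager_inv_def by metis
  consider "Suc j < g" | "g = Suc j" | "g = j" | "Suc g = j" | "Suc g < j" by linarith
  then show ?thesis
  proof cases
    case 1
    then have "Suc N div 2 ^ g = N div 2 ^ g" "Suc N div 2 ^ (g - 1) = N div 2 ^ (g - 1)"
      by (auto intro!: div_Suc_high [OF N])
    then show ?thesis using slot_cong [OF old, of M] keep [of _ "Suc g"] 1 by auto
  next
    case 2
    have "N div 2 ^ j = 2 * a" by (rule div_pred [OF N])
    moreover have "Suc N div 2 ^ j = Suc (2 * a)" by (simp add: N)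
    moreover have "range_starts (Suc (2 * a)) \<Longrightarrow> range_starts (2 * a)" unfolding bd_Suc_double bd_double by presburger
    moreover have "Suc N div 2 ^ g = N div 2 ^ g" using 2 by (intro div_Suc_high [OF N]) simp
    ultimately show ?thesis using slot_cong [OF old, of M] keep [of _ "Suc g"] 2 by auto
  next
    case 3
    then have "Suc N div 2 ^ g = Suc (2 * a)" by (simp add: N)
    then show ?thesis using slot_cong [OF merged] 3 by auto
  next
    case 4
    then have "Suc N div 2 ^ g = 2 * Suc (2 * a)" unfolding N by auto
    then show ?thesis using cleared 4 by (simp add: slot_def)
  next
    case 5
    then obtain e where e: "j = Suc (Suc (g + e))" using less_iff_Suc_add by auto
    \<comment> \<open>Digits \<open>g\<close> and \<open>g + 1\<close> lie below \<open>j\<close>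
      and change from 11 to 00; \<open>v\<close> is the part of \<open>N\<close> above them.\<close>
    define v where "v = 2 ^ e * Suc (2 * a) - 1"
    have "Suc v = 2 ^ e * Suc (2 * a)" by (simp add: v_def)
    moreover have "Suc (4 * v + 3) = 4 * Suc v" by simp
    ultimately have N': "Suc N = 2 ^ g * Suc (4 * v + 3)" using N e by (simp only: power_add power_Suc)

    then have d: "N div 2 ^ g = 4 * v + 3" "Suc N div 2 ^ g = 2 * (2 * v + 2)"
      using div_pred [OF N'] by (simp_all add: N')
    have "(4 * v + 3) div 2 = 2 * v + 1" "odd (4 * v + 3)" by presburger+
    then have "fst (M0 (addr 0 (Suc g))) = 1" "snd (M0 (addr 0 (Suc g))) = lab (mountain (Suc g) (2 * v + 2))"
      "snd (M0 (addr 2 (Suc g))) = lab (rnode (Suc g) (2 * v + 2))"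
      using old d(1) mtn_shift [of g v] range_shift [of g v] by (auto simp: slot_def)
    moreover have "M (addr r (Suc g)) = M0 (addr r (Suc g))" if "r < 4" for r
      using keep [OF that, of "Suc g"] 5 by auto
    ultimately show ?thesis unfolding d(2) by (simp add: slot_def del: add_2_eq_Suc' add_Suc_right)
  qed
qed

lemma slot_1: "slot M lab g (Suc 0) w \<longleftrightarrow> fst (M (addr 0 (Suc g))) = 0"
  by (simp add: slot_def)

text \<open>The first 12 cells are the registers and height 0. A merge writes up to height
  \<open>j + 1\<close>, whose last cell is \<open>15 + 4 * j\<close>. For \<open>j = 0\<close> it
  absorbs the new leaf; otherwise the leaf becomes a mountain afterwards.\<close>

lemma sem_append:
  fixes H d x
  defines "lab \<equiv> label H d x"
  assumes inv: "manager_inv lab N M" and N: "Suc N = 2 ^ j * Suc (2 * a)" "1 \<le> N"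
    and B: "12 \<le> B" "a \<noteq> 0 \<Longrightarrow> 16 + 4 * j \<le> B"
  shows "\<exists>M' pub. sem H d B append_cmd (M, [(0, H (x N))], []) = Some (M', [], pub @ [lab (mmb N)]) \<and>
    manager_inv lab (Suc N) M' \<and> lab ` new_nodes N a j \<subseteq> set (pub @ [lab (mmb N)])"
proof -
  have lab: "lab (Node l r) = H (lab l @ lab r)" "lab Missing = d" "lab (Leaf N) = H (x N)" for l r
    by (simp_all add: lab_def)
  have B': "8 \<le> B" "\<And>r. r < 4 \<Longrightarrow> addr r 0 < B" using B(1) by (auto simp: addr_def)
  have mmb: "lab (mmb N) = H (lab (bnode 0 (Suc N)) @ lab (rnode 0 (Suc N)))"
    using N(2) by (simp add: mmb_eq lab)
  show ?thesis
  proof (cases "j = 0")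
    case True
    then have N': "N = 2 * a" "1 \<le> a" using N by auto
    define M1 where "M1 = M(1 := (of_bool True, H (x N)), 2 := (addr 0 j, lab (mountain j (2 * a))),
        3 := (top_pair (Suc j) a, lab (perfect j (2 ^ j * (2 * a - 1)))))"
    have s1: "sem H d B select_cmd (M(1 := (0, H (x N))), [], []) = Some (M1, [], [])"
      using sem_select [OF inv [unfolded lab_def] N(1) N'(2) B'(1)] True by (simp add: M1_def lab_def)
    have "addr r h < B" if "r < 4" "h \<le> Suc j" for r h
      using that B(2) N'(2) True by (auto simp: addr_def)
    then obtain M2 where M2: "sem H d B merge_cmd (M1, [], []) =
        Some (M2, [], [] @ [lab (mountain j (Suc (2 * a))), lab (rnode j (Suc (2 * a))),
          lab (Node (bnode j (Suc (2 * a))) (rnode j (Suc (2 * a))))])"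
        "merged_memory lab True j a M1 M2"
      using sem_merge [OF inv [unfolded lab_def] N(1) N'(2) B'(1), of M1 True "H (x N)" "[]" "[]"]
      unfolding M1_def lab_def by blast
    have "M1 2 = (addr 0 j, lab (mountain j (2 * a)))" "M1 1 = (1, H (x N))"
      "\<And>r h. M1 (addr r h) = M (addr r h)" by (simp_all add: M1_def addr_simps)
    then have "sem H d B append_cmd (M, [(0, H (x N))], []) =
      Some (M2, [], [lab (mountain j (Suc (2 * a))), lab (rnode j (Suc (2 * a))),
          lab (Node (bnode j (Suc (2 * a))) (rnode j (Suc (2 * a)))), lab (Leaf N)] @ [lab (mmb N)])"
      using M2 s1 B'(1) True N'(1) mmb lab(3)
      by (simp add: append_cmd_def push_cmd_def merged_memory_def addr_simps)
    moreover have "manager_inv lab (Suc N) M2"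
    proof -
      have "slot M2 lab g (Suc N div 2 ^ g) (g = 0 \<or> range_starts (Suc N div 2 ^ (g - 1)))" for g
        by (rule slot_step [OF inv N(1)])
          (use M2(2) True \<open>\<And>r h. M1 (addr r h) = M (addr r h)\<close> in \<open>auto simp: merged_memory_def\<close>)
      then show ?thesis
        using M2(2) True N' by (auto simp: manager_inv_def merged_memory_def)
    qed
    moreover have "lab ` new_nodes N a j \<subseteq> set ([lab (mountain j (Suc (2 * a))), lab (rnode j (Suc (2 * a))),
          lab (Node (bnode j (Suc (2 * a))) (rnode j (Suc (2 * a)))), lab (Leaf N)] @ [lab (mmb N)])"
      using True N' by (auto simp: new_nodes_def)
    ultimately show ?thesis by blast
  next
    case False
    then have ev: "even (Suc N)" using N(1) by (metis dvd_power even_mult_iff neq0_conv)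
    then have "odd N" by simp
    have mm: "\<exists>M2 pub. sem H d B (Seq select_cmd (If (Less (Num 0) (reg 2)) merge_cmd (StoreHash (Num 5) Default)))
          (M(1 := (0, H (x N))), [], []) = Some (M2, [], pub) \<and>
        M2 1 = (0, H (x N)) \<and> snd (M2 5) = lab (bnode 0 (Suc N)) \<and>
        fst (M2 0) = top_pair j (Suc (2 * a)) \<and>
        slot M2 lab j (Suc (2 * a)) True \<and> fst (M2 (addr 0 j)) = 0 \<and>
        (\<forall>r h. r < 4 \<longrightarrow> h \<noteq> j \<longrightarrow> h \<noteq> Suc j \<longrightarrow> M2 (addr r h) = M (addr r h)) \<and>
        (a \<noteq> 0 \<longrightarrow> {lab (mountain j (Suc (2 * a))), lab (rnode j (Suc (2 * a))),
          lab (Node (bnode j (Suc (2 * a))) (rnode j (Suc (2 * a))))} \<subseteq> set pub)"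
    proof (cases "a = 0")
      case True
      obtain r where r: "j = Suc r" using False by (cases j) auto
      have "fst (M 0) = 0" "fst (M (addr 0 0)) = 0"
        using inv top_pair_ones [of N r a 0] N True r \<open>odd N\<close> by (auto simp: manager_inv_def)
      then have "sem H d B (Seq select_cmd (If (Less (Num 0) (reg 2)) merge_cmd (StoreHash (Num 5) Default)))
          (M(1 := (0, H (x N))), [], []) =
        Some (M(1 := (0, H (x N)), 2 := (0, H (x N)), 3 := (0, snd (M 0)), 5 := (fst (M 5), d)), [], [])"
        using B'(1) by (simp add: select_cmd_def addr_simps fun_upd_twist)
      moreover have "bnode 0 (Suc N) = Missing"
        using belt_odd_times_power [of j a] N(1) True False by simp
      moreover have "fst (M (addr 0 (Suc j))) = 0"
      proof -
        have "N div 2 ^ j = 0" using div_pred [OF N(1)] True by simp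
        then have "slot M lab j 0 (j = 0 \<or> range_starts (N div 2 ^ (j - 1)))" using inv unfolding manager_inv_def by metis
        then show ?thesis by (simp add: slot_def)
      qed
      moreover have "fst (M (addr 0 j)) = 0"
      proof -
        have "Suc N = 2 ^ r * Suc 1" using N True r by simp
        then have "N div 2 ^ r = Suc 0" using div_pred [of N r 1] by simp
        then have "slot M lab r (Suc 0) (r = 0 \<or> range_starts (N div 2 ^ (r - 1)))" using inv unfolding manager_inv_def by metis
        then show ?thesis by (simp add: slot_def r)
      qed
      moreover have "top_pair 0 N = 0" using \<open>fst (M 0) = 0\<close> inv by (simp add: manager_inv_def)
      ultimately show ?thesis
        using True \<open>fst (M 0) = 0\<close> lab(2)
        by (intro exI conjI) (assumption | (auto simp: slot_1 addr_simps top_pair.simps))+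
    next
      case a: False
      define M1 where "M1 = M(1 := (of_bool False, H (x N)), 2 := (addr 0 j, lab (mountain j (2 * a))),
          3 := (top_pair (Suc j) a, lab (perfect j (2 ^ j * (2 * a - 1)))))"
      have s1: "sem H d B select_cmd (M(1 := (0, H (x N))), [], []) = Some (M1, [], [])"
        using sem_select [OF inv [unfolded lab_def] N(1) _ B'(1)] False a by (simp add: M1_def lab_def)
      have "addr r h < B" if "r < 4" "h \<le> Suc j" for r h
        using that B(2) a by (auto simp: addr_def)
      then obtain M2 where M2: "sem H d B merge_cmd (M1, [], []) =
          Some (M2, [], [] @ [lab (mountain j (Suc (2 * a))), lab (rnode j (Suc (2 * a))),
            lab (Node (bnode j (Suc (2 * a))) (rnode j (Suc (2 * a))))])"
          "merged_memory lab False j a M1 M2"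
        using sem_merge [OF inv [unfolded lab_def] N(1) _ B'(1), of M1 False "H (x N)" "[]" "[]"] a
        unfolding M1_def lab_def by (auto simp del: append_Nil)
      have M1: "M1 2 = (addr 0 j, lab (mountain j (2 * a)))" "M1 1 = (0, H (x N))"
        "\<And>r h. M1 (addr r h) = M (addr r h)" by (simp_all add: M1_def addr_simps)
      have "sem H d B (Seq select_cmd (If (Less (Num 0) (reg 2)) merge_cmd (StoreHash (Num 5) Default)))
          (M(1 := (0, H (x N))), [], []) = Some (M2, [], [lab (mountain j (Suc (2 * a))), lab (rnode j (Suc (2 * a))),
            lab (Node (bnode j (Suc (2 * a))) (rnode j (Suc (2 * a))))])"
        using s1 M2(1) M1(1) by (simp add: addr_simps)
      moreover have "bnode 0 (Suc N) = Node (bnode j (Suc (2 * a))) (rnode j (Suc (2 * a)))"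
        using belt_odd_times_power [of j a] N(1) a False by simp
      ultimately show ?thesis
        using M2(2) M1 by (intro exI conjI) (assumption | (auto simp: merged_memory_def))+
    qed
    then obtain M2 pub where M2: "sem H d B (Seq select_cmd (If (Less (Num 0) (reg 2)) merge_cmd (StoreHash (Num 5) Default)))
          (M(1 := (0, H (x N))), [], []) = Some (M2, [], pub)"
        "M2 1 = (0, H (x N))" "snd (M2 5) = lab (bnode 0 (Suc N))"
        "fst (M2 0) = top_pair j (Suc (2 * a))"
        "slot M2 lab j (Suc (2 * a)) True" "fst (M2 (addr 0 j)) = 0"
        "\<And>r h. r < 4 \<Longrightarrow> h \<noteq> j \<Longrightarrow> h \<noteq> Suc j \<Longrightarrow> M2 (addr r h) = M (addr r h)"
        "a \<noteq> 0 \<Longrightarrow> {lab (mountain j (Suc (2 * a))), lab (rnode j (Suc (2 * a))),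
          lab (Node (bnode j (Suc (2 * a))) (rnode j (Suc (2 * a))))} \<subseteq> set pub"
      by blast
    have R: "rnode 0 (Suc N) = Node (if j = 1 then Missing else rnode 0 N) (Leaf N)"
    proof -
      have "Suc N mod 4 = 2 \<longleftrightarrow> j = 1"
      proof (cases "j = 1")
        case False
        define e where "e = j - 2"
        have "j = Suc (Suc e)" using False \<open>j \<noteq> 0\<close> by (simp add: e_def)
        then show ?thesis by (simp add: N(1) mult.assoc del: mult_Suc_right)
      next
        case True
        have "2 * Suc (2 * a) mod 4 = 2" by presburger
        then show ?thesis using True N(1) by (simp only: power_one_right) simp
      qed
      then show ?thesis using range_even [OF ev] N(2) by simp
    qed
    have c1: "fst (M2 (addr 0 (Suc 0))) = 0 \<longleftrightarrow> j = 1"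
      "j \<noteq> 1 \<Longrightarrow> snd (M2 (addr 2 (Suc 0))) = lab (rnode 0 N)"
    proof -
      have "odd N" "3 \<le> N" if "j \<noteq> 1"
      proof -
        show "odd N" using ev by simp
        define e where "e = j - 2"
        have "j = Suc (Suc e)" using that False by (simp add: e_def)
        then have "Suc N = 4 * (2 ^ e * Suc (2 * a))" by (simp add: N(1) mult.assoc del: mult_Suc_right)
        moreover have "1 \<le> 2 ^ e * Suc (2 * a)" by (simp add: Suc_le_eq del: mult_Suc_right)
        ultimately show "3 \<le> N" by linarith
      qed
      moreover have "slot M lab 0 N True" using inv unfolding manager_inv_def by (metis power_0 div_by_1)
      ultimately have "j \<noteq> 1 \<Longrightarrow> 0 < fst (M (addr 0 (Suc 0)))" "j \<noteq> 1 \<Longrightarrow> snd (M (addr 2 (Suc 0))) = lab (rnode 0 N)"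
        by (auto simp: slot_def)
      moreover have "M2 (addr r (Suc 0)) = M (addr r (Suc 0))" if "r < 4" "j \<noteq> 1" for r
        using M2(7) [of r "Suc 0"] that False by auto
      ultimately show "fst (M2 (addr 0 (Suc 0))) = 0 \<longleftrightarrow> j = 1"
        "j \<noteq> 1 \<Longrightarrow> snd (M2 (addr 2 (Suc 0))) = lab (rnode 0 N)"
        using M2(6) by (cases "j = 1"; auto)+
    qed
    define M3 where "M3 = M2(6 := (fst (M2 6), lab (rnode 0 (Suc N))), addr 0 0 := (1, H (x N)),
      addr 2 0 := (fst (M2 (addr 2 0)), lab (rnode 0 (Suc N))),
      addr 3 0 := (fst (M2 (addr 3 0)), lab (bnode 0 (Suc N))))"
    have "sem H d B push_cmd (M2, [], pub) =
        Some (M3, [], pub @ [H (x N), lab (rnode 0 (Suc N)), lab (mmb N)])"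
      using B' M2(2,3) c1
      by (cases "j = 1") (simp_all add: push_cmd_def addr_simps M3_def R lab mmb fun_upd_twist)
    then have run: "sem H d B append_cmd (M, [(0, H (x N))], []) =
      Some (M3, [], (pub @ [H (x N), lab (rnode 0 (Suc N))]) @ [lab (mmb N)])"
      using M2(1) B'(1) by (auto simp: append_cmd_def split: option.splits)
    have M3: "M3 (addr r h) = M2 (addr r h)" if "r < 4" "1 \<le> h" for r h
      using that by (simp add: M3_def addr_simps)
    have "slot M3 lab g (Suc N div 2 ^ g) (g = 0 \<or> range_starts (Suc N div 2 ^ (g - 1)))" for g
    proof (rule slot_step [OF inv N(1)])
      show "slot M3 lab j (Suc (2 * a)) True" using slot_cong [OF M2(5)] M3 by auto
      show "fst (M3 (addr 0 j)) = 0" if "1 \<le> j" using M3 [of 0 j] that M2(6) by simp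
      show "M3 (addr r h) = M (addr r h)" if "r < 4" "1 \<le> h" "h \<noteq> j" "h \<noteq> Suc j" for r h
        using M3 [of r h] M2(7) that by simp
    qed
    moreover have "fst (M3 0) = top_pair 0 (Suc N)"
      using M2(4) top_pair_power [of 0 j "Suc (2 * a)"] N(1) by (simp add: M3_def addr_simps)
    ultimately have "manager_inv lab (Suc N) M3"
      using ev N(2) mtn_0_even [OF ev] lab(3) by (simp add: manager_inv_def M3_def addr_simps)
    then show ?thesis
      using run M2(8) lab(3)
      by (intro exI [of _ M3] exI [of _ "pub @ [H (x N), lab (rnode 0 (Suc N))]"]) (auto simp: new_nodes_def)
  qed
qed

section \<open>The scheme\<close>

definition belt_scheme :: scheme where
  "belt_scheme = \<lparr>append_prog = append_cmd, commitment_prog = commit_cmd, increment_prog = incr_cmd,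
     membership_prog = member_cmd, update_prog = update_cmd, increment_choice = belt_increment\<rparr>"

lemma belt_scheme_simps [simp]:
  "append_prog belt_scheme = append_cmd" "commitment_prog belt_scheme = commit_cmd"
  "increment_prog belt_scheme = incr_cmd" "membership_prog belt_scheme = member_cmd"
  "update_prog belt_scheme = update_cmd" "increment_choice belt_scheme = belt_increment"
  by (simp_all add: belt_scheme_def)

text \<open>The increment proof dominates: it is given \<open>19 + 4 * s\<close> cells, where
  \<open>s = 104 * floor_log n + 250\<close> bounds its message.\<close>

definition mem_bound :: "nat \<Rightarrow> nat" where
  "mem_bound n = 1100 + 420 * floor_log n"

text \<open>The argument \<open>104 * floor_log k + 250\<close> bounds the messages of all resync
  operations; the 100 covers initial commands and the commitment update.\<close>

definition time_bound :: "nat \<Rightarrow> nat" where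
  "time_bound k = 100 + climb_all_cost (104 * floor_log k + 250) + incr_cost (104 * floor_log k + 250)"

lemma floor_log_le: "m \<le> n \<Longrightarrow> floor_log m \<le> floor_log n"
  using floor_log_mono by (rule monoD)

lemma mono_mem_bound: "mono mem_bound"
  by (rule monoI) (simp add: mem_bound_def floor_log_le)

lemma climb_all_cost_mono: "m \<le> n \<Longrightarrow> climb_all_cost m \<le> climb_all_cost n"
  unfolding climb_all_cost_def by (intro add_left_mono mult_le_mono2)

lemma incr_cost_mono: "m \<le> n \<Longrightarrow> incr_cost m \<le> incr_cost n"
  unfolding incr_cost_def by (intro add_left_mono mult_le_mono2)

lemma time_bound_mono: "k \<le> l \<Longrightarrow> time_bound k \<le> time_bound l"
  unfolding time_bound_def using floor_log_le [of k l]
  by (intro add_mono order_refl climb_all_cost_mono incr_cost_mono) auto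

lemma affine_floor_log_bigo: "(\<lambda>k. real (\<alpha> + \<beta> * floor_log k)) \<in> O(\<lambda>k. ln (real k))"
proof (rule bigoI)
  show "eventually (\<lambda>k. norm (real (\<alpha> + \<beta> * floor_log k)) \<le> (real \<alpha> + real \<beta> / ln 2) * norm (ln (real k))) at_top"
    using eventually_ge_at_top [of 3]
  proof eventually_elim
    case (elim k)
    \<comment> \<open>From 3 on the logarithm is at least 1 and absorbs the constant
      \<open>\<alpha>\<close>.\<close>
    have "ln (exp 1) \<le> ln (real k)"
      using elim exp_le by (subst ln_le_cancel_iff) auto
    then have 1: "1 \<le> ln (real k)" by simp
    have "real (floor_log k) \<le> log 2 (real k)"
      using elim by (simp add: floor_log_altdef)
    then have "real \<beta> * real (floor_log k) \<le> real \<beta> * (ln (real k) / ln 2)"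
      by (intro mult_left_mono) (auto simp: log_def)
    moreover have "real \<alpha> * 1 \<le> real \<alpha> * ln (real k)" using 1 by (intro mult_left_mono) auto
    ultimately show ?case using 1 by (simp add: algebra_simps)
  qed
qed

lemma mem_bound_bigo: "(\<lambda>n. real (mem_bound n)) \<in> O(\<lambda>n. ln (real n))"
  unfolding mem_bound_def by (rule affine_floor_log_bigo)

lemma time_bound_bigo: "(\<lambda>k. real (time_bound k)) \<in> O(\<lambda>k. ln (real k))"
proof -
  obtain p q where pq: "\<And>n. climb_all_cost n = p + q * n"
    by (rule that) (rule climb_all_cost_def)
  obtain r s where rs: "\<And>n. incr_cost n = r + s * n"
    by (rule that) (rule incr_cost_def)
  have "time_bound k = (100 + p + r + (q + s) * 250) + (q + s) * 104 * floor_log k" for k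
    by (simp add: time_bound_def pq rs algebra_simps)
  then show ?thesis using affine_floor_log_bigo by presburger
qed

section \<open>The four resync operations within the bounds\<close>

lemma updates_commitment_belt:
  assumes "3 \<le> B" "100 \<le> c"
  shows "updates_commitment_within H d x belt_scheme B c n"
  unfolding updates_commitment_within_def
proof (intro allI impI)
  fix M assume "fits B M"
  let ?M = "M(2 := (fst (M 2), snd (M 0)), 0 := (0, root_hash H d x n))"
  have "sem H d B commit_cmd (M, [(0, root_hash H d x n)], []) = Some (?M, [], [])"
    using assms(1) by (simp add: commit_cmd_def)
  then obtain t where t: "t \<le> cost_bound commit_cmd" "exec H d B commit_cmd (M, [(0, root_hash H d x n)], []) t (?M, [], [])"
    using exec_sem by blast
  moreover have "fits B ?M" using exec_fits [OF t(2) \<open>fits B M\<close>] .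
  moreover have "cost_bound commit_cmd \<le> 100" by (simp add: commit_cmd_def)
  ultimately show "\<exists>t M'. runs H d B (commitment_prog belt_scheme) M (map (Pair 0) (commitment H d x n)) t M' [] \<and>
      t \<le> c \<and> fits B M' \<and> snd (M' 0) = root_hash H d x n \<and> snd (M' 2) = snd (M 0) \<and>
      (\<forall>a. even a \<and> a \<notin> {0, 2} \<longrightarrow> M' a = M a)"
    using assms(2) by (intro exI [of _ t] exI [of _ ?M]) (auto simp: runs_def commitment_def)
qed

text \<open>Here \<open>k\<close> exceeds the distance of \<open>i\<close> from the end: it is
  \<open>n - m\<close> for elements appended after \<open>m\<close>, and \<open>n\<close> for
  arbitrary ones.\<close>

lemma length_membership_proof:
  assumes "1 \<le> i" "i \<le> n" "n - i < k"
  shows "length (membership_proof H d x n i) \<le> 2 * floor_log k + 5"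
proof -
  have "n < i + 2 ^ Suc (floor_log k)" using less_power_floor_log [of k] assms(3) by linarith
  then have "length (path i (mmb n)) \<le> 2 * Suc (floor_log k) + 4"
    using length_path_mmb [OF assms(1,2)] by blast
  moreover have "i \<in> leaves (mmb n)" using assms by (simp add: leaves_mmb)
  ultimately show ?thesis by (simp add: membership_proof_def length_siblings)
qed

lemma recompute_membership_proof:
  "1 \<le> i \<Longrightarrow> i \<le> n \<Longrightarrow> recompute H d (H (x i)) (membership_proof H d x n i) = root_hash H d x n"
  by (simp add: membership_proof_def root_hash_def recompute_siblings leaves_mmb)

lemma retrieves_membership_belt:
  assumes "m < i" "i \<le> n"
  shows "retrieves_membership_within H d x belt_scheme (mem_bound n) (time_bound (n - m)) n i"
  unfolding retrieves_membership_within_def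
proof (intro allI impI)
  fix M assume M: "fits (mem_bound n) M \<and> snd (M 0) = root_hash H d x n"
  let ?es = "membership_proof H d x n i"
  have len: "length ?es \<le> 2 * floor_log (n - m) + 5" "length ?es \<le> 2 * floor_log n + 5"
    using assms by (auto intro!: length_membership_proof)
  then have "15 + 4 * length ?es \<le> mem_bound n" by (simp add: mem_bound_def)
  then obtain t M' where M': "exec H d (mem_bound n) member_cmd (M, (0, H (x i)) # map step_token ?es, []) t (M', [], [])"
    "t \<le> 7 + climb_all_cost (length ?es)"
    "fst (M' 4) = of_bool (recompute H d (H (x i)) ?es = snd (M 0))"
    "stores_proof H d M' (H (x i)) ?es" "M' 0 = M 0" "M' 2 = M 2"
    using exec_member by blast
  have "climb_all_cost (length ?es) \<le> climb_all_cost (104 * floor_log (n - m) + 250)"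
    using len by (intro climb_all_cost_mono) linarith
  then have "t \<le> time_bound (n - m)" using M'(2) unfolding time_bound_def by linarith
  moreover have "fits (mem_bound n) M'" using exec_fits [OF M'(1)] M by blast
  moreover have "fst (M' 4) = 1" using M'(3) M assms recompute_membership_proof [of i n H d x] by simp
  ultimately show "\<exists>t M'. runs H d (mem_bound n) (membership_prog belt_scheme) M
          ((0, H (x i)) # map step_token ?es) t M' [] \<and>
        t \<le> time_bound (n - m) \<and> fits (mem_bound n) M' \<and> fst (M' 4) = 1 \<and>
        stores_proof H d M' (H (x i)) ?es \<and> M' 0 = M 0 \<and> M' 2 = M 2"
    using M' by (intro exI [of _ t] exI [of _ M']) (simp add: runs_def)
qed

lemma updates_membership_belt:
  assumes "1 \<le> i" "i \<le> m" "m < n"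
  shows "updates_membership_within H d x belt_scheme (mem_bound n) (time_bound (n - m)) m n i"
  unfolding updates_membership_within_def
proof (intro allI impI)
  let ?old = "membership_proof H d x m i" and ?new = "membership_proof H d x n i" and ?j = "kept m n i"
  fix M assume M: "fits (mem_bound n) M \<and> snd (M 0) = root_hash H d x n \<and> stores_proof H d M (H (x i)) ?old"
  let ?es = "drop ?j ?new"
  have j: "?j \<le> length ?old" and eq: "take ?j ?old @ ?es = ?new"
    using take_kept [of i m n H d x] assms by auto
  have "length ?old \<le> 2 * floor_log n + 5" "length ?new \<le> 2 * floor_log n + 5"
    using assms by (auto intro!: length_membership_proof)
  then have B: "15 + 4 * (?j + length ?es) \<le> mem_bound n" using j by (simp add: mem_bound_def)
  obtain t M' where M': "exec H d (mem_bound n) update_cmd (M, (?j, []) # map step_token ?es, []) t (M', [], [])"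
    "t \<le> 3 + climb_all_cost (length ?es)"
    "fst (M' 4) = of_bool (recompute H d (H (x i)) (take ?j ?old @ ?es) = snd (M 0))"
    "stores_proof H d M' (H (x i)) (take ?j ?old @ ?es)" "M' 0 = M 0" "M' 2 = M 2"
    using exec_update [OF _ j B] M by blast
  have "climb_all_cost (length ?es) \<le> climb_all_cost (104 * floor_log (n - m) + 250)"
    using length_drop_kept [OF assms, of H d x] by (intro climb_all_cost_mono) linarith
  then have "t \<le> time_bound (n - m)" using M'(2) unfolding time_bound_def by linarith
  moreover have "fits (mem_bound n) M'" using exec_fits [OF M'(1)] M by blast
  moreover have "fst (M' 4) = 1" using M'(3) M assms recompute_membership_proof [of i n H d x] eq by simp
  ultimately show "\<exists>t M'. runs H d (mem_bound n) (update_prog belt_scheme) M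
          ((?j, []) # map step_token ?es) t M' [] \<and>
        t \<le> time_bound (n - m) \<and> fits (mem_bound n) M' \<and> fst (M' 4) = 1 \<and>
        stores_proof H d M' (H (x i)) ?new \<and> M' 0 = M 0 \<and> M' 2 = M 2"
    using M' eq by (intro exI [of _ t] exI [of _ M']) (simp add: runs_def)
qed

lemma verifies_increment_belt:
  assumes "1 \<le> m" "m < n"
  shows "verifies_increment_within H d x belt_scheme (mem_bound n) (time_bound (n - m)) m n"
  unfolding verifies_increment_within_def
proof (intro allI impI)
  fix M assume M: "fits (mem_bound n) M \<and> snd (M 0) = root_hash H d x n \<and> snd (M 2) = root_hash H d x m"
  obtain C D "is" js where ip: "hash_increment_proof H d x (belt_increment m n) = (C, D, is, js)"
    by (metis prod_cases4)
  let ?msg = "increment_message (C, D, is, js)"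
  have len: "length ?msg \<le> 104 * floor_log (n - m) + 250"
    using length_increment_message [OF assms, of H d x] ip by simp
  moreover have "floor_log (n - m) \<le> floor_log n" by (intro floor_log_le) simp
  moreover have "length C + length D \<le> length ?msg" by (simp add: increment_message_def)
  ultimately have "19 + 4 * (length C + length D) \<le> mem_bound n" by (simp add: mem_bound_def)
  then obtain t M' where M': "exec H d (mem_bound n) incr_cmd (M, ?msg, []) t (M', [], [])"
    "t \<le> incr_cost (length ?msg)"
    "fst (M' 4) = of_bool (increment_accepts H d (snd (M 2)) (snd (M 0)) (C, D, is, js))"
    "\<forall>a. even a \<and> a \<noteq> 4 \<longrightarrow> M' a = M a"
    using exec_increment by blast
  have "incr_cost (length ?msg) \<le> incr_cost (104 * floor_log (n - m) + 250)"
    using len by (rule incr_cost_mono)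
  then have "t \<le> time_bound (n - m)" using M'(2) unfolding time_bound_def by linarith
  moreover have "fits (mem_bound n) M'" using exec_fits [OF M'(1)] M by blast
  moreover have "fst (M' 4) = 1" using M'(3) M increment_accepts_belt [OF assms, of H d x] ip by simp
  ultimately show "\<exists>t M'. runs H d (mem_bound n) (increment_prog belt_scheme) M
          (increment_message (hash_increment_proof H d x (increment_choice belt_scheme m n))) t M' [] \<and>
        t \<le> time_bound (n - m) \<and> fits (mem_bound n) M' \<and> fst (M' 4) = 1 \<and>
        (\<forall>a. even a \<and> a \<noteq> 4 \<longrightarrow> M' a = M a)"
    using M' by (intro exI [of _ t] exI [of _ M']) (simp add: runs_def ip)
qed

lemma resyncs_belt:
  assumes "m < n"
  shows "resyncs_within H d x belt_scheme (mem_bound n) (time_bound (n - m)) m n"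
  unfolding resyncs_within_def
  using assms verifies_increment_belt retrieves_membership_belt updates_membership_belt
    updates_commitment_belt [of "mem_bound n" "time_bound (n - m)" H d x n]
  by (simp add: mem_bound_def time_bound_def)

lemma is_mmb_scheme_belt: "is_mmb_scheme belt_scheme"
  unfolding is_mmb_scheme_def verifies_correctly_def
proof (intro conjI allI impI)
  fix H d M and ip :: "hash increment_proof"
  obtain C D "is" js where ip: "ip = (C, D, is, js)" by (metis prod_cases4)
  show "\<exists>B t M'. runs H d B (increment_prog belt_scheme) M (increment_message ip) t M' [] \<and>
      fst (M' 4) = of_bool (increment_accepts H d (snd (M 2)) (snd (M 0)) ip)"
    unfolding ip runs_def belt_scheme_simps using exec_increment [OF order_refl] by blast
next
  fix H d M h \<pi>
  show "\<exists>B t M'. runs H d B (membership_prog belt_scheme) M ((0, h) # map step_token \<pi>) t M' [] \<and>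
      fst (M' 4) = of_bool (recompute H d h \<pi> = snd (M 0)) \<and> stores_proof H d M' h \<pi>"
    unfolding runs_def belt_scheme_simps using exec_member [OF order_refl] by blast
next
  fix H d M h \<pi> j \<pi>'
  assume "stores_proof H d M h \<pi> \<and> j \<le> length \<pi>"
  then show "\<exists>B t M'. runs H d B (update_prog belt_scheme) M ((j, []) # map step_token \<pi>') t M' [] \<and>
      fst (M' 4) = of_bool (recompute H d h (take j \<pi> @ \<pi>') = snd (M 0)) \<and>
      stores_proof H d M' h (take j \<pi> @ \<pi>')"
    unfolding runs_def belt_scheme_simps using exec_update [OF _ _ order_refl] by blast
next
  fix m n :: nat assume "1 \<le> m \<and> m < n"
  then show "is_increment_proof m n (increment_choice belt_scheme m n)"
    by (simp add: is_increment_proof_belt)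
qed

section \<open>The manager's memory along the appends\<close>

lemma manager_inv_0: "manager_inv lab (Suc 0) (\<lambda>_. (0, []))"
proof -
  have "slot (\<lambda>_. (0, [])) lab g (Suc 0 div 2 ^ g) w" for g w
  proof -
    have "Suc 0 div 2 ^ g \<le> Suc 0" by (rule div_le_dividend)
    then have "\<not> 3 \<le> Suc 0 div 2 ^ g" "\<not> 4 \<le> Suc 0 div 2 ^ g" by linarith+
    then show ?thesis by (simp add: slot_def)
  qed
  then show ?thesis by (simp add: manager_inv_def top_pair.simps)
qed

lemma append_step:
  assumes "manager_inv (label H d x) (Suc n) M" "fits (mem_bound n) M"
  shows "\<exists>t M' pub. exec H d (mem_bound (Suc n)) append_cmd (M, [(0, H (x (Suc n)))], []) t
      (M', [], pub @ commitment H d x (Suc n)) \<and> t \<le> cost_bound append_cmd \<and>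
    manager_inv (label H d x) (Suc (Suc n)) M' \<and> fits (mem_bound (Suc n)) M' \<and>
    label H d x ` (nodes (mmb (Suc n)) - nodes (mmb n)) \<subseteq> set (pub @ commitment H d x (Suc n))"
proof -
  obtain a j where N: "Suc (Suc n) = 2 ^ j * Suc (2 * a)" using odd_times_power by blast
  have "16 + 4 * j \<le> mem_bound (Suc n)" if "a \<noteq> 0"
  proof -
    \<comment> \<open>A merge needs \<open>a \<ge> 1\<close>, so
      \<open>3 * 2 ^ j \<le> n + 2\<close>, and its height is logarithmic.\<close>
    have "2 ^ j * 3 \<le> 2 ^ j * Suc (2 * a)" using that by (intro mult_le_mono2) simp
    moreover have "(1::nat) \<le> 2 ^ j" by simp
    ultimately have "2 ^ j \<le> Suc n" using N by linarith
    then have "j \<le> floor_log (Suc n)" by (rule le_floor_log)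
    then show ?thesis by (simp add: mem_bound_def)
  qed
  then obtain M' pub where M': "sem H d (mem_bound (Suc n)) append_cmd (M, [(0, H (x (Suc n)))], []) =
      Some (M', [], pub @ [label H d x (mmb (Suc n))])"
    "manager_inv (label H d x) (Suc (Suc n)) M'"
    "label H d x ` new_nodes (Suc n) a j \<subseteq> set (pub @ [label H d x (mmb (Suc n))])"
    using sem_append [OF assms(1) N, of "mem_bound (Suc n)"] by (auto simp: mem_bound_def)
  obtain t where t: "t \<le> cost_bound append_cmd" "exec H d (mem_bound (Suc n)) append_cmd
      (M, [(0, H (x (Suc n)))], []) t (M', [], pub @ [label H d x (mmb (Suc n))])"
    using exec_sem [OF M'(1)] by blast
  have "mem_bound n \<le> mem_bound (Suc n)" using mono_mem_bound by (simp add: mono_def)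
  then have "fits (mem_bound (Suc n)) M" using assms(2) by (simp add: fits_def)
  then have "fits (mem_bound (Suc n)) M'" using exec_fits [OF t(2)] by blast
  moreover have "commitment H d x (Suc n) = [label H d x (mmb (Suc n))]"
    by (simp add: commitment_def root_hash_def)
  moreover have "label H d x ` (nodes (mmb (Suc n)) - nodes (mmb n)) \<subseteq> set (pub @ commitment H d x (Suc n))"
    using nodes_mmb_Suc [OF N] M'(3) by (auto simp: commitment_def root_hash_def)
  ultimately show ?thesis using t M'(2) by metis
qed

lemma manager_memory_inv:
  "manager_memory H d x belt_scheme n M \<Longrightarrow> manager_inv (label H d x) (Suc n) M \<and> fits (mem_bound n) M"
proof (induction rule: manager_memory.induct)
  case 1
  then show ?case by (simp add: manager_inv_0 fits_def)
next
  case (2 n M B t M' pub)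
  then obtain t1 M1 pub1 where "exec H d (mem_bound (Suc n)) append_cmd (M, [(0, H (x (Suc n)))], []) t1
      (M1, [], pub1)" "manager_inv (label H d x) (Suc (Suc n)) M1" "fits (mem_bound (Suc n)) M1"
    using append_step by blast
  moreover have "exec H d B append_cmd (M, [(0, H (x (Suc n)))], []) t (M', [], pub)"
    using 2 by (simp add: runs_def)
  ultimately show ?case using exec_deterministic by blast
qed

lemma appends_belt:
  assumes "manager_memory H d x belt_scheme n M" "cost_bound append_cmd \<le> c"
  shows "appends_within H d x belt_scheme (mem_bound (Suc n)) c n M"
  using append_step [of H d x n M] manager_memory_inv [OF assms(1)] assms(2)
  unfolding appends_within_def runs_def belt_scheme_simps by (meson order_trans)

lemma verifies_increment_within_mono:
  "verifies_increment_within H d x P B c m n \<Longrightarrow> c \<le> c' \<Longrightarrow> verifies_increment_within H d x P B c' m n"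
  unfolding verifies_increment_within_def by (meson order_trans)

lemma succinct_belt: "succinct belt_scheme"
  unfolding succinct_def
proof (intro exI conjI allI impI)
  show "mono mem_bound" by (rule mono_mem_bound)
  show "polylogarithmic time_bound"
    unfolding polylogarithmic_def using time_bound_bigo by (intro exI [of _ 1]) simp
  fix H d x and n :: nat assume n: "1 \<le> n"
  show "updates_commitment_within H d x belt_scheme (mem_bound n) (time_bound n) n"
    by (rule updates_commitment_belt) (simp_all add: mem_bound_def time_bound_def)
  \<comment> \<open>With the empty list as the old state every element counts as new.\<close>
  show "retrieves_membership_within H d x belt_scheme (mem_bound n) (time_bound n) n i" if "1 \<le> i \<and> i \<le> n" for i
    using retrieves_membership_belt [of 0 i n H d x] that by simp
  show "verifies_increment_within H d x belt_scheme (mem_bound n) (time_bound n) m n" if "1 \<le> m \<and> m < n" for m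
    using that by (intro verifies_increment_within_mono [OF verifies_increment_belt] time_bound_mono) auto
qed

theorem theorem1:
  shows "\<exists>P. is_mmb_scheme P \<and> succinct P \<and> incremental P \<and> optimally_additive P \<and>
    (\<exists>(mem :: nat \<Rightarrow> nat) (T :: nat \<Rightarrow> nat) (c :: nat).
       mono mem \<and>
       (\<lambda>n. real (mem n)) \<in> O(\<lambda>n. ln (real n)) \<and>
       (\<lambda>k. real (T k)) \<in> O(\<lambda>k. ln (real k)) \<and>
       (\<forall>H d x.
          (\<forall>n. length (commitment H d x n) \<le> c) \<and>
          (\<forall>n M. manager_memory H d x P n M \<longrightarrow>
             fits (mem n) M \<and> appends_within H d x P (mem (Suc n)) c n M) \<and>
          (\<forall>m n. m < n \<longrightarrow> resyncs_within H d x P (mem n) (T (n - m)) m n)))"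
proof (intro exI [of _ belt_scheme] conjI)
  show "is_mmb_scheme belt_scheme" by (rule is_mmb_scheme_belt)
  show "succinct belt_scheme" by (rule succinct_belt)
  show "incremental belt_scheme"
    unfolding incremental_def using mono_mem_bound resyncs_belt by blast
  show "optimally_additive belt_scheme"
    unfolding optimally_additive_def using mono_mem_bound appends_belt by blast
  show "\<exists>(mem :: nat \<Rightarrow> nat) (T :: nat \<Rightarrow> nat) (c :: nat).
       mono mem \<and>
       (\<lambda>n. real (mem n)) \<in> O(\<lambda>n. ln (real n)) \<and>
       (\<lambda>k. real (T k)) \<in> O(\<lambda>k. ln (real k)) \<and>
       (\<forall>H d x.
          (\<forall>n. length (commitment H d x n) \<le> c) \<and>
          (\<forall>n M. manager_memory H d x belt_scheme n M \<longrightarrow>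
             fits (mem n) M \<and> appends_within H d x belt_scheme (mem (Suc n)) c n M) \<and>
          (\<forall>m n. m < n \<longrightarrow> resyncs_within H d x belt_scheme (mem n) (T (n - m)) m n))"
  proof (intro exI conjI allI impI)
    show "mono mem_bound" by (rule mono_mem_bound)
    show "(\<lambda>n. real (mem_bound n)) \<in> O(\<lambda>n. ln (real n))" by (rule mem_bound_bigo)
    show "(\<lambda>k. real (time_bound k)) \<in> O(\<lambda>k. ln (real k))" by (rule time_bound_bigo)
    fix H d x
    \<comment> \<open>The \<open>Suc\<close> lets the same constant bound the commitment, a single
      hash.\<close>
    show "length (commitment H d x n) \<le> Suc (cost_bound append_cmd)" for n
      by (simp add: commitment_def)
    show "fits (mem_bound n) M" "appends_within H d x belt_scheme (mem_bound (Suc n)) (Suc (cost_bound append_cmd)) n M"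
      if "manager_memory H d x belt_scheme n M" for n M
      using manager_memory_inv [OF that] appends_belt [OF that] by auto
    show "resyncs_within H d x belt_scheme (mem_bound n) (time_bound (n - m)) m n" if "m < n" for m n
      using that by (rule resyncs_belt)
  qed
qed

end
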